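(* Let $\{\lambda(t)\}_{t\ge0}$ be the intensity of a Hawkes process with parameters $\theta\ge0$, $\eta>0$, $\kappa>0$ and jump sizes of mean $\mu$ and variance $\psi^2$, and let $\{E_f(t)\}_{t\ge0}$ be an independent inverse Lévy subordinator with Bernstein function $f$. Suppose $\gamma=\kappa-\eta\mu>0$. Then for $t\ge 0$ the mean of $\lambda(E_f(t))$ is $$\mathbb{E}_0[\lambda(E_f(t))]=\Bigl(\lambda_0-\frac{\kappa\theta}{\gamma}\Bigr)\mathbb{E}[e^{-\gamma E_f(t)}]+\frac{\kappa\theta}{\gamma},$$ the variance is $$\mathbb{V}_0[\lambda(E_f(t))]=\frac{\rho_1\lambda_0+\rho_2}{\gamma}\Bigl[\mathbb{E}[e^{-\gamma E_f(t)}]-\mathbb{E}[e^{-2\gamma E_f(t)}]\Bigr]+\frac{\rho_2}{2\gamma}\,\mathbb{E}\bigl[e^{-2\gamma E_f(t)}-1\bigr]+\Bigl(\lambda_0-\frac{\kappa\theta}{\gamma}\Bigr)^2\mathbb{V}_0\bigl[e^{-\gamma E_f(t)}\bigr],$$ and for $0\le s\le t$ the covariance is $$\begin{aligned}\mathbb{C}_0(\lambda(E_f(t)),\lambda(E_f(s)))=\;&\frac{\rho_1\lambda_0+\rho_2}{\eta\mu-\kappa}\Bigl[\mathbb{E}_0\bigl[e^{-\gamma(E_f(t)+E_f(s))}\bigr]-\mathbb{E}_0\bigl[e^{-\gamma E_f(t)}\bigr]\Bigr]\\&+\frac{\rho_2}{2(\eta\mu-\kappa)}\Bigl[\mathbb{E}_0\bigl[e^{-\gamma(E_f(t)-E_f(s))}\bigr]-\mathbb{E}_0\bigl[e^{-\gamma(E_f(t)+E_f(s))}\bigr]\Bigr]\\&+\Bigl(\lambda_0+\frac{\kappa\theta}{\eta\mu-\kappa}\Bigr)^2\Bigl[\mathbb{E}_0\bigl[e^{-\gamma(E_f(t)+E_f(s))}\bigr]-\mathbb{E}_0\bigl[e^{-\gamma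 E_f(t)}\bigr]\mathbb{E}_0\bigl[e^{-\gamma E_f(s)}\bigr]\Bigr].\end{aligned}$$
   Context: Hawkes process: $\{(N_t,\lambda_t)\}_{t\ge0}$ (write $\lambda(t)=\lambda_t$), where $N_t$ is a counting process with stochastic intensity $\lambda_t$ satisfying $$\lambda_t=\theta+e^{-\kappa(t-s)}(\lambda_s-\theta)+\eta\int_s^t e^{-\kappa(t-u)}\,dP_u,\qquad t\ge s,$$ with $\theta\ge0$, $\eta>0$, $\kappa>0$ and $P_t=\sum_{i=1}^{N_t}\xi_i$, where $(\xi_i)$ are i.i.d. positive random variables with finite positive mean $\mu$ and finite variance $\psi^2$. $\mathbb{E}_0,\mathbb{V}_0,\mathbb{C}_0$ denote expectation, variance and covariance conditional on $\mathcal{F}_0$, the initial information of the Hawkes process (so $\lambda_0$ is treated as known). Inverse Lévy subordinator: $\{D_f(t)\}_{t\ge0}$ is a subordinator with $\mathbb{E}[e^{-sD_f(t)}]=e^{-tf(s)}$, $f(s)=a+bs+\int_0^\infty(1-e^{-sx})\upsilon(dx)$, $s>0$, where $a,b\ge0$ and $\upsilon$ is a non-negative Lévy measure on the positive half-line with $\int_0^\infty(x\wedge1)\upsilon(dx)<\infty$ and $\upsilon([0,\infty))=\infty$. Its right-continuous inverse is $E_f(t)=\inf\{r\ge0:D_f(r)>t\}$, independent of the Hawkes process. Constants: $\rho_1=\eta^2(\psi^2+\mu^2)$ and $\rho_2=\dfrac{\eta^2\kappa\theta(\psi^2+\mu^2)}{\eta\mu-\kappa}$.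
   Formalization: Besides being i.i.d., each jump size is assumed independent of everything strictly before its jump (the standard meaning of a marked Hawkes process); with i.i.d. jump sizes alone, which may depend on the waiting times, the stated formulas fail. *)

theory Defs
  imports "HOL-Probability.Probability"
begin

section \<open>Conditional second moments\<close>

definition cond_variance :: "'a measure \<Rightarrow> 'a measure \<Rightarrow> ('a \<Rightarrow> real) \<Rightarrow> 'a \<Rightarrow> real" where
  "cond_variance M G X = real_cond_exp M G (\<lambda>\<omega>. (X \<omega> - real_cond_exp M G X \<omega>)\<^sup>2)"

definition cond_covariance ::
  "'a measure \<Rightarrow> 'a measure \<Rightarrow> ('a \<Rightarrow> real) \<Rightarrow> ('a \<Rightarrow> real) \<Rightarrow> 'a \<Rightarrow> real" where
  "cond_covariance M G X Y =
     real_cond_exp M G (\<lambda>\<omega>. (X \<omega> - real_cond_exp M G X \<omega>) * (Y \<omega> - real_cond_exp M G Y \<omega>))"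


section \<open>Sigma-algebras generated by processes\<close>

definition generated_sigma :: "'a set \<Rightarrow> 'i set \<Rightarrow> ('i \<Rightarrow> 'a \<Rightarrow> 'b) \<Rightarrow> 'b measure \<Rightarrow> 'a measure" where
  "generated_sigma \<Omega> I X S = sigma \<Omega> {X i -` B \<inter> \<Omega> | i B. i \<in> I \<and> B \<in> sets S}"

text \<open>Time is real; all processes are used on the nonnegative half-line only.  The predictable
  sigma-algebra lives on the product of the positive half-line with the sample space.\<close>

definition predictable_sigma :: "'a set \<Rightarrow> (real \<Rightarrow> 'a measure) \<Rightarrow> (real \<times> 'a) measure" where
  "predictable_sigma \<Omega> F =
     sigma ({0<..} \<times> \<Omega>) {{u<..v} \<times> A | u v A. 0 \<le> u \<and> u \<le> v \<and> A \<in> sets (F u)}"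


section \<open>Counting processes and their intensities\<close>

locale counting_process = prob_space M + filtration "space M" F
  for M :: "'a measure" and F :: "real \<Rightarrow> 'a measure" and N :: "real \<Rightarrow> 'a \<Rightarrow> nat" +
  assumes filtration_subset: "\<And>t. sets (F t) \<subseteq> sets M"
    and N_adapted: "\<And>t. 0 \<le> t \<Longrightarrow> N t \<in> F t \<rightarrow>\<^sub>M count_space UNIV"
    and N_zero: "\<And>\<omega>. \<omega> \<in> space M \<Longrightarrow> N 0 \<omega> = 0"
    and N_mono: "\<And>\<omega> s t. \<omega> \<in> space M \<Longrightarrow> 0 \<le> s \<Longrightarrow> s \<le> t \<Longrightarrow> N s \<omega> \<le> N t \<omega>"
    and N_right_continuous: "\<And>\<omega> t. \<omega> \<in> space M \<Longrightarrow> 0 \<le> t \<Longrightarrow> continuous (at_right t) (\<lambda>u. N u \<omega>)"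
    \<comment> \<open>for a nondecreasing path this says that the jump at time \<open>t\<close> is at most one\<close>
    and N_unit_jumps: "\<And>\<omega> t. \<omega> \<in> space M \<Longrightarrow> 0 < t \<Longrightarrow> \<exists>s\<in>{0..<t}. N t \<omega> \<le> N s \<omega> + 1"

text \<open>The intensity in the sense of Bremaud: a nonnegative progressive process \<open>l\<close>, locally
  integrable in time, with
  \<open>E (\<integral>\<^sub>0\<^sup>\<infinity> C dN) = E (\<integral>\<^sub>0\<^sup>\<infinity> C u * l u du)\<close>
  for every nonnegative predictable process \<open>C\<close>.  The inner integral on the left is the
  Lebesgue-Stieltjes integral along the path of \<open>N\<close>; \<open>max 0\<close> extends the path by its initial value
  to negative times, as \<open>interval_measure\<close> expects a function on the whole line.\<close>

definition stochastic_intensity ::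
  "'a measure \<Rightarrow> (real \<Rightarrow> 'a measure) \<Rightarrow> (real \<Rightarrow> 'a \<Rightarrow> nat) \<Rightarrow> (real \<Rightarrow> 'a \<Rightarrow> real) \<Rightarrow> bool" where
  "stochastic_intensity M F N l \<longleftrightarrow>
     (\<forall>t\<ge>0. \<forall>\<omega>\<in>space M. 0 \<le> l t \<omega>) \<and>
     (\<forall>t\<ge>0. (\<lambda>(s, \<omega>). l s \<omega>) \<in> borel_measurable (restrict_space borel {0..t} \<Otimes>\<^sub>M F t)) \<and>
     (\<forall>t\<ge>0. AE \<omega> in M. (\<integral>\<^sup>+ s\<in>{0..t}. ennreal (l s \<omega>) \<partial>lborel) < \<infinity>) \<and>
     (\<forall>C :: real \<times> 'a \<Rightarrow> ennreal. C \<in> borel_measurable (predictable_sigma (space M) F) \<longrightarrow>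
        (\<integral>\<^sup>+ \<omega>. (\<integral>\<^sup>+ u\<in>{0<..}. C (u, \<omega>) \<partial>interval_measure (\<lambda>u. real (N (max 0 u) \<omega>))) \<partial>M) =
        (\<integral>\<^sup>+ \<omega>. (\<integral>\<^sup>+ u\<in>{0<..}. (C (u, \<omega>) * ennreal (l u \<omega>)) \<partial>lborel) \<partial>M))"

text \<open>With \<open>T\<^sub>n = inf {t. n \<le> N t}\<close> the time of the \<open>n\<close>-th jump, the strict past
  of \<open>T\<^sub>n\<close> is generated by the sets \<open>A \<inter> {t < T\<^sub>n}\<close> with \<open>A\<close> an event of the filtration at time
  \<open>t\<close>; here \<open>{t < T\<^sub>n}\<close> is \<open>{N t < n}\<close>.  For \<open>n \<ge> 1\<close> the sets with \<open>t = 0\<close> are the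
  events at time \<open>0\<close>, as \<open>N 0 = 0\<close>.\<close>

definition strict_past ::
  "'a measure \<Rightarrow> (real \<Rightarrow> 'a measure) \<Rightarrow> (real \<Rightarrow> 'a \<Rightarrow> nat) \<Rightarrow> nat \<Rightarrow> 'a measure" where
  "strict_past M F N n =
     sigma (space M) {A \<inter> {\<omega> \<in> space M. N t \<omega> < n} | t A. 0 \<le> t \<and> A \<in> sets (F t)}"


section \<open>Hawkes processes\<close>

definition compound_process :: "(real \<Rightarrow> 'a \<Rightarrow> nat) \<Rightarrow> (nat \<Rightarrow> 'a \<Rightarrow> real) \<Rightarrow> real \<Rightarrow> 'a \<Rightarrow> real" where
  "compound_process N \<xi> t \<omega> = (\<Sum>i=1..N t \<omega>. \<xi> i \<omega>)"

text \<open>The filtration is arbitrary, so that \<open>F 0\<close> may carry any initial information and the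
  initial intensity \<open>l 0\<close> is an \<open>F 0\<close>-measurable random variable.  The marks \<open>\<xi>\<close> are i.i.d.; being
  marks of the jumps, each \<open>\<xi> n\<close> is moreover independent of what happened strictly before the
  \<open>n\<close>-th jump.  (Full independence of \<open>\<xi>\<close> and \<open>N\<close> would be contradictory, since past marks
  influence future jumps through the intensity.)  The path integral with respect to the compound
  process over the interval from \<open>s\<close> to \<open>t\<close> includes a jump at \<open>t\<close> and excludes one at \<open>s\<close>, which
  makes \<open>l\<close> right-continuous.\<close>

locale hawkes_process = counting_process M F N
  for M :: "'a measure" and F :: "real \<Rightarrow> 'a measure" and N :: "real \<Rightarrow> 'a \<Rightarrow> nat" +
  fixes l :: "real \<Rightarrow> 'a \<Rightarrow> real" and \<xi> :: "nat \<Rightarrow> 'a \<Rightarrow> real"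
    and \<theta> \<eta> \<kappa> \<mu> \<psi> :: real
  assumes \<theta>_nonneg: "0 \<le> \<theta>" and \<eta>_pos: "0 < \<eta>" and \<kappa>_pos: "0 < \<kappa>"
    and \<xi>_indep: "indep_vars (\<lambda>_. borel) \<xi> {1..}"
    and \<xi>_identical: "\<And>i. 1 \<le> i \<Longrightarrow> distr M borel (\<xi> i) = distr M borel (\<xi> 1)"
    and \<xi>_pos: "\<And>i \<omega>. 1 \<le> i \<Longrightarrow> \<omega> \<in> space M \<Longrightarrow> 0 < \<xi> i \<omega>"
    and \<xi>_integrable: "integrable M (\<xi> 1)" and \<xi>_mean: "expectation (\<xi> 1) = \<mu>"
    and \<xi>_square_integrable: "integrable M (\<lambda>\<omega>. (\<xi> 1 \<omega>)\<^sup>2)" and \<xi>_variance: "variance (\<xi> 1) = \<psi>\<^sup>2"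
    and \<xi>_indep_past: "\<And>n. 1 \<le> n \<Longrightarrow>
      indep_set (sets (strict_past M F N n)) (sets (vimage_algebra (space M) (\<xi> n) borel))"
    and intensity: "stochastic_intensity M F N l"
    and intensity_eq: "\<And>\<omega> s t. \<omega> \<in> space M \<Longrightarrow> 0 \<le> s \<Longrightarrow> s \<le> t \<Longrightarrow>
      l t \<omega> = \<theta> + exp (- \<kappa> * (t - s)) * (l s \<omega> - \<theta>) +
        \<eta> * (LINT u:{s<..t}|interval_measure (\<lambda>v. compound_process N \<xi> (max 0 v) \<omega>).
               exp (- \<kappa> * (t - u)))"

definition hawkes_sigma ::
  "'a measure \<Rightarrow> (real \<Rightarrow> 'a measure) \<Rightarrow> (real \<Rightarrow> 'a \<Rightarrow> nat) \<Rightarrow> (real \<Rightarrow> 'a \<Rightarrow> real) \<Rightarrow> 'a measure" where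
  "hawkes_sigma M F N l =
     sigma (space M) (sets (F 0) \<union> sets (generated_sigma (space M) {0..} N (count_space UNIV))
                                \<union> sets (generated_sigma (space M) {0..} l borel))"


section \<open>Inverse subordinators\<close>

definition levy_bernstein :: "real \<Rightarrow> real \<Rightarrow> real measure \<Rightarrow> real \<Rightarrow> real" where
  "levy_bernstein a b \<nu> s = a + b * s + (LINT x:{0<..}|\<nu>. 1 - exp (- s * x))"

text \<open>As \<open>a > 0\<close> is admitted, the subordinator may be killed (at rate \<open>a\<close>): it takes values in
  \<open>[0, \<infinity>]\<close>, with \<open>\<infinity>\<close> absorbing, and on the event that it is finite at time \<open>r\<close> its increments after
  \<open>r\<close> are independent of the past and stationary.  For \<open>a = 0\<close> the value \<open>\<infinity>\<close> has probability zero.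
  The Laplace transform uses \<open>exp (- s * \<infinity>) = 0\<close>.\<close>

locale levy_subordinator = prob_space M
  for M :: "'a measure" +
  fixes D :: "real \<Rightarrow> 'a \<Rightarrow> ennreal" and a b :: real and \<nu> :: "real measure"
  assumes a_nonneg: "0 \<le> a" and b_nonneg: "0 \<le> b"
    and \<nu>_sets: "sets \<nu> = sets borel"
    and \<nu>_half_line: "emeasure \<nu> {..0} = 0"
    and \<nu>_levy: "(\<integral>\<^sup>+ x\<in>{0<..}. ennreal (min x 1) \<partial>\<nu>) < \<infinity>"
    and \<nu>_infinite: "emeasure \<nu> {0..} = \<infinity>"
    and D_measurable: "\<And>r. 0 \<le> r \<Longrightarrow> D r \<in> borel_measurable M"
    and D_zero: "\<And>\<omega>. \<omega> \<in> space M \<Longrightarrow> D 0 \<omega> = 0"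
    and D_mono: "\<And>\<omega> r q. \<omega> \<in> space M \<Longrightarrow> 0 \<le> r \<Longrightarrow> r \<le> q \<Longrightarrow> D r \<omega> \<le> D q \<omega>"
    and D_right_continuous: "\<And>\<omega> r. \<omega> \<in> space M \<Longrightarrow> 0 \<le> r \<Longrightarrow> continuous (at_right r) (\<lambda>q. D q \<omega>)"
    and D_increments: "\<And>r h A B. 0 \<le> r \<Longrightarrow> 0 \<le> h \<Longrightarrow>
      A \<in> sets (generated_sigma (space M) {0..r} D borel) \<Longrightarrow> B \<in> sets borel \<Longrightarrow>
      prob {\<omega> \<in> A. D r \<omega> < \<infinity> \<and> D (r + h) \<omega> - D r \<omega> \<in> B} =
      prob {\<omega> \<in> A. D r \<omega> < \<infinity>} * prob {\<omega> \<in> space M. D h \<omega> \<in> B}"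
    and D_laplace: "\<And>s r. 0 < s \<Longrightarrow> 0 \<le> r \<Longrightarrow>
      expectation (\<lambda>\<omega>. if D r \<omega> = \<infinity> then 0 else exp (- s * enn2real (D r \<omega>))) =
      exp (- r * levy_bernstein a b \<nu> s)"

text \<open>The infimum is taken in \<open>[0, \<infinity>]\<close>; it is finite almost surely for a subordinator as above,
  and \<open>enn2real\<close> assigns \<open>0\<close> on the remaining null event.\<close>

definition inverse_process :: "(real \<Rightarrow> 'a \<Rightarrow> ennreal) \<Rightarrow> real \<Rightarrow> 'a \<Rightarrow> real" where
  "inverse_process D t \<omega> = enn2real (INF r\<in>{r. 0 \<le> r \<and> ennreal t < D r \<omega>}. ennreal r)"

end

theory Submission
  imports Defs
begin

text \<open>Write \<open>c = \<kappa>\<theta>/\<gamma>\<close> for the long-run mean of the intensity.  The mean and the covariance come from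
  three facts.

  First, between jumps the intensity relaxes to \<open>\<theta>\<close> at rate \<open>\<kappa>\<close>, and a jump adds \<open>\<eta>\<xi>\<close>.  The mark of a jump
  is independent of the strict past of that jump, and jumps occur at the rate \<open>l\<close>; together this is
  Campbell's formula (\<open>campbell_formula\<close>), which turns the expectation of a sum over jumps of a
  predictable weight times a function of the mark into a time integral.  Applied to the path formula of
  \<open>l\<close> it gives, for every nonnegative weight \<open>Z\<close> known at time \<open>s\<close>, a linear Volterra equation for
  \<open>E (Z * l t)\<close> (\<open>mean_equation\<close>).  Applied to the telescoped square of the path it gives one for
  \<open>E (Z * (l t - \<theta>)\<^sup>2)\<close> (\<open>second_moment_equation\<close>).

  Second, the kernels are \<open>exp (- \<kappa> (t - u))\<close> and \<open>exp (- 2 \<kappa> (t - u))\<close>, whose total masses are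
  \<open>1/\<kappa>\<close> and \<open>1/(2\<kappa>)\<close>, while the unknown enters with the factors \<open>\<eta>\<mu>\<close> and \<open>2\<eta>\<mu>\<close>.  As \<open>\<eta>\<mu> < \<kappa>\<close>, both
  equations are contractions in the supremum norm.  For the process truncated after finitely many jumps
  this yields moment bounds that do not depend on the truncation (\<open>mean_bounded\<close>,
  \<open>second_moment_bounded\<close>); for the process itself it yields uniqueness, so that the moments are the
  explicit solutions (\<open>mean_solution\<close>, \<open>second_moment_solution\<close>).  The weight \<open>Z = 1\<^sub>B\<close> with \<open>B\<close> an initial
  event gives the conditional mean and variance, and the weight \<open>Z = 1\<^sub>B * l s\<close> at time \<open>s\<close> gives the
  conditional product moment \<open>E\<^sub>0 (l s * l t)\<close>.

  Third, the time change is independent of the Hawkes process, so its values can be frozen while the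
  Hawkes process is integrated (\<open>nn_integral_time_change\<close>).  What remains are expectations of
  exponentials of \<open>E t\<close>, \<open>E t + E s\<close> and \<open>E t - E s\<close>; the last one is bounded because \<open>E\<close> is almost surely
  nondecreasing (\<open>inverse_process_mono\<close>), as the subordinator exceeds every level.  The variance is the
  covariance at equal times.

  The initial intensity is an arbitrary nonnegative random variable known at time \<open>0\<close>.  Conditional
  moments are therefore computed on initial events on which it is bounded, for nonnegative integrands,
  and signed integrands enter only through the difference of two nonnegative ones with finite
  conditional expectations (\<open>real_cond_exp_diff_nonneg\<close>).\<close>

section \<open>Independence and conditional expectations\<close>

text \<open>Independence of two sigma-algebras says that the diagonal map sends the measure to the product
  measure, so the two arguments can be integrated one after the other.  This separates a mark from the
  past of its jump, and the random time change from the Hawkes process.\<close>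

lemma (in prob_space) indep_set_nn_integral_pair:
  assumes indep: "indep_set (sets G) (sets H)"
    and G: "space G = space M" and H: "space H = space M"
    and f: "f \<in> borel_measurable (G \<Otimes>\<^sub>M H)"
  shows "(\<integral>\<^sup>+x. f (x, x) \<partial>M) = (\<integral>\<^sup>+x. \<integral>\<^sup>+y. f (x, y) \<partial>M \<partial>M)"
proof -
  have sub: "sets G \<subseteq> events" "sets H \<subseteq> events"
    using indep by (auto simp: indep_sets2_eq)
  have idG: "(\<lambda>x. x) \<in> M \<rightarrow>\<^sub>M G" and idH: "(\<lambda>x. x) \<in> M \<rightarrow>\<^sub>M H"
    using sub G H by (auto intro!: measurableI simp: Int_absorb2[OF sets.sets_into_space])
  have ss: "sigma_sets (space M) {(\<lambda>x. x) -` A \<inter> space M |A. A \<in> sets K} = sets K"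
    if "space K = space M" for K :: "'a measure"
  proof -
    have "{(\<lambda>x. x) -` A \<inter> space M |A. A \<in> sets K} = (\<lambda>A. A \<inter> space K) ` sets K"
      by (simp add: that setcompr_eq_image)
    also have "\<dots> = (\<lambda>A. A) ` sets K"
      by (intro image_cong refl Int_absorb2 sets.sets_into_space)
    finally have "{(\<lambda>x. x) -` A \<inter> space M |A. A \<in> sets K} = sets K"
      by simp
    then show ?thesis
      using sets.sigma_sets_eq[of K] that by simp
  qed
  have "indep_var G (\<lambda>x. x) H (\<lambda>x. x)"
    unfolding indep_var_eq ss[OF G] ss[OF H] using indep idG idH by simp
  then have eq: "distr M G (\<lambda>x. x) \<Otimes>\<^sub>M distr M H (\<lambda>x. x) = distr M (G \<Otimes>\<^sub>M H) (\<lambda>x. (x, x))"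
    by (simp add: indep_var_distribution_eq)
  interpret H: prob_space "distr M H (\<lambda>x. x)"
    by (rule prob_space_distr[OF idH])
  have f': "f \<in> borel_measurable (distr M G (\<lambda>x. x) \<Otimes>\<^sub>M distr M H (\<lambda>x. x))"
    using f by (simp add: eq)
  have "(\<integral>\<^sup>+x. f (x, x) \<partial>M) = (\<integral>\<^sup>+p. f p \<partial>distr M (G \<Otimes>\<^sub>M H) (\<lambda>x. (x, x)))"
    using f idG idH by (subst nn_integral_distr) auto
  also have "\<dots> = (\<integral>\<^sup>+x. \<integral>\<^sup>+y. f (x, y) \<partial>distr M H (\<lambda>x. x) \<partial>distr M G (\<lambda>x. x))"
    unfolding eq[symmetric] by (rule H.nn_integral_fst[OF f', symmetric])
  also have "\<dots> = (\<integral>\<^sup>+x. \<integral>\<^sup>+y. f (x, y) \<partial>distr M H (\<lambda>x. x) \<partial>M)"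
    using H.borel_measurable_nn_integral_fst[OF f'] idG by (subst nn_integral_distr) auto
  also have "\<dots> = (\<integral>\<^sup>+x. \<integral>\<^sup>+y. f (x, y) \<partial>M \<partial>M)"
  proof (rule nn_integral_cong)
    fix x assume "x \<in> space M"
    then have "(\<lambda>y. f (x, y)) \<in> borel_measurable H"
      using G by (intro measurable_Pair2[OF f]) auto
    then show "(\<integral>\<^sup>+y. f (x, y) \<partial>distr M H (\<lambda>x. x)) = (\<integral>\<^sup>+y. f (x, y) \<partial>M)"
      using idH by (subst nn_integral_distr) auto
  qed
  finally show ?thesis .
qed

text \<open>Integrability of \<open>f\<close> and \<open>g\<close> is replaced by finiteness of their conditional expectations: the
  identity \<open>(f - g)\<^sup>+ + g = (f - g)\<^sup>- + f\<close> is additive under nonnegative conditional expectation, and all four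
  terms are finite.\<close>

lemma (in sigma_finite_subalgebra) real_cond_exp_diff_nonneg:
  assumes [measurable]: "f \<in> borel_measurable M" "g \<in> borel_measurable M"
    and nonneg: "\<And>x. x \<in> space M \<Longrightarrow> 0 \<le> f x" "\<And>x. x \<in> space M \<Longrightarrow> 0 \<le> g x"
    and finite: "AE x in M. nn_cond_exp M F (\<lambda>x. ennreal (f x)) x = ennreal (u x)"
      "AE x in M. nn_cond_exp M F (\<lambda>x. ennreal (g x)) x = ennreal (v x)"
    and uv: "\<And>x. x \<in> space M \<Longrightarrow> 0 \<le> u x" "\<And>x. x \<in> space M \<Longrightarrow> 0 \<le> v x"
  shows "AE x in M. real_cond_exp M F (\<lambda>x. f x - g x) x = u x - v x"
proof -
  define p where "p x = ennreal (f x - g x)" for x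
  define n where "n x = ennreal (- (f x - g x))" for x
  have [measurable]: "p \<in> borel_measurable M" "n \<in> borel_measurable M"
    unfolding p_def n_def by measurable
  have split: "p x + ennreal (g x) = n x + ennreal (f x)" if "x \<in> space M" for x
    unfolding p_def n_def using nonneg[OF that]
    by (smt (verit) add.commute add_0 ennreal_neg ennreal_plus)
  have "AE x in M. nn_cond_exp M F p x + nn_cond_exp M F (\<lambda>x. ennreal (g x)) x =
      nn_cond_exp M F (\<lambda>x. p x + ennreal (g x)) x"
    by (rule nn_cond_exp_sum) auto
  moreover have "AE x in M. nn_cond_exp M F n x + nn_cond_exp M F (\<lambda>x. ennreal (f x)) x =
      nn_cond_exp M F (\<lambda>x. n x + ennreal (f x)) x"
    by (rule nn_cond_exp_sum) auto
  moreover have "AE x in M. nn_cond_exp M F (\<lambda>x. p x + ennreal (g x)) x =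
      nn_cond_exp M F (\<lambda>x. n x + ennreal (f x)) x"
    by (rule nn_cond_exp_cong) (auto simp: split)
  moreover have "AE x in M. nn_cond_exp M F p x \<le> nn_cond_exp M F (\<lambda>x. ennreal (f x)) x"
    by (rule nn_cond_exp_mono) (auto simp: p_def nonneg intro!: AE_I2 ennreal_leI)
  moreover have "AE x in M. nn_cond_exp M F n x \<le> nn_cond_exp M F (\<lambda>x. ennreal (g x)) x"
    by (rule nn_cond_exp_mono) (auto simp: n_def nonneg intro!: AE_I2 ennreal_leI)
  ultimately show ?thesis
    using finite AE_space
  proof eventually_elim
    case (elim x)
    note uv = uv[OF elim(8)]
    define P where "P = enn2real (nn_cond_exp M F p x)"
    define Q where "Q = enn2real (nn_cond_exp M F n x)"
    have P: "nn_cond_exp M F p x = ennreal P" 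
      unfolding P_def using elim(4,6) by (metis ennreal_enn2real ennreal_less_top le_less_trans)
    have Q: "nn_cond_exp M F n x = ennreal Q" 
      unfolding Q_def using elim(5,7) by (metis ennreal_enn2real ennreal_less_top le_less_trans)
    have PQ: "0 \<le> P" "0 \<le> Q" by (auto simp: P_def Q_def)
    have "ennreal (P + v x) = ennreal (Q + u x)"
      using elim P Q PQ uv by (simp add: ennreal_plus)
    then have "P + v x = Q + u x"
      using PQ uv by (subst (asm) ennreal_inj) auto
    then show ?case
      unfolding real_cond_exp_def P_def Q_def p_def n_def by simp
  qed
qed

lemma (in prob_space) nn_cond_exp_independent:
  assumes indep: "indep_set (sets G) (sets H)" and G: "space G = space M" and H: "space H = space M"
    and F0: "subalgebra H F0" and f: "f \<in> borel_measurable G"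
  shows "AE \<omega> in M. nn_cond_exp M F0 f \<omega> = (\<integral>\<^sup>+x. f x \<partial>M)"
proof -
  have sub: "subalgebra M G" "subalgebra M H"
    using indep G H by (auto simp: indep_sets2_eq subalgebra_def)
  then have F0_M: "subalgebra M F0"
    using F0 by (auto simp: subalgebra_def)
  interpret finite_measure_subalgebra M F0
    by (unfold_locales) (rule F0_M)
  have f_M: "f \<in> borel_measurable M"
    using measurable_from_subalg[OF sub(1) f] .
  have "AE \<omega> in M. (\<integral>\<^sup>+x. f x \<partial>M) = nn_cond_exp M F0 f \<omega>"
  proof (rule nn_cond_exp_charact)
    fix A assume A: "A \<in> sets F0"
    then have [measurable]: "A \<in> sets H" "A \<in> sets M"
      using F0 F0_M by (auto simp: subalgebra_def)
    note [measurable] = f f_M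
    have "(\<integral>\<^sup>+x\<in>A. f x \<partial>M) = (\<integral>\<^sup>+x. \<integral>\<^sup>+y. f x * indicator A y \<partial>M \<partial>M)"
      using indep_set_nn_integral_pair[OF indep G H, of "\<lambda>(x, y). f x * indicator A y"] by simp
    also have "\<dots> = (\<integral>\<^sup>+y\<in>A. (\<integral>\<^sup>+x. f x \<partial>M) \<partial>M)"
      by (simp add: nn_integral_cmult nn_integral_multc)
    finally show "(\<integral>\<^sup>+x\<in>A. f x \<partial>M) = (\<integral>\<^sup>+y\<in>A. (\<integral>\<^sup>+x. f x \<partial>M) \<partial>M)" .
  qed (use f_M in auto)
  then show ?thesis
    by eventually_elim simp
qed

lemma (in prob_space) real_cond_exp_independent:
  assumes indep: "indep_set (sets G) (sets H)" and G: "space G = space M" and H: "space H = space M"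
    and F0: "subalgebra H F0" and f: "f \<in> borel_measurable G" and int: "integrable M f"
  shows "AE \<omega> in M. real_cond_exp M F0 f \<omega> = expectation f"
proof -
  have "AE \<omega> in M. nn_cond_exp M F0 (\<lambda>x. ennreal (f x)) \<omega> = (\<integral>\<^sup>+x. ennreal (f x) \<partial>M)"
    "AE \<omega> in M. nn_cond_exp M F0 (\<lambda>x. ennreal (- f x)) \<omega> = (\<integral>\<^sup>+x. ennreal (- f x) \<partial>M)"
    using f by (intro nn_cond_exp_independent[OF indep G H F0]; simp)+
  then show ?thesis
    unfolding real_lebesgue_integral_def[OF int] real_cond_exp_def by eventually_elim simp
qed

section \<open>Volterra equations with an exponential kernel\<close>

abbreviation exp_convolution :: "real \<Rightarrow> real \<Rightarrow> real \<Rightarrow> (real \<Rightarrow> ennreal) \<Rightarrow> ennreal" where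
  "exp_convolution k s t f \<equiv> \<integral>\<^sup>+u\<in>{s..t}. ennreal (exp (- k * (t - u))) * f u \<partial>lborel"

lemma nn_integral_exp_kernel_le:
  assumes "0 < (k::real)" "s \<le> t"
  shows "(\<integral>\<^sup>+u\<in>{s..t}. ennreal (exp (- k * (t - u))) \<partial>lborel) \<le> ennreal (1 / k)"
proof -
  have "(\<integral>\<^sup>+u\<in>{s..t}. ennreal (exp (- k * (t - u))) \<partial>lborel) =
      ennreal (exp (- k * (t - t)) / k - exp (- k * (t - s)) / k)"
    using assms
    by (intro nn_integral_FTC_Icc) (auto intro!: derivative_eq_intros)
  also have "\<dots> \<le> ennreal (1 / k)"
    using assms by (intro ennreal_leI) auto
  finally show ?thesis .
qed

lemma exp_convolution_le:
  assumes k: "0 < k" and t: "s \<le> t" and K: "0 \<le> K" "\<And>u. s \<le> u \<Longrightarrow> f u \<le> ennreal K"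
  shows "exp_convolution k s t f \<le> ennreal (K * (1 / k))"
proof -
  have "exp_convolution k s t f \<le> (\<integral>\<^sup>+u. ennreal K * (ennreal (exp (- k * (t - u))) * indicator {s..t} u) \<partial>lborel)"
    using K(2) by (intro nn_integral_mono)
      (auto simp: mult.commute[of "ennreal K"] intro: mult_left_mono split: split_indicator)
  also have "\<dots> = ennreal K * (\<integral>\<^sup>+u\<in>{s..t}. ennreal (exp (- k * (t - u))) \<partial>lborel)"
    by (rule nn_integral_cmult) auto
  also have "\<dots> \<le> ennreal K * ennreal (1 / k)"
    using k t by (intro mult_left_mono nn_integral_exp_kernel_le) auto
  also have "\<dots> = ennreal (K * (1 / k))"
    using K(1) by (rule ennreal_mult'[symmetric])
  finally show ?thesis .
qed

text \<open>Since the kernel has mass at most \<open>1/k\<close>, the supremum \<open>\<sigma>\<close> of \<open>w\<close> satisfies \<open>\<sigma> \<le> b + a \<sigma> / k\<close>.  The bound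
  \<open>K\<close> only makes \<open>\<sigma>\<close> finite, so that it can be absorbed, and does not enter the conclusion; this is
  what makes estimates for truncated processes uniform in the truncation.\<close>

lemma volterra_contraction_bound:
  fixes w :: "real \<Rightarrow> ennreal"
  assumes a: "0 \<le> a" "a < k" and b: "0 \<le> b"
    and bounded: "\<And>t. s \<le> t \<Longrightarrow> w t \<le> ennreal K"
    and step: "\<And>t. s \<le> t \<Longrightarrow> w t \<le> ennreal b +
      ennreal a * exp_convolution k s t w"
    and t: "s \<le> t"
  shows "w t \<le> ennreal (b * k / (k - a))"
proof -
  define S where "S = (SUP t\<in>{s..}. w t)"
  have "S \<le> ennreal K"
    unfolding S_def using bounded by (auto intro: SUP_least)
  then obtain \<sigma> where \<sigma>: "S = ennreal \<sigma>" "0 \<le> \<sigma>"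
    by (cases S) (auto simp: top_unique)
  have le: "w t \<le> ennreal (b + a * (\<sigma> / k))" if t: "s \<le> t" for t
  proof -
    have "exp_convolution k s t w \<le> ennreal (\<sigma> * (1 / k))"
      using a t \<sigma>(2) by (intro exp_convolution_le) (auto simp: \<sigma>(1)[symmetric] S_def intro: SUP_upper)
    then have "w t \<le> ennreal b + ennreal a * ennreal (\<sigma> * (1 / k))"
      using step[OF t] by (meson add_left_mono dual_order.trans mult_left_mono zero_le)
    also have "\<dots> = ennreal (b + a * (\<sigma> / k))"
      using a b \<sigma> by (subst ennreal_mult[symmetric]) (auto simp flip: ennreal_plus)
    finally show ?thesis .
  qed
  have "ennreal \<sigma> \<le> ennreal (b + a * (\<sigma> / k))"
    unfolding \<sigma>(1)[symmetric] S_def using le by (auto intro: SUP_least)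
  then have "\<sigma> \<le> b + a * (\<sigma> / k)"
    using a b \<sigma> by (subst (asm) ennreal_le_iff) auto
  then have "\<sigma> \<le> b * k / (k - a)"
    using a by (simp add: field_simps)
  moreover have "w t \<le> ennreal \<sigma>"
    unfolding \<sigma>(1)[symmetric] S_def using t by (auto intro: SUP_upper)
  ultimately show ?thesis
    using ennreal_leI order_trans by blast
qed

text \<open>By variation of constants \<open>g\<close> solves the same integral equation as \<open>f\<close>, and the difference of two
  bounded solutions satisfies the contraction estimate with \<open>b = 0\<close>.\<close>

lemma linear_volterra_solution:
  fixes f g h :: "real \<Rightarrow> real"
  assumes a: "0 \<le> a" "a < k"
    and f_bound: "\<And>t. s \<le> t \<Longrightarrow> \<bar>f t\<bar> \<le> K"
    and f_integrable: "\<And>t. s \<le> t \<Longrightarrow> set_integrable lborel {s..t} (\<lambda>u. exp (- k * (t - u)) * f u)"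
    and f_eq: "\<And>t. s \<le> t \<Longrightarrow> f t = exp (- k * (t - s)) * f s +
      (LINT u:{s..t}|lborel. exp (- k * (t - u)) * (a * f u + h u))"
    and g_bound: "\<And>t. s \<le> t \<Longrightarrow> \<bar>g t\<bar> \<le> L"
    and g_deriv: "\<And>t. (g has_real_derivative - k * g t + (a * g t + h t)) (at t)"
    and h: "continuous_on UNIV h"
    and start: "g s = f s"
    and t: "s \<le> t"
  shows "f t = g t"
proof -
  have g_cont: "continuous_on UNIV g"
    using g_deriv by (meson DERIV_isCont continuous_at_imp_continuous_on)
  have int_cont: "set_integrable lborel {s..t} (\<lambda>u. exp (- k * (t - u)) * r u)"
    if "continuous_on UNIV r" for r t
    using that by (intro borel_integrable_atLeastAtMost' continuous_intros continuous_on_subset[OF that]) auto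
  have g_eq: "g t = exp (- k * (t - s)) * g s +
      (LINT u:{s..t}|lborel. exp (- k * (t - u)) * (a * g u + h u))" if t: "s \<le> t" for t
  proof -
    have "(LINT u|lborel. (exp (- k * (t - u)) * (a * g u + h u)) * indicator {s..t} u) =
        exp (- k * (t - t)) * g t - exp (- k * (t - s)) * g s"
    proof (rule integral_FTC_Icc_real[OF t])
      fix u
      show "((\<lambda>u. exp (- k * (t - u)) * g u) has_real_derivative exp (- k * (t - u)) * (a * g u + h u)) (at u)"
        by (rule derivative_eq_intros g_deriv refl | simp add: algebra_simps)+
      show "isCont (\<lambda>u. exp (- k * (t - u)) * (a * g u + h u)) u"
        using g_cont h by (intro continuous_intros) (auto simp: continuous_on_eq_continuous_at)
    qed
    then show ?thesis
      by (simp add: set_lebesgue_integral_def mult.commute)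
  qed
  have diff: "f t - g t = a * (LINT u:{s..t}|lborel. exp (- k * (t - u)) * (f u - g u))" if t: "s \<le> t" for t
  proof -
    have lin: "(LINT u:{s..t}|lborel. exp (- k * (t - u)) * (a * r u + h u)) =
        a * (LINT u:{s..t}|lborel. exp (- k * (t - u)) * r u) + (LINT u:{s..t}|lborel. exp (- k * (t - u)) * h u)"
      if "set_integrable lborel {s..t} (\<lambda>u. exp (- k * (t - u)) * r u)" for r
    proof -
      have "(\<lambda>u. exp (- k * (t - u)) * (a * r u + h u)) =
          (\<lambda>u. a * (exp (- k * (t - u)) * r u) + exp (- k * (t - u)) * h u)"
        by (simp add: fun_eq_iff algebra_simps)
      then show ?thesis
        using set_integral_add(2)[OF set_integrable_mult_right[of a, OF that] int_cont[OF h]] by simp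
    qed
    have sub: "(LINT u:{s..t}|lborel. exp (- k * (t - u)) * (f u - g u)) =
        (LINT u:{s..t}|lborel. exp (- k * (t - u)) * f u) - (LINT u:{s..t}|lborel. exp (- k * (t - u)) * g u)"
      using set_integral_diff(2)[OF f_integrable[OF t] int_cont[OF g_cont]] by (simp add: right_diff_distrib)
    show ?thesis
      unfolding f_eq[OF t] g_eq[OF t] lin[OF f_integrable[OF t]] lin[OF int_cont[OF g_cont]] sub start by (simp add: algebra_simps)
  qed
  have "ennreal \<bar>f t - g t\<bar> \<le> ennreal (0 * k / (k - a))"
  proof (rule volterra_contraction_bound[where s = s and w = "\<lambda>t. ennreal \<bar>f t - g t\<bar>" and K = "K + L", OF a order_refl _ _ t])
    fix t assume t: "s \<le> t"
    show "ennreal \<bar>f t - g t\<bar> \<le> ennreal (K + L)"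
      using f_bound[OF t] g_bound[OF t] by (intro ennreal_leI) linarith
    let ?i = "\<lambda>u. indicator {s..t} u *\<^sub>R (exp (- k * (t - u)) * (f u - g u))"
    have int: "integrable lborel ?i"
      using set_integral_diff(1)[OF f_integrable[OF t] int_cont[OF g_cont]]
      by (simp add: right_diff_distrib set_integrable_def)
    have "ennreal \<bar>f t - g t\<bar> = ennreal a * ennreal \<bar>LINT u|lborel. ?i u\<bar>"
      unfolding diff[OF t] set_lebesgue_integral_def using a by (simp add: abs_mult ennreal_mult)
    also have "\<dots> \<le> ennreal a * (\<integral>\<^sup>+u. ennreal \<bar>?i u\<bar> \<partial>lborel)"
      using integral_norm_bound_ennreal[OF int] by (intro mult_left_mono) auto
    also have "(\<integral>\<^sup>+u. ennreal \<bar>?i u\<bar> \<partial>lborel) =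
        (\<integral>\<^sup>+u\<in>{s..t}. ennreal (exp (- k * (t - u))) * ennreal \<bar>f u - g u\<bar> \<partial>lborel)"
      by (intro nn_integral_cong) (auto simp: indicator_def abs_mult ennreal_mult)
    finally show "ennreal \<bar>f t - g t\<bar> \<le> ennreal 0 + ennreal a *
        (\<integral>\<^sup>+u\<in>{s..t}. ennreal (exp (- k * (t - u))) * ennreal \<bar>f u - g u\<bar> \<partial>lborel)"
      by simp
  qed
  then show ?thesis by simp
qed

lemma kernel_integral:
  fixes f :: "real \<Rightarrow> real"
  assumes f: "f \<in> borel_measurable borel" and k: "0 \<le> k"
    and bound: "\<And>u. u \<in> {s..t} \<Longrightarrow> 0 \<le> f u \<and> f u \<le> K"
  shows "set_integrable lborel {s..t} (\<lambda>u. exp (- k * (t - u)) * f u)" (is ?int)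
    and "(\<integral>\<^sup>+u\<in>{s..t}. ennreal (exp (- k * (t - u))) * ennreal (f u) \<partial>lborel) =
      ennreal (LINT u:{s..t}|lborel. exp (- k * (t - u)) * f u)" (is ?eq)
proof -
  let ?g = "\<lambda>u. indicator {s..t} u *\<^sub>R (exp (- k * (t - u)) * f u)"
  have int: "integrable lborel ?g"
  proof (rule integrableI_bounded_set[where A = "{s..t}" and B = K])
    show "AE u\<in>{s..t} in lborel. norm (?g u) \<le> K"
    proof (intro AE_I2 impI)
      fix u assume u: "u \<in> {s..t}"
      have "exp (- k * (t - u)) * f u \<le> 1 * f u"
        using k u bound[OF u] by (intro mult_right_mono) auto
      then show "norm (?g u) \<le> K"
        using u bound[OF u] by (simp add: abs_mult)
    qed
    show "?g \<in> borel_measurable lborel"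
      using f by measurable
  qed (auto simp: emeasure_lborel_Icc_eq)
  then show ?int
    by (simp add: set_integrable_def)
  have "(\<integral>\<^sup>+u\<in>{s..t}. ennreal (exp (- k * (t - u))) * ennreal (f u) \<partial>lborel) = (\<integral>\<^sup>+u. ennreal (?g u) \<partial>lborel)"
    using bound by (intro nn_integral_cong) (auto simp: ennreal_mult split: split_indicator)
  also have "\<dots> = ennreal (\<integral>u. ?g u \<partial>lborel)"
    using bound by (intro nn_integral_eq_integral int AE_I2) (auto split: split_indicator)
  finally show ?eq
    by (simp add: set_lebesgue_integral_def)
qed

section \<open>Paths of counting processes\<close>

text \<open>A single path of a counting process.  In this form the bookkeeping of jumps involves no
  probability.\<close>

locale counting_path =
  fixes n :: "real \<Rightarrow> nat"
  assumes zero: "n 0 = 0"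
    and mono: "\<And>s t. 0 \<le> s \<Longrightarrow> s \<le> t \<Longrightarrow> n s \<le> n t"
    and right_continuous: "\<And>t. 0 \<le> t \<Longrightarrow> continuous (at_right t) n"
    and unit_jumps: "\<And>t. 0 < t \<Longrightarrow> \<exists>s\<in>{0..<t}. n t \<le> n s + 1"

definition reached :: "(real \<Rightarrow> nat) \<Rightarrow> nat \<Rightarrow> bool" where
  "reached n k \<longleftrightarrow> (\<exists>t\<ge>0. k \<le> n t)"

text \<open>Only meaningful if \<open>n\<close> reaches \<open>k\<close>; otherwise it is the infimum of the empty set.\<close>

definition jump_time :: "(real \<Rightarrow> nat) \<Rightarrow> nat \<Rightarrow> real" where
  "jump_time n k = Inf {t. 0 \<le> t \<and> k \<le> n t}"

text \<open>The left limit of the path.  The value \<open>0\<close> is inserted so that the maximum also exists for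
  \<open>u = 0\<close>, where it agrees with the count.\<close>

definition left_count :: "(real \<Rightarrow> nat) \<Rightarrow> real \<Rightarrow> nat" where
  "left_count n u = Max (insert 0 (n ` {0..<u}))"

text \<open>The integral of \<open>f\<close> along the jumps of the path.  The summand receives the index of the jump besides
  its time, so that marks can be attached; jumps that never occur contribute nothing.\<close>

definition jump_sum :: "(real \<Rightarrow> nat) \<Rightarrow> (nat \<Rightarrow> real \<Rightarrow> ennreal) \<Rightarrow> ennreal" where
  "jump_sum n f = (\<Sum>k. if reached n (Suc k) then f (Suc k) (jump_time n (Suc k)) else 0)"

context counting_path
begin

lemma locally_constant:
  assumes "0 \<le> t"
  obtains b where "t < b" "\<And>u. t \<le> u \<Longrightarrow> u < b \<Longrightarrow> n u = n t"
proof -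
  have "eventually (\<lambda>u. n u = n t) (at_right t)"
    using right_continuous[OF assms] by (simp add: continuous_within tendsto_discrete)
  then obtain b where "t < b" "\<And>u. t < u \<Longrightarrow> u < b \<Longrightarrow> n u = n t"
    by (auto simp: eventually_at_right_field)
  then show thesis
    using that by (metis order_le_less)
qed

lemma jump_time_nonneg: "reached n k \<Longrightarrow> 0 \<le> jump_time n k"
  unfolding jump_time_def reached_def by (intro cInf_greatest) auto

lemma jump_time_le_iff:
  assumes k: "reached n k" and t: "0 \<le> t"
  shows "jump_time n k \<le> t \<longleftrightarrow> k \<le> n t"
proof
  assume "k \<le> n t"
  then show "jump_time n k \<le> t"
    unfolding jump_time_def using t by (intro cInf_lower bdd_belowI[of _ 0]) auto
next
  assume le: "jump_time n k \<le> t"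
  note nonneg = jump_time_nonneg[OF k]
  obtain b where b: "jump_time n k < b" "\<And>u. jump_time n k \<le> u \<Longrightarrow> u < b \<Longrightarrow> n u = n (jump_time n k)"
    using locally_constant[OF nonneg] by blast
  obtain s where s: "0 \<le> s" "k \<le> n s" "s < b"
    using cInf_lessD[of "{t. 0 \<le> t \<and> k \<le> n t}" b] b(1) k
    unfolding jump_time_def reached_def by auto
  then have "jump_time n k \<le> s"
    unfolding jump_time_def by (intro cInf_lower bdd_belowI[of _ 0]) auto
  then have "k \<le> n (jump_time n k)"
    using b(2) s by metis
  also have "\<dots> \<le> n t"
    using mono nonneg le by blast
  finally show "k \<le> n t" .
qed

lemma count_ge_iff: "0 \<le> t \<Longrightarrow> k \<le> n t \<longleftrightarrow> reached n k \<and> jump_time n k \<le> t"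
  using jump_time_le_iff reached_def by blast

lemma jump_time_pos:
  assumes "reached n k" "1 \<le> k"
  shows "0 < jump_time n k"
  using jump_time_nonneg[OF assms(1)] jump_time_le_iff[OF assms(1), of 0] assms(2) zero by auto

lemma finite_counts: "finite (n ` {0..<u})"
proof (rule finite_subset)
  show "n ` {0..<u} \<subseteq> {..n u}"
    using mono by auto
qed auto

lemma left_count_ge: "0 \<le> s \<Longrightarrow> s < u \<Longrightarrow> n s \<le> left_count n u"
  unfolding left_count_def using finite_counts by (intro Max_ge) auto

lemma left_count_attained:
  assumes "0 < u"
  shows "\<exists>r\<in>{0..<u}. n r = left_count n u"
proof -
  have "left_count n u \<in> insert (n 0) (n ` {0..<u})"
    unfolding left_count_def zero using finite_counts by (intro Max_in) auto
  then show ?thesis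
    using assms by auto
qed

lemma left_count_eventually:
  assumes "0 < u"
  shows "eventually (\<lambda>s. n s = left_count n u) (at_left u)"
proof -
  obtain r where r: "0 \<le> r" "r < u" "n r = left_count n u"
    using left_count_attained[OF assms] by auto
  have "n s = left_count n u" if "r < s" "s < u" for s
    using mono[of r s] left_count_ge[of s u] r that by auto
  then show ?thesis
    using r by (auto simp: eventually_at_left_field)
qed

lemma left_count_le: "0 \<le> u \<Longrightarrow> left_count n u \<le> n u"
  unfolding left_count_def using mono finite_counts by (intro Max.boundedI) auto

lemma count_le_left_count:
  assumes "0 \<le> u"
  shows "n u \<le> left_count n u + 1"
proof (cases "u = 0")
  case False
  then obtain s where "0 \<le> s" "s < u" "n u \<le> n s + 1"
    using unit_jumps[of u] assms by auto
  then show ?thesis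
    using left_count_ge[of s u] by simp
qed (simp add: zero)

lemma left_count_mono: "u \<le> v \<Longrightarrow> left_count n u \<le> left_count n v"
  unfolding left_count_def using finite_counts by (intro Max_mono) auto

text \<open>Jumps of size one do not skip a value, so exactly \<open>k\<close> jumps strictly precede the next one.\<close>

lemma left_count_jump_time:
  assumes k: "reached n (Suc k)"
  shows "left_count n (jump_time n (Suc k)) = k"
proof -
  let ?T = "jump_time n (Suc k)"
  have pos: "0 < ?T"
    using jump_time_pos[OF k] by simp
  obtain r where r: "0 \<le> r" "r < ?T" "n r = left_count n ?T"
    using left_count_attained[OF pos] by auto
  then have "\<not> Suc k \<le> n r"
    using jump_time_le_iff[OF k, of r] by simp
  moreover obtain s where s: "0 \<le> s" "s < ?T" "n ?T \<le> n s + 1"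
    using unit_jumps[OF pos] by auto
  moreover have "Suc k \<le> n ?T"
    using jump_time_le_iff[OF k, of ?T] pos by simp
  ultimately show ?thesis
    using left_count_ge[OF s(1,2)] r(3) by linarith
qed

lemma left_count_eq:
  assumes "0 < u" "u \<notin> range (jump_time n)"
  shows "left_count n u = n u"
proof (rule ccontr)
  assume "left_count n u \<noteq> n u"
  then have less: "left_count n u < n u"
    using left_count_le[of u] assms(1) by simp
  let ?k = "n u"
  have k: "reached n ?k" "jump_time n ?k \<le> u"
    using count_ge_iff[of u ?k] assms(1) by auto
  then have "jump_time n ?k < u"
    using assms(2) by (metis order_le_less rangeI)
  then have "n (jump_time n ?k) \<le> left_count n u"
    using jump_time_nonneg[OF k(1)] by (intro left_count_ge) auto
  moreover have "?k \<le> n (jump_time n ?k)"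
    using jump_time_le_iff[OF k(1)] jump_time_nonneg[OF k(1)] by blast
  ultimately show False
    using less by simp
qed

lemma AE_left_count: "AE u in lborel. 0 < u \<longrightarrow> left_count n u = n u"
proof -
  have "AE u in lborel. u \<notin> range (jump_time n)"
    by (intro AE_not_in countable_imp_null_set_lborel) auto
  then show ?thesis
    by eventually_elim (use left_count_eq in auto)
qed

lemma jumps_in_interval:
  assumes "a \<le> b"
  shows "{k. reached n (Suc k) \<and> jump_time n (Suc k) \<in> {a<..b}} = {n (max 0 a)..<n (max 0 b)}"
proof -
  have *: "reached n (Suc k) \<and> jump_time n (Suc k) \<le> c \<longleftrightarrow> k < n (max 0 c)" for k c
    using count_ge_iff[of "max 0 c" "Suc k"] jump_time_pos[of "Suc k"] by (auto simp: Suc_le_eq)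
  show ?thesis
  proof (rule set_eqI)
    fix k
    show "k \<in> {k. reached n (Suc k) \<and> jump_time n (Suc k) \<in> {a<..b}} \<longleftrightarrow> k \<in> {n (max 0 a)..<n (max 0 b)}"
      using *[of k a] *[of k b]
      by (simp only: mem_Collect_eq greaterThanAtMost_iff atLeastLessThan_iff not_le[symmetric]) blast
  qed
qed

lemma jump_sum_interval:
  assumes "0 \<le> s" "s \<le> t"
  shows "jump_sum n (\<lambda>k u. f k u * indicator {s<..t} u) = (\<Sum>k\<in>{n s<..n t}. f k (jump_time n k))"
proof -
  let ?g = "\<lambda>k. if reached n (Suc k) then f (Suc k) (jump_time n (Suc k)) * indicator {s<..t} (jump_time n (Suc k)) else 0"
  have I: "{k. reached n (Suc k) \<and> jump_time n (Suc k) \<in> {s<..t}} = {n s..<n t}"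
    using jumps_in_interval[OF assms(2)] assms by (simp add: max_def)
  have "jump_sum n (\<lambda>k u. f k u * indicator {s<..t} u) = (\<Sum>k\<in>{n s..<n t}. ?g k)"
    unfolding jump_sum_def
  proof (rule suminf_finite)
    fix k assume "k \<notin> {n s..<n t}"
    then show "?g k = 0"
      unfolding I[symmetric] by auto
  qed auto
  also have "\<dots> = (\<Sum>k\<in>{n s..<n t}. f (Suc k) (jump_time n (Suc k)))"
    unfolding I[symmetric] by (intro sum.cong) auto
  also have "\<dots> = (\<Sum>k\<in>{n s<..n t}. f k (jump_time n k))"
    by (rule sum.reindex_bij_witness[where i = "\<lambda>k. k - 1" and j = Suc]) auto
  finally show ?thesis .
qed

text \<open>The Lebesgue-Stieltjes measure of a weighted step function is the image of a weighted counting
  measure under the jump times, because both give the same mass to half-open intervals.  With unit weights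
  this describes \<open>N\<close>, with the marks as weights the compound process.\<close>

lemma nn_integral_interval_measure_step:
  fixes x :: "nat \<Rightarrow> real"
  assumes x: "\<And>k. 1 \<le> k \<Longrightarrow> 0 \<le> x k" and g: "g \<in> borel_measurable borel"
  shows "(\<integral>\<^sup>+u. g u \<partial>interval_measure (\<lambda>v. \<Sum>i=1..n (max 0 v). x i)) =
    jump_sum n (\<lambda>k u. ennreal (x k) * g u)"
proof -
  define F where "F v = (\<Sum>i=1..n (max 0 v). x i)" for v
  define J where "J = {k. reached n (Suc k)}"
  define D where "D = distr (density (count_space J) (\<lambda>k. ennreal (x (Suc k)))) borel (\<lambda>k. jump_time n (Suc k))"
  have F_mono: "F v \<le> F w" if "v \<le> w" for v w
  proof -
    have "n (max 0 v) \<le> n (max 0 w)"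
      using that by (intro mono) auto
    then show ?thesis
      unfolding F_def using x by (intro sum_mono2) auto
  qed
  have F_right_cont: "continuous (at_right v) F" for v
  proof -
    obtain b where b: "max 0 v < b" "\<And>u. max 0 v \<le> u \<Longrightarrow> u < b \<Longrightarrow> n u = n (max 0 v)"
      using locally_constant[of "max 0 v"] by auto
    have "F u = F v" if "v < u" "u < b" for u
    proof -
      have *: "max 0 v \<le> max 0 u" "max 0 u < b"
        using that b(1) by auto
      show ?thesis
        unfolding F_def b(2)[OF *] ..
    qed
    then have "eventually (\<lambda>u. F u = F v) (at_right v)"
      using b(1) by (auto simp: eventually_at_right_field)
    then show ?thesis
      unfolding continuous_within by (rule tendsto_eventually)
  qed
  have D_Ioc: "emeasure D {a<..b} = ennreal (F b - F a)" if ab: "a \<le> b" for a b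
  proof -
    let ?K = "{n (max 0 a)..<n (max 0 b)}"
    have K: "?K = {k\<in>J. jump_time n (Suc k) \<in> {a<..b}}"
      using jumps_in_interval[OF ab] by (auto simp: J_def)
    have KJ: "?K \<subseteq> J"
      unfolding K by blast
    have le: "n (max 0 a) \<le> n (max 0 b)"
      using ab by (intro mono) auto
    have "emeasure D {a<..b} = (\<integral>\<^sup>+k. ennreal (x (Suc k)) * indicator {k\<in>J. jump_time n (Suc k) \<in> {a<..b}} k \<partial>count_space J)"
      unfolding D_def by (subst emeasure_distr, simp, simp, subst emeasure_density)
        (auto intro!: nn_integral_cong split: split_indicator)
    also have "\<dots> = (\<Sum>k\<in>?K. ennreal (x (Suc k)))"
      unfolding K[symmetric] using KJ by (subst nn_integral_count_space'[where A = ?K]) auto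
    also have "\<dots> = ennreal (\<Sum>k\<in>?K. x (Suc k))"
      using x by (intro sum_ennreal) auto
    also have "(\<Sum>k\<in>?K. x (Suc k)) = (\<Sum>k\<in>{n (max 0 a)<..n (max 0 b)}. x k)"
      by (rule sum.reindex_bij_witness[where j = Suc and i = "\<lambda>k. k - 1"]) auto
    also have "\<dots> = F b - F a"
    proof -
      have "{1..n (max 0 b)} = {1..n (max 0 a)} \<union> {n (max 0 a)<..n (max 0 b)}"
        using le by auto
      then have "F b = F a + (\<Sum>k\<in>{n (max 0 a)<..n (max 0 b)}. x k)"
        unfolding F_def by (simp only:) (rule sum.union_disjoint, auto)
      then show ?thesis by simp
    qed
    finally show ?thesis .
  qed
  have "interval_measure F = D"
  proof (rule measure_eqI_generator_eq[where E = "range (\<lambda>(a, b). {a<..b::real})" and \<Omega> = UNIV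
        and A = "\<lambda>i. {- real i<..real i}"])
    show "Int_stable (range (\<lambda>(a, b). {a<..b::real}))"
    proof (rule Int_stableI)
      fix X Y :: "real set" assume "X \<in> range (\<lambda>(a, b). {a<..b::real})" "Y \<in> range (\<lambda>(a, b). {a<..b})"
      then obtain a b c d where "X = {a<..b}" "Y = {c<..d}" by auto
      then have "X \<inter> Y = (\<lambda>(a, b). {a<..b}) (max a c, min b d)"
        by (simp add: Int_greaterThanAtMost)
      then show "X \<inter> Y \<in> range (\<lambda>(a, b). {a<..b})"
        by blast
    qed
    show "sets (interval_measure F) = sigma_sets UNIV (range (\<lambda>(a, b). {a<..b::real}))"
      by (simp add: borel_sigma_sets_Ioc)
    show "sets D = sigma_sets UNIV (range (\<lambda>(a, b). {a<..b::real}))"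
      by (simp add: D_def borel_sigma_sets_Ioc)
    fix X assume "X \<in> range (\<lambda>(a, b). {a<..b::real})"
    then obtain a b where X: "X = {a<..b}" by auto
    show "emeasure (interval_measure F) X = emeasure D X"
    proof (cases "a \<le> b")
      case True
      then show ?thesis
        using emeasure_interval_measure_Ioc[OF True F_mono F_right_cont] D_Ioc[OF True] X by simp
    qed (simp add: X)
  next
    show "(\<Union>i. {- real i<..real i}) = UNIV"
    proof (intro set_eqI iffI)
      fix v :: real
      obtain i :: nat where "\<bar>v\<bar> < real i" using reals_Archimedean2 by blast
      then show "v \<in> (\<Union>i. {- real i<..real i})" by (auto intro!: exI[of _ i])
    qed auto
    fix i :: nat
    show "emeasure (interval_measure F) {- real i<..real i} \<noteq> \<infinity>"
      by (subst emeasure_interval_measure_Ioc[OF _ F_mono F_right_cont]) auto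
  qed auto
  then have "(\<integral>\<^sup>+u. g u \<partial>interval_measure F) =
      (\<integral>\<^sup>+k. ennreal (x (Suc k)) * g (jump_time n (Suc k)) \<partial>count_space J)"
    unfolding D_def using g by (simp add: nn_integral_distr nn_integral_density)
  also have "\<dots> = (\<integral>\<^sup>+k. (if reached n (Suc k) then ennreal (x (Suc k)) * g (jump_time n (Suc k)) else 0) \<partial>count_space UNIV)"
    by (subst nn_integral_count_space_indicator)
      (auto intro!: nn_integral_cong simp: J_def split: split_indicator)
  also have "\<dots> = jump_sum n (\<lambda>k u. ennreal (x k) * g u)"
    unfolding jump_sum_def by (rule nn_integral_count_space_nat)
  finally show ?thesis
    unfolding F_def .
qed

lemma set_integral_interval_measure_step:
  fixes x :: "nat \<Rightarrow> real" and g :: "real \<Rightarrow> real"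
  assumes x: "\<And>k. 1 \<le> k \<Longrightarrow> 0 \<le> x k" and g: "g \<in> borel_measurable borel" "\<And>u. 0 \<le> g u"
    and t: "0 \<le> s" "s \<le> t"
  shows "(LINT u:{s<..t}|interval_measure (\<lambda>v. \<Sum>i=1..n (max 0 v). x i). g u) =
    (\<Sum>k\<in>{n s<..n t}. x k * g (jump_time n k))"
proof -
  have "(LINT u:{s<..t}|interval_measure (\<lambda>v. \<Sum>i=1..n (max 0 v). x i). g u) =
      enn2real (\<integral>\<^sup>+u. ennreal (g u) * indicator {s<..t} u \<partial>interval_measure (\<lambda>v. \<Sum>i=1..n (max 0 v). x i))"
    unfolding set_lebesgue_integral_def using g
    by (subst integral_eq_nn_integral) (auto intro!: arg_cong[where f = enn2real] nn_integral_cong split: split_indicator)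
  also have "\<dots> = enn2real (jump_sum n (\<lambda>k u. ennreal (x k) * (ennreal (g u) * indicator {s<..t} u)))"
    using g by (subst nn_integral_interval_measure_step[OF x]) auto
  also have "\<dots> = enn2real (\<Sum>k\<in>{n s<..n t}. ennreal (x k) * ennreal (g (jump_time n k)))"
    unfolding mult.assoc[symmetric] by (subst jump_sum_interval[OF t]) (rule refl)
  also have "\<dots> = enn2real (ennreal (\<Sum>k\<in>{n s<..n t}. x k * g (jump_time n k)))"
    using x g by (subst sum_ennreal[symmetric]) (auto intro!: arg_cong[where f = enn2real] sum.cong simp: ennreal_mult)
  also have "\<dots> = (\<Sum>k\<in>{n s<..n t}. x k * g (jump_time n k))"
    using x g by (intro enn2real_ennreal sum_nonneg) auto
  finally show ?thesis .
qed

end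

section \<open>Predictable processes and the strict past of a jump\<close>

context counting_process
begin

abbreviation jump_at :: "nat \<Rightarrow> 'a \<Rightarrow> real" ("\<tau>") where
  "\<tau> k \<omega> \<equiv> jump_time (\<lambda>t. N t \<omega>) k"

lemma path: "\<omega> \<in> space M \<Longrightarrow> counting_path (\<lambda>t. N t \<omega>)"
  using N_zero N_mono N_right_continuous N_unit_jumps by unfold_locales auto

lemma in_F_imp_subset: "A \<in> sets (F t) \<Longrightarrow> A \<subseteq> space M"
  using sets.sets_into_space[of A "F t"] space_F by auto

lemma measurable_F_mono: "f \<in> F s \<rightarrow>\<^sub>M K \<Longrightarrow> s \<le> t \<Longrightarrow> f \<in> F t \<rightarrow>\<^sub>M K"
  using sets_F_mono[of s t] by (auto simp: measurable_def space_F)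

lemma measurable_F_M: "f \<in> F s \<rightarrow>\<^sub>M K \<Longrightarrow> f \<in> M \<rightarrow>\<^sub>M K"
  using filtration_subset[of s] by (auto simp: measurable_def space_F)

abbreviation predictable :: "(real \<times> 'a) measure" where
  "predictable \<equiv> predictable_sigma (space M) F"

lemma predictable_generator:
  "{{u<..v} \<times> A | u v A. 0 \<le> u \<and> u \<le> v \<and> A \<in> sets (F u)} \<subseteq> Pow ({0<..} \<times> space M)"
  using in_F_imp_subset by fastforce

lemma space_predictable: "space predictable = {0<..} \<times> space M"
  unfolding predictable_sigma_def by (rule space_measure_of[OF predictable_generator])

lemma sets_predictable: "sets predictable =
    sigma_sets ({0<..} \<times> space M) {{u<..v} \<times> A | u v A. 0 \<le> u \<and> u \<le> v \<and> A \<in> sets (F u)}"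
  unfolding predictable_sigma_def by (rule sets_measure_of[OF predictable_generator])

lemma measurable_predictable:
  assumes "f \<in> space K \<rightarrow> {0<..} \<times> space M"
    and "\<And>u v A. 0 \<le> u \<Longrightarrow> u \<le> v \<Longrightarrow> A \<in> sets (F u) \<Longrightarrow> f -` ({u<..v} \<times> A) \<inter> space K \<in> sets K"
  shows "f \<in> K \<rightarrow>\<^sub>M predictable"
  unfolding predictable_sigma_def
  by (rule measurable_sigma_sets[OF sets_measure_of[OF predictable_generator] predictable_generator assms(1)])
    (use assms(2) in blast)

lemma Ioc_times_predictable:
  "0 \<le> u \<Longrightarrow> u \<le> v \<Longrightarrow> A \<in> sets (F u) \<Longrightarrow> {u<..v} \<times> A \<in> sets predictable"
  unfolding sets_predictable by (rule sigma_sets.Basic) blast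

lemma Ioi_times_predictable:
  assumes "0 \<le> u" "A \<in> sets (F u)"
  shows "{u<..} \<times> A \<in> sets predictable"
proof -
  have "{u<..} \<times> A = (\<Union>i. {u<..u + real i} \<times> A)"
  proof (intro set_eqI iffI)
    fix p assume p: "p \<in> {u<..} \<times> A"
    obtain i :: nat where "fst p - u < real i" using reals_Archimedean2 by blast
    then show "p \<in> (\<Union>i. {u<..u + real i} \<times> A)" using p by (auto intro!: exI[of _ i])
  qed auto
  also have "\<dots> \<in> sets predictable"
    using assms by (intro sets.countable_UN) (auto intro!: Ioc_times_predictable)
  finally show ?thesis .
qed

lemma space_in_F: "space M \<in> sets (F t)"
  using sets.top[of "F t"] space_F by simp

lemma measurable_fst_predictable [measurable]: "fst \<in> borel_measurable predictable"
proof (rule borel_measurableI_greater)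
  fix a :: real
  have "{p \<in> space predictable. a < fst p} = {max 0 a<..} \<times> space M"
    by (auto simp: space_predictable)
  then show "{p \<in> space predictable. a < fst p} \<in> sets predictable"
    using Ioi_times_predictable[of "max 0 a" "space M"] space_in_F by simp
qed

lemma measurable_after_predictable:
  fixes Z :: "'a \<Rightarrow> real"
  assumes s: "0 \<le> s" and Z: "Z \<in> borel_measurable (F s)"
  shows "(\<lambda>p. if s < fst p then Z (snd p) else 0) \<in> borel_measurable predictable"
proof (rule measurableI)
  fix B :: "real set" assume B: "B \<in> sets borel"
  have Z': "Z -` B \<inter> space M \<in> sets (F s)"
    using measurable_sets[OF Z B] space_F by simp
  have "(\<lambda>p. if s < fst p then Z (snd p) else 0) -` B \<inter> space predictable =
      {s<..} \<times> (Z -` B \<inter> space M) \<union> (if 0 \<in> B then {0<..s} \<times> space M else {})"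
    using s by (auto simp: space_predictable split: if_splits)
  moreover have "\<dots> \<in> sets predictable"
    using Ioi_times_predictable[OF s Z'] Ioc_times_predictable[OF order_refl s space_in_F] by auto
  ultimately show "(\<lambda>p. if s < fst p then Z (snd p) else 0) -` B \<inter> space predictable \<in> sets predictable"
    by simp
qed simp

text \<open>The process is sampled at the last point of the grid \<open>{i / (k + 1)}\<close> strictly before the current
  time.  Such a sampled process is predictable, being constant after the sampling time until the next grid
  point, and as the grid is refined it converges to the left limit.\<close>

lemma left_limit_predictable:
  fixes X :: "real \<Rightarrow> 'a \<Rightarrow> real"
  assumes adapted: "\<And>t. 0 \<le> t \<Longrightarrow> X t \<in> borel_measurable (F t)"
    and lim: "\<And>u \<omega>. 0 < u \<Longrightarrow> \<omega> \<in> space M \<Longrightarrow> ((\<lambda>r. X r \<omega>) \<longlongrightarrow> Y u \<omega>) (at_left u)"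
  shows "(\<lambda>p. Y (fst p) (snd p)) \<in> borel_measurable predictable"
proof (rule borel_measurable_LIMSEQ_real)
  define j where "j k u = nat (\<lceil>real (Suc k) * u\<rceil> - 1)" for k and u :: real
  define d where "d k u = real (j k u) / real (Suc k)" for k u
  define S where "S k i p = (if real i / real (Suc k) < fst p then X (real i / real (Suc k)) (snd p) else 0)"
    for k i and p :: "real \<times> 'a"
  have S: "S k i \<in> borel_measurable predictable" for k i
    unfolding S_def by (rule measurable_after_predictable) (auto intro: adapted)
  have d_less: "d k u < u" and d_ge: "u - 1 / real (Suc k) \<le> d k u" if "0 < u" for k u
  proof -
    have pos: "0 < \<lceil>real (Suc k) * u\<rceil>"
      using that by (simp add: zero_less_ceiling)
    then have j: "real (j k u) = real_of_int \<lceil>real (Suc k) * u\<rceil> - 1"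
      unfolding j_def by simp
    have "real (j k u) < real (Suc k) * u" "real (Suc k) * u - 1 \<le> real (j k u)"
      unfolding j by linarith+
    moreover from this(2) have "(real (Suc k) * u - 1) / real (Suc k) \<le> real (j k u) / real (Suc k)"
      by (intro divide_right_mono) auto
    ultimately show "d k u < u" "u - 1 / real (Suc k) \<le> d k u"
      unfolding d_def by (auto simp add: pos_divide_less_eq diff_divide_distrib mult.commute)
  qed
  fix k
  have "(\<lambda>p. j k (fst p)) \<in> predictable \<rightarrow>\<^sub>M count_space UNIV"
    unfolding j_def by measurable
  then show "(\<lambda>p. S k (j k (fst p)) p) \<in> borel_measurable predictable"
    using S by (rule measurable_compose_countable[rotated])
  fix p assume p: "p \<in> space predictable"
  then have u: "0 < fst p" and \<omega>: "snd p \<in> space M"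
    by (auto simp: space_predictable)
  have "(\<lambda>k. fst p - 1 / real (Suc k)) \<longlonglongrightarrow> fst p - 0"
    by (intro tendsto_intros LIMSEQ_Suc[OF lim_1_over_n])
  then have lower: "(\<lambda>k. fst p - 1 / real (Suc k)) \<longlonglongrightarrow> fst p"
    by simp
  have "(\<lambda>k. d k (fst p)) \<longlonglongrightarrow> fst p"
  proof (rule tendsto_sandwich[OF _ _ lower tendsto_const])
    show "\<forall>\<^sub>F k in sequentially. fst p - 1 / real (Suc k) \<le> d k (fst p)"
      using d_ge[OF u] by (intro always_eventually allI)
    show "\<forall>\<^sub>F k in sequentially. d k (fst p) \<le> fst p"
      using d_less[OF u] by (intro always_eventually allI less_imp_le)
  qed
  then have "filterlim (\<lambda>k. d k (fst p)) (at_left (fst p)) sequentially"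
    unfolding filterlim_at using d_less[OF u] by (simp add: less_imp_neq)
  then have "(\<lambda>k. X (d k (fst p)) (snd p)) \<longlonglongrightarrow> Y (fst p) (snd p)"
    by (rule filterlim_compose[OF lim[OF u \<omega>]])
  moreover have "S k (j k (fst p)) p = X (d k (fst p)) (snd p)" for k
    using d_less[OF u, of k] unfolding S_def d_def by simp
  ultimately show "(\<lambda>k. S k (j k (fst p)) p) \<longlonglongrightarrow> Y (fst p) (snd p)"
    by simp
qed

lemma left_count_predictable:
  "(\<lambda>p. real (left_count (\<lambda>t. N t (snd p)) (fst p))) \<in> borel_measurable predictable"
proof (rule left_limit_predictable[where X = "\<lambda>t \<omega>. real (N t \<omega>)" and Y = "\<lambda>u \<omega>. real (left_count (\<lambda>t. N t \<omega>) u)"])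
  show "(\<lambda>\<omega>. real (N t \<omega>)) \<in> borel_measurable (F t)" if "0 \<le> t" for t
    using measurable_compose[OF N_adapted[OF that], of real borel] by simp
  show "((\<lambda>r. real (N r \<omega>)) \<longlongrightarrow> real (left_count (\<lambda>t. N t \<omega>) u)) (at_left u)"
    if "0 < u" "\<omega> \<in> space M" for u \<omega>
    using counting_path.left_count_eventually[OF path[OF that(2)] that(1)]
    by (intro tendsto_eventually) (auto elim: eventually_mono)
qed

text \<open>These two lemmas move a predictable integrand to the ordinary product sigma-algebra, where paths can
  be integrated and the order of integration can be exchanged.  The indicator is there because the
  predictable sigma-algebra lives on positive times only.\<close>

lemma predictable_section:
  assumes C: "C \<in> borel_measurable predictable" and \<omega>: "\<omega> \<in> space M"
  shows "(\<lambda>u. C (u, \<omega>) * indicator {0<..} u :: ennreal) \<in> borel_measurable borel"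
proof -
  have "(\<lambda>u. (u, \<omega>)) \<in> restrict_space borel {0<..} \<rightarrow>\<^sub>M predictable"
  proof (rule measurable_predictable)
    fix u v :: real and A assume "0 \<le> u" "u \<le> v" "A \<in> sets (F u)"
    then have "(\<lambda>u. (u, \<omega>)) -` ({u<..v} \<times> A) \<inter> space (restrict_space borel {0<..}) = (if \<omega> \<in> A then {u<..v} else {})"
      by (auto simp: space_restrict_space)
    also have "\<dots> \<in> sets (restrict_space borel {0<..})"
      using \<open>0 \<le> u\<close> by (auto simp: sets_restrict_space_iff)
    finally show "(\<lambda>u. (u, \<omega>)) -` ({u<..v} \<times> A) \<inter> space (restrict_space borel {0<..}) \<in> sets (restrict_space borel {0<..})" .
  qed (use \<omega> in \<open>auto simp: space_restrict_space\<close>)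
  from measurable_compose[OF this C] show ?thesis
    by (simp add: borel_measurable_restrict_space_iff_ennreal)
qed

lemma predictable_imp_product_measurable:
  assumes C: "C \<in> borel_measurable predictable"
  shows "(\<lambda>p. C p * indicator {0<..} (fst p) :: ennreal) \<in> borel_measurable (borel \<Otimes>\<^sub>M M)"
proof -
  have S: "{0::real<..} \<times> space M \<in> sets (borel \<Otimes>\<^sub>M M)"
    by (intro pair_measureI) auto
  have "(\<lambda>p. p) \<in> restrict_space (borel \<Otimes>\<^sub>M M) ({0<..} \<times> space M) \<rightarrow>\<^sub>M predictable"
  proof (rule measurable_predictable)
    fix u v :: real and A assume A: "0 \<le> u" "u \<le> v" "A \<in> sets (F u)"
    then have "(\<lambda>p. p) -` ({u<..v} \<times> A) \<inter> space (restrict_space (borel \<Otimes>\<^sub>M M) ({0<..} \<times> space M)) = {u<..v} \<times> A"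
      using in_F_imp_subset[OF A(3)] by (auto simp: space_restrict_space space_pair_measure)
    also have "\<dots> \<in> sets (restrict_space (borel \<Otimes>\<^sub>M M) ({0<..} \<times> space M))"
      using A in_F_imp_subset[OF A(3)] filtration_subset S by (auto simp: sets_restrict_space_iff intro!: pair_measureI)
    finally show "(\<lambda>p. p) -` ({u<..v} \<times> A) \<inter> space (restrict_space (borel \<Otimes>\<^sub>M M) ({0<..} \<times> space M))
      \<in> sets (restrict_space (borel \<Otimes>\<^sub>M M) ({0<..} \<times> space M))" .
  qed (auto simp: space_restrict_space space_pair_measure)
  from measurable_compose[OF this C]
  have "(\<lambda>p. C p * indicator ({0<..} \<times> space M) p) \<in> borel_measurable (borel \<Otimes>\<^sub>M M)"
    using S by (subst (asm) borel_measurable_restrict_space_iff_ennreal) (auto simp: space_pair_measure)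
  then show ?thesis
    by (rule measurable_cong[THEN iffD1, rotated]) (auto simp: space_pair_measure split: split_indicator)
qed

lemma strict_past_generator:
  "{A \<inter> {\<omega> \<in> space M. N t \<omega> < k} | t A. 0 \<le> t \<and> A \<in> sets (F t)} \<subseteq> Pow (space M)"
  by auto

lemma space_strict_past: "space (strict_past M F N k) = space M"
  unfolding strict_past_def by (rule space_measure_of[OF strict_past_generator])

lemma in_strict_past:
  "0 \<le> t \<Longrightarrow> A \<in> sets (F t) \<Longrightarrow> A \<inter> {\<omega> \<in> space M. N t \<omega> < k} \<in> sets (strict_past M F N k)"
  unfolding strict_past_def sets_measure_of[OF strict_past_generator]
  by (rule sigma_sets.Basic) blast

lemma before_jump_in_strict_past:
  assumes "0 \<le> t"
  shows "{\<omega> \<in> space M. N t \<omega> < k} \<in> sets (strict_past M F N k)"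
proof -
  have "space M \<inter> {\<omega> \<in> space M. N t \<omega> < k} = {\<omega> \<in> space M. N t \<omega> < k}"
    by auto
  then show ?thesis
    using in_strict_past[OF assms space_in_F, of k] by simp
qed

text \<open>For a generator \<open>(u, v] \<times> A\<close> with \<open>A\<close> known at time \<open>u\<close>, the value at the jump time \<open>T\<close> is the indicator
  of \<open>A \<inter> {u < T} - {v < T}\<close>, and both events belong to the strict past of \<open>T\<close>.\<close>

lemma predictable_at_jump_strict_past:
  fixes C :: "real \<times> 'a \<Rightarrow> ennreal"
  assumes C: "C \<in> borel_measurable predictable"
  shows "(\<lambda>\<omega>. if reached (\<lambda>t. N t \<omega>) (Suc k) then C (\<tau> (Suc k) \<omega>, \<omega>) else 0)
    \<in> borel_measurable (strict_past M F N (Suc k))"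
proof -
  let ?G = "strict_past M F N (Suc k)"
  let ?R = "{\<omega> \<in> space M. reached (\<lambda>t. N t \<omega>) (Suc k)}"
  have R_eq: "?R = (\<Union>i::nat. space M - {\<omega> \<in> space M. N (real i) \<omega> < Suc k})"
  proof (intro set_eqI iffI)
    fix \<omega> assume "\<omega> \<in> ?R"
    then obtain t where t: "\<omega> \<in> space M" "0 \<le> t" "Suc k \<le> N t \<omega>"
      by (auto simp: reached_def)
    obtain i :: nat where "t \<le> real i" using real_arch_simple by blast
    then have "Suc k \<le> N (real i) \<omega>"
      using N_mono[of \<omega> t "real i"] t by simp
    then show "\<omega> \<in> (\<Union>i::nat. space M - {\<omega> \<in> space M. N (real i) \<omega> < Suc k})"
      using t by (auto simp: not_less intro!: exI[of _ i])
  next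
    fix \<omega> assume "\<omega> \<in> (\<Union>i::nat. space M - {\<omega> \<in> space M. N (real i) \<omega> < Suc k})"
    then obtain i :: nat where "\<omega> \<in> space M" "Suc k \<le> N (real i) \<omega>"
      by (auto simp: not_less)
    then show "\<omega> \<in> ?R"
      unfolding reached_def by (auto intro!: exI[of _ "real i"])
  qed
  have R: "?R \<in> sets ?G"
    unfolding R_eq
    using sets.compl_sets[OF before_jump_in_strict_past[where k = "Suc k"]]
    by (intro sets.countable_UN) (auto simp: space_strict_past)
  have "(\<lambda>\<omega>. (\<tau> (Suc k) \<omega>, \<omega>)) \<in> restrict_space ?G ?R \<rightarrow>\<^sub>M predictable"
  proof (rule measurable_predictable)
    show "(\<lambda>\<omega>. (\<tau> (Suc k) \<omega>, \<omega>)) \<in> space (restrict_space ?G ?R) \<rightarrow> {0<..} \<times> space M"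
      using counting_path.jump_time_pos[OF path] by (auto simp: space_restrict_space)
    fix u v :: real and A assume A: "0 \<le> u" "u \<le> v" "A \<in> sets (F u)"
    have v: "0 \<le> v" using A by simp
    have "(\<lambda>\<omega>. (\<tau> (Suc k) \<omega>, \<omega>)) -` ({u<..v} \<times> A) \<inter> space (restrict_space ?G ?R) =
        (A \<inter> {\<omega> \<in> space M. N u \<omega> < Suc k}) - {\<omega> \<in> space M. N v \<omega> < Suc k}" (is "?L = ?S")
    proof (rule set_eqI)
      fix \<omega>
      show "\<omega> \<in> ?L \<longleftrightarrow> \<omega> \<in> ?S"
      proof (cases "\<omega> \<in> space M")
        case True
        show ?thesis
          using True counting_path.count_ge_iff[OF path[OF True] A(1), of "Suc k"]
            counting_path.count_ge_iff[OF path[OF True] v, of "Suc k"]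
          by (simp add: space_restrict_space space_strict_past not_less not_le[symmetric] del: not_le) blast
      qed (auto simp: space_restrict_space space_strict_past)
    qed
    moreover have "?S \<in> sets ?G"
      using in_strict_past[OF A(1,3)] before_jump_in_strict_past[OF v] by auto
    moreover have "?S \<subseteq> ?R"
      using calculation(1) by (auto simp: space_restrict_space)
    ultimately show "(\<lambda>\<omega>. (\<tau> (Suc k) \<omega>, \<omega>)) -` ({u<..v} \<times> A) \<inter> space (restrict_space ?G ?R) \<in> sets (restrict_space ?G ?R)"
      using sets.Int_space_eq2[OF R] R by (subst sets_restrict_space_iff) simp_all
  qed
  from measurable_compose[OF this C]
  have "(\<lambda>\<omega>. C (\<tau> (Suc k) \<omega>, \<omega>) * indicator ?R \<omega>) \<in> borel_measurable ?G"
    using R sets.Int_space_eq2[OF R] by (subst (asm) borel_measurable_restrict_space_iff_ennreal) simp_all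
  then show ?thesis
    by (rule measurable_cong[THEN iffD1, rotated]) (auto simp: space_strict_past)
qed

end

section \<open>Campbell's formula for the marked jumps\<close>

context hawkes_process
begin

lemma l_nonneg: "0 \<le> t \<Longrightarrow> \<omega> \<in> space M \<Longrightarrow> 0 \<le> l t \<omega>"
  using intensity unfolding stochastic_intensity_def by blast

lemma l_adapted:
  assumes "0 \<le> t"
  shows "l t \<in> borel_measurable (F t)"
proof -
  have "(\<lambda>(s, \<omega>). l s \<omega>) \<in> borel_measurable (restrict_space borel {0..t} \<Otimes>\<^sub>M F t)"
    using intensity assms unfolding stochastic_intensity_def by blast
  from measurable_Pair2[OF this, of t] show ?thesis
    using assms by (simp add: space_restrict_space)
qed

lemma mark_measurable: "1 \<le> k \<Longrightarrow> \<xi> k \<in> borel_measurable M"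
  using \<xi>_indep unfolding indep_vars_def by auto

lemma nn_integral_mark:
  assumes k: "1 \<le> k" and h: "h \<in> borel_measurable borel"
  shows "(\<integral>\<^sup>+\<omega>. h (\<xi> k \<omega>) \<partial>M) = (\<integral>\<^sup>+\<omega>. h (\<xi> 1 \<omega>) \<partial>M)"
proof -
  have "(\<integral>\<^sup>+\<omega>. h (\<xi> k \<omega>) \<partial>M) = (\<integral>\<^sup>+x. h x \<partial>distr M borel (\<xi> k))"
    using mark_measurable[OF k] h by (simp add: nn_integral_distr)
  also have "\<dots> = (\<integral>\<^sup>+\<omega>. h (\<xi> 1 \<omega>) \<partial>M)"
    unfolding \<xi>_identical[OF k] using mark_measurable[of 1] h by (simp add: nn_integral_distr)
  finally show ?thesis .
qed

lemma mean_nonneg: "0 \<le> \<mu>"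
  unfolding \<xi>_mean[symmetric] using \<xi>_pos[of 1] by (intro integral_nonneg_AE) (auto intro!: AE_I2 less_imp_le)

lemma mark_mean: "(\<integral>\<^sup>+\<omega>. ennreal (\<xi> 1 \<omega>) \<partial>M) = ennreal \<mu>"
  unfolding \<xi>_mean[symmetric] using \<xi>_pos[of 1]
  by (intro nn_integral_eq_integral \<xi>_integrable) (auto intro!: AE_I2 less_imp_le)

lemma mark_second_moment: "(\<integral>\<^sup>+\<omega>. ennreal ((\<xi> 1 \<omega>)\<^sup>2) \<partial>M) = ennreal (\<psi>\<^sup>2 + \<mu>\<^sup>2)"
proof -
  have "expectation (\<lambda>\<omega>. (\<xi> 1 \<omega>)\<^sup>2) = \<psi>\<^sup>2 + \<mu>\<^sup>2"
    using variance_eq[OF \<xi>_integrable \<xi>_square_integrable] \<xi>_mean \<xi>_variance by simp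
  then show ?thesis
    by (subst nn_integral_eq_integral[OF \<xi>_square_integrable]) auto
qed

lemma sets_strict_past: "1 \<le> k \<Longrightarrow> sets (strict_past M F N k) \<subseteq> events"
  using \<xi>_indep_past[of k] by (simp add: indep_sets2_eq)

lemma measurable_strict_past_M:
  "f \<in> strict_past M F N (Suc k) \<rightarrow>\<^sub>M K \<Longrightarrow> f \<in> M \<rightarrow>\<^sub>M K"
  using sets_strict_past[of "Suc k"] by (auto simp: measurable_def space_strict_past)

text \<open>The mark of a jump is independent of the strict past of that jump, and all marks have the law of the
  first one.\<close>

lemma nn_integral_mult_mark:
  assumes f: "f \<in> borel_measurable (strict_past M F N (Suc k))" and h: "h \<in> borel_measurable borel"
  shows "(\<integral>\<^sup>+\<omega>. f \<omega> * h (\<xi> (Suc k) \<omega>) \<partial>M) = (\<integral>\<^sup>+\<omega>. f \<omega> \<partial>M) * (\<integral>\<^sup>+\<omega>. h (\<xi> 1 \<omega>) \<partial>M)"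
proof -
  let ?G = "strict_past M F N (Suc k)" and ?H = "vimage_algebra (space M) (\<xi> (Suc k)) borel"
  have [measurable]: "\<xi> (Suc k) \<in> borel_measurable ?H"
    by (rule measurable_vimage_algebra1) auto
  note [measurable] = f h
  have "(\<integral>\<^sup>+\<omega>. f \<omega> * h (\<xi> (Suc k) \<omega>) \<partial>M) = (\<integral>\<^sup>+\<omega>. \<integral>\<^sup>+\<omega>'. f \<omega> * h (\<xi> (Suc k) \<omega>') \<partial>M \<partial>M)"
    using indep_set_nn_integral_pair[OF \<xi>_indep_past[of "Suc k"], of "\<lambda>(x, y). f x * h (\<xi> (Suc k) y)"]
    by (simp add: space_strict_past)
  also have "\<dots> = (\<integral>\<^sup>+\<omega>. f \<omega> * (\<integral>\<^sup>+\<omega>'. h (\<xi> 1 \<omega>') \<partial>M) \<partial>M)"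
    using mark_measurable[of "Suc k"] h nn_integral_mark[of "Suc k" h]
    by (subst nn_integral_cmult) auto
  also have "\<dots> = (\<integral>\<^sup>+\<omega>. f \<omega> \<partial>M) * (\<integral>\<^sup>+\<omega>. h (\<xi> 1 \<omega>) \<partial>M)"
    using measurable_strict_past_M[OF f] by (rule nn_integral_multc)
  finally show ?thesis .
qed

lemma nn_integral_jump_sum_mark:
  assumes C: "C \<in> borel_measurable predictable" and h: "h \<in> borel_measurable borel"
  shows "(\<integral>\<^sup>+\<omega>. jump_sum (\<lambda>t. N t \<omega>) (\<lambda>k u. C (u, \<omega>) * h (\<xi> k \<omega>)) \<partial>M) =
    (\<integral>\<^sup>+\<omega>. h (\<xi> 1 \<omega>) \<partial>M) * (\<integral>\<^sup>+\<omega>. jump_sum (\<lambda>t. N t \<omega>) (\<lambda>k u. C (u, \<omega>)) \<partial>M)"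
proof -
  define g where "g k \<omega> = (if reached (\<lambda>t. N t \<omega>) (Suc k) then C (\<tau> (Suc k) \<omega>, \<omega>) else 0)" for k \<omega>
  have g: "g k \<in> borel_measurable (strict_past M F N (Suc k))" for k
    unfolding g_def by (rule predictable_at_jump_strict_past[OF C])
  note g_M = measurable_strict_past_M[OF g]
  have "(\<integral>\<^sup>+\<omega>. jump_sum (\<lambda>t. N t \<omega>) (\<lambda>k u. C (u, \<omega>) * h (\<xi> k \<omega>)) \<partial>M) =
      (\<integral>\<^sup>+\<omega>. (\<Sum>k. g k \<omega> * h (\<xi> (Suc k) \<omega>)) \<partial>M)"
    unfolding jump_sum_def g_def by (intro nn_integral_cong suminf_cong) auto
  also have "\<dots> = (\<Sum>k. \<integral>\<^sup>+\<omega>. g k \<omega> * h (\<xi> (Suc k) \<omega>) \<partial>M)"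
    using g_M mark_measurable h by (intro nn_integral_suminf) auto
  also have "\<dots> = (\<Sum>k. (\<integral>\<^sup>+\<omega>. g k \<omega> \<partial>M) * (\<integral>\<^sup>+\<omega>. h (\<xi> 1 \<omega>) \<partial>M))"
    using nn_integral_mult_mark[OF g h] by simp
  also have "\<dots> = (\<integral>\<^sup>+\<omega>. h (\<xi> 1 \<omega>) \<partial>M) * (\<integral>\<^sup>+\<omega>. (\<Sum>k. g k \<omega>) \<partial>M)"
    using g_M by (simp add: nn_integral_suminf mult.commute)
  finally show ?thesis
    unfolding jump_sum_def g_def .
qed

text \<open>The defining property of the stochastic intensity, with the path integral written as a sum over
  jumps.\<close>

lemma nn_integral_jump_sum:
  assumes C: "C \<in> borel_measurable predictable"
  shows "(\<integral>\<^sup>+\<omega>. jump_sum (\<lambda>t. N t \<omega>) (\<lambda>k u. C (u, \<omega>)) \<partial>M) =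
    (\<integral>\<^sup>+\<omega>. (\<integral>\<^sup>+u\<in>{0<..}. (C (u, \<omega>) * ennreal (l u \<omega>)) \<partial>lborel) \<partial>M)"
proof -
  have "(\<integral>\<^sup>+u\<in>{0<..}. C (u, \<omega>) \<partial>interval_measure (\<lambda>u. real (N (max 0 u) \<omega>))) =
      jump_sum (\<lambda>t. N t \<omega>) (\<lambda>k u. C (u, \<omega>))" if \<omega>: "\<omega> \<in> space M" for \<omega>
  proof -
    interpret counting_path "\<lambda>t. N t \<omega>" by (rule path[OF \<omega>])
    have "(\<integral>\<^sup>+u\<in>{0<..}. C (u, \<omega>) \<partial>interval_measure (\<lambda>u. real (N (max 0 u) \<omega>))) =
        jump_sum (\<lambda>t. N t \<omega>) (\<lambda>k u. ennreal 1 * (C (u, \<omega>) * indicator {0<..} u))"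
      using nn_integral_interval_measure_step[of "\<lambda>_. 1", OF _ predictable_section[OF C \<omega>]] by simp
    also have "\<dots> = jump_sum (\<lambda>t. N t \<omega>) (\<lambda>k u. C (u, \<omega>))"
      unfolding jump_sum_def using jump_time_pos by (intro suminf_cong) auto
    finally show ?thesis .
  qed
  then have "(\<integral>\<^sup>+\<omega>. jump_sum (\<lambda>t. N t \<omega>) (\<lambda>k u. C (u, \<omega>)) \<partial>M) =
      (\<integral>\<^sup>+\<omega>. (\<integral>\<^sup>+u\<in>{0<..}. C (u, \<omega>) \<partial>interval_measure (\<lambda>u. real (N (max 0 u) \<omega>))) \<partial>M)"
    by (intro nn_integral_cong) simp
  also have "\<dots> = (\<integral>\<^sup>+\<omega>. (\<integral>\<^sup>+u\<in>{0<..}. (C (u, \<omega>) * ennreal (l u \<omega>)) \<partial>lborel) \<partial>M)"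
    using intensity C unfolding stochastic_intensity_def by blast
  finally show ?thesis .
qed

text \<open>The integral of \<open>D\<close> times \<open>h\<close> of the mark along the jumps in \<open>(s, t]\<close>, discounted at rate \<open>r\<close>.  All
  three sums over jumps that occur in the moment equations have this form.\<close>

definition jump_integral ::
  "real \<Rightarrow> (real \<Rightarrow> 'a \<Rightarrow> real) \<Rightarrow> (real \<Rightarrow> real) \<Rightarrow> real \<Rightarrow> real \<Rightarrow> 'a \<Rightarrow> real" where
  "jump_integral r D h s t \<omega> =
    (\<Sum>k\<in>{N s \<omega><..N t \<omega>}. exp (- r * (t - \<tau> k \<omega>)) * D (\<tau> k \<omega>) \<omega> * h (\<xi> k \<omega>))"

text \<open>The path integral in the dynamics of \<open>l\<close> is a finite sum over the jumps in \<open>(s, t]\<close>.\<close>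

lemma intensity_path:
  assumes \<omega>: "\<omega> \<in> space M" and t: "0 \<le> s" "s \<le> t"
  shows "l t \<omega> = \<theta> + exp (- \<kappa> * (t - s)) * (l s \<omega> - \<theta>)
    + jump_integral \<kappa> (\<lambda>_ _. 1) (\<lambda>x. \<eta> * x) s t \<omega>"
proof -
  interpret counting_path "\<lambda>t. N t \<omega>" by (rule path[OF \<omega>])
  have "(LINT u:{s<..t}|interval_measure (\<lambda>v. compound_process N \<xi> (max 0 v) \<omega>). exp (- \<kappa> * (t - u))) =
      (\<Sum>k\<in>{N s \<omega><..N t \<omega>}. \<xi> k \<omega> * exp (- \<kappa> * (t - \<tau> k \<omega>)))"
    unfolding compound_process_def
    using \<xi>_pos \<omega> t by (intro set_integral_interval_measure_step) (auto intro: less_imp_le)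
  then show ?thesis
    using intensity_eq[OF \<omega> t]
    by (simp add: jump_integral_def sum_distrib_left mult.assoc mult.commute mult.left_commute)
qed

lemma intensity_between_jumps:
  assumes "\<omega> \<in> space M" "0 \<le> s" "s \<le> t" "N t \<omega> = N s \<omega>"
  shows "l t \<omega> = \<theta> + exp (- \<kappa> * (t - s)) * (l s \<omega> - \<theta>)"
  using intensity_path[OF assms(1-3)] assms(4) by (simp add: jump_integral_def)

lemma intensity_right_limit:
  assumes \<omega>: "\<omega> \<in> space M" and t: "0 \<le> t"
  shows "((\<lambda>r. l r \<omega>) \<longlongrightarrow> l t \<omega>) (at_right t)"
proof -
  interpret counting_path "\<lambda>t. N t \<omega>" by (rule path[OF \<omega>])
  obtain b where b: "t < b" "\<And>u. t \<le> u \<Longrightarrow> u < b \<Longrightarrow> N u \<omega> = N t \<omega>"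
    using locally_constant[OF t] by blast
  have "\<theta> + exp (- \<kappa> * (r - t)) * (l t \<omega> - \<theta>) = l r \<omega>" if "t < r" "r < b" for r
    using intensity_between_jumps[OF \<omega> t, of r] b(2)[of r] that by simp
  then have "eventually (\<lambda>r. \<theta> + exp (- \<kappa> * (r - t)) * (l t \<omega> - \<theta>) = l r \<omega>) (at_right t)"
    unfolding eventually_at_right_field using b(1) by blast
  moreover have "((\<lambda>r. \<theta> + exp (- \<kappa> * (r - t)) * (l t \<omega> - \<theta>)) \<longlongrightarrow>
      \<theta> + exp (- \<kappa> * (t - t)) * (l t \<omega> - \<theta>)) (at_right t)"
    by (intro tendsto_intros)
  ultimately have "((\<lambda>r. l r \<omega>) \<longlongrightarrow> \<theta> + exp (- \<kappa> * (t - t)) * (l t \<omega> - \<theta>)) (at_right t)"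
    by (rule Lim_transform_eventually[rotated])
  then show ?thesis by simp
qed

text \<open>The paths are right-continuous, so \<open>l\<close> is the limit of its values at the next point of finer and finer
  grids.  The sigma-algebra \<open>G\<close> is kept general because the time change needs the one generated by the
  Hawkes process.\<close>

lemma intensity_jointly_measurable:
  assumes G: "space G = space M" "\<And>t. 0 \<le> t \<Longrightarrow> l t \<in> borel_measurable G"
  shows "(\<lambda>p. l (max 0 (fst p)) (snd p)) \<in> borel_measurable (borel \<Otimes>\<^sub>M G)"
proof (rule borel_measurable_LIMSEQ_real)
  define j where "j k u = nat (\<lfloor>real (Suc k) * max 0 u\<rfloor> + 1)" for k and u :: real
  define d where "d k u = real (j k u) / real (Suc k)" for k u
  have d_greater: "max 0 u < d k u" and d_le: "d k u \<le> max 0 u + 1 / real (Suc k)" for k u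
  proof -
    have "0 \<le> real (Suc k) * max 0 u" by simp
    then have j: "real (j k u) = real_of_int \<lfloor>real (Suc k) * max 0 u\<rfloor> + 1"
      unfolding j_def by (simp del: of_nat_Suc)
    have *: "real (Suc k) * max 0 u < real (j k u)" "real (j k u) \<le> real (Suc k) * max 0 u + 1"
      unfolding j by linarith+
    then have "real (j k u) / real (Suc k) \<le> (real (Suc k) * max 0 u + 1) / real (Suc k)"
      by (intro divide_right_mono) auto
    then show "max 0 u < d k u" "d k u \<le> max 0 u + 1 / real (Suc k)"
      unfolding d_def using *(1)
      by (auto simp: pos_less_divide_eq add_divide_distrib mult.commute simp del: of_nat_Suc max_less_iff_conj)
  qed
  fix k
  have j: "(\<lambda>p. j k (fst p)) \<in> borel \<Otimes>\<^sub>M G \<rightarrow>\<^sub>M count_space UNIV"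
    unfolding j_def by measurable
  have "(\<lambda>p. l (real i / real (Suc k)) (snd p)) \<in> borel_measurable (borel \<Otimes>\<^sub>M G)" for i
    using G(2)[of "real i / real (Suc k)"] by (intro measurable_compose[OF measurable_snd]) auto
  then show "(\<lambda>p. l (d k (fst p)) (snd p)) \<in> borel_measurable (borel \<Otimes>\<^sub>M G)"
    unfolding d_def by (rule measurable_compose_countable[OF _ j])
  fix p :: "real \<times> 'a" assume "p \<in> space (borel \<Otimes>\<^sub>M G)"
  then have \<omega>: "snd p \<in> space M"
    by (simp add: space_pair_measure mem_Times_iff G(1))
  have "(\<lambda>k. max 0 (fst p) + 1 / real (Suc k)) \<longlonglongrightarrow> max 0 (fst p) + 0"
    by (intro tendsto_intros LIMSEQ_Suc[OF lim_1_over_n])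
  then have upper: "(\<lambda>k. max 0 (fst p) + 1 / real (Suc k)) \<longlonglongrightarrow> max 0 (fst p)"
    by simp
  have "(\<lambda>k. d k (fst p)) \<longlonglongrightarrow> max 0 (fst p)"
  proof (rule tendsto_sandwich[OF _ _ tendsto_const upper])
    show "\<forall>\<^sub>F k in sequentially. max 0 (fst p) \<le> d k (fst p)"
      using d_greater by (intro always_eventually allI less_imp_le)
    show "\<forall>\<^sub>F k in sequentially. d k (fst p) \<le> max 0 (fst p) + 1 / real (Suc k)"
      using d_le by (intro always_eventually allI)
  qed
  then have "filterlim (\<lambda>k. d k (fst p)) (at_right (max 0 (fst p))) sequentially"
    unfolding filterlim_at using d_greater[of "fst p"]
    by (simp add: less_imp_neq[THEN not_sym] del: max_less_iff_conj)
  moreover have "((\<lambda>r. l r (snd p)) \<longlongrightarrow> l (max 0 (fst p)) (snd p)) (at_right (max 0 (fst p)))"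
    by (rule intensity_right_limit[OF \<omega>]) simp
  ultimately show "(\<lambda>k. l (d k (fst p)) (snd p)) \<longlonglongrightarrow> l (max 0 (fst p)) (snd p)"
    by (rule filterlim_compose[rotated])
qed

lemma l_measurable: "0 \<le> t \<Longrightarrow> l t \<in> borel_measurable M"
  using l_adapted measurable_F_M by blast

lemma intensity_measurable_pair: "(\<lambda>p. l (max 0 (fst p)) (snd p)) \<in> borel_measurable (borel \<Otimes>\<^sub>M M)"
  using l_measurable by (intro intensity_jointly_measurable) auto

text \<open>Independence of the marks and the stochastic intensity combine to one formula.  The integrand \<open>C\<close> is
  evaluated at jump times and must be predictable, but in the time integral on the right it may be changed
  on null sets of times: there a left limit \<open>C\<close> can be replaced by the process \<open>C'\<close> itself.\<close>

lemma campbell_formula: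
  assumes C: "C \<in> borel_measurable predictable" and h: "h \<in> borel_measurable borel"
    and C': "(\<lambda>p. C' p * indicator {0<..} (fst p)) \<in> borel_measurable (borel \<Otimes>\<^sub>M M)"
    and eq: "\<And>\<omega>. \<omega> \<in> space M \<Longrightarrow> AE u in lborel. 0 < u \<longrightarrow> C (u, \<omega>) = C' (u, \<omega>)"
  shows "(\<integral>\<^sup>+\<omega>. jump_sum (\<lambda>t. N t \<omega>) (\<lambda>k u. C (u, \<omega>) * h (\<xi> k \<omega>)) \<partial>M) =
    (\<integral>\<^sup>+\<omega>. h (\<xi> 1 \<omega>) \<partial>M) * (\<integral>\<^sup>+u\<in>{0<..}. (\<integral>\<^sup>+\<omega>. C' (u, \<omega>) * ennreal (l u \<omega>) \<partial>M) \<partial>lborel)"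
proof -
  interpret pair_sigma_finite lborel M ..
  note [measurable] = C' intensity_measurable_pair
  let ?f = "\<lambda>p. (C' p * indicator {0<..} (fst p)) * ennreal (l (max 0 (fst p)) (snd p))"
  have "(\<integral>\<^sup>+\<omega>. (\<integral>\<^sup>+u\<in>{0<..}. (C (u, \<omega>) * ennreal (l u \<omega>)) \<partial>lborel) \<partial>M) =
      (\<integral>\<^sup>+\<omega>. (\<integral>\<^sup>+u. ?f (u, \<omega>) \<partial>lborel) \<partial>M)"
  proof (rule nn_integral_cong, rule nn_integral_cong_AE)
    fix \<omega> assume "\<omega> \<in> space M"
    from eq[OF this] show "AE u in lborel. C (u, \<omega>) * ennreal (l u \<omega>) * indicator {0<..} u = ?f (u, \<omega>)"
      by eventually_elim (auto simp: max_def split: split_indicator)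
  qed
  also have "\<dots> = (\<integral>\<^sup>+u. (\<integral>\<^sup>+\<omega>. ?f (u, \<omega>) \<partial>M) \<partial>lborel)"
    by (rule Fubini') measurable
  also have "\<dots> = (\<integral>\<^sup>+u\<in>{0<..}. (\<integral>\<^sup>+\<omega>. C' (u, \<omega>) * ennreal (l u \<omega>) \<partial>M) \<partial>lborel)"
    by (intro nn_integral_cong) (auto simp: max_def split: split_indicator)
  finally show ?thesis
    using nn_integral_jump_sum_mark[OF C h] nn_integral_jump_sum[OF C] by simp
qed

lemma positive_at_jumps:
  assumes \<omega>: "\<omega> \<in> space M" and k: "k \<in> {N s \<omega><..N t \<omega>}" and t: "0 \<le> t"
  shows "0 < \<tau> k \<omega>" "0 < \<xi> k \<omega>"
proof -
  have "reached (\<lambda>t. N t \<omega>) k" "1 \<le> k"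
    using k t unfolding reached_def by auto
  then show "0 < \<tau> k \<omega>" "0 < \<xi> k \<omega>"
    using counting_path.jump_time_pos[OF path[OF \<omega>]] \<xi>_pos[OF _ \<omega>] by auto
qed

abbreviation moment :: "('a \<Rightarrow> real) \<Rightarrow> ennreal" where
  "moment X \<equiv> \<integral>\<^sup>+\<omega>. ennreal (X \<omega>) \<partial>M"

context
  fixes D :: "real \<Rightarrow> 'a \<Rightarrow> real" and h :: "real \<Rightarrow> real" and r s t :: real
  assumes s: "0 \<le> s" "s \<le> t"
    and D: "(\<lambda>p. D (fst p) (snd p)) \<in> borel_measurable predictable"
    and D_nonneg: "\<forall>u>0. \<forall>\<omega>\<in>space M. 0 \<le> D u \<omega>"
    and h: "h \<in> borel_measurable borel" and h_nonneg: "\<forall>x>0. 0 \<le> h x"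
begin

lemma jump_integral_nonneg: "\<omega> \<in> space M \<Longrightarrow> 0 \<le> jump_integral r D h s t \<omega>"
  unfolding jump_integral_def using positive_at_jumps[of \<omega> _ s t] s D_nonneg h_nonneg
  by (intro sum_nonneg mult_nonneg_nonneg) auto

lemma jump_integral_eq_jump_sum:
  assumes \<omega>: "\<omega> \<in> space M"
  shows "ennreal (jump_integral r D h s t \<omega>) = jump_sum (\<lambda>t. N t \<omega>)
    (\<lambda>k u. (ennreal (exp (- r * (t - u))) * ennreal (D u \<omega>) * indicator {s<..t} u) * ennreal (h (\<xi> k \<omega>)))"
proof -
  have "ennreal (jump_integral r D h s t \<omega>) =
      (\<Sum>k\<in>{N s \<omega><..N t \<omega>}. ennreal (exp (- r * (t - \<tau> k \<omega>)) * D (\<tau> k \<omega>) \<omega> * h (\<xi> k \<omega>)))"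
    unfolding jump_integral_def using positive_at_jumps[OF \<omega>, of _ s t] s D_nonneg \<omega> h_nonneg
    by (intro sum_ennreal[symmetric] mult_nonneg_nonneg) auto
  also have "\<dots> = (\<Sum>k\<in>{N s \<omega><..N t \<omega>}.
      ennreal (exp (- r * (t - \<tau> k \<omega>))) * ennreal (D (\<tau> k \<omega>) \<omega>) * ennreal (h (\<xi> k \<omega>)))"
    using positive_at_jumps[OF \<omega>, of _ s t] s D_nonneg \<omega> by (intro sum.cong refl) (simp add: ennreal_mult')
  also have "\<dots> = jump_sum (\<lambda>t. N t \<omega>)
      (\<lambda>k u. (ennreal (exp (- r * (t - u))) * ennreal (D u \<omega>) * ennreal (h (\<xi> k \<omega>))) * indicator {s<..t} u)"
    by (rule counting_path.jump_sum_interval[OF path[OF \<omega>] s, symmetric])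
  finally show ?thesis
    by (simp add: ac_simps)
qed

lemma jump_integral_measurable: "jump_integral r D h s t \<in> borel_measurable M"
proof -
  define C where "C p = ennreal (exp (- r * (t - fst p))) * ennreal (D (fst p) (snd p)) * indicator {s<..t} (fst p)"
    for p :: "real \<times> 'a"
  define g where "g k \<omega> = (if reached (\<lambda>t. N t \<omega>) (Suc k) then C (\<tau> (Suc k) \<omega>, \<omega>) else 0)" for k \<omega>
  have "C \<in> borel_measurable predictable"
    unfolding C_def using D by measurable
  from measurable_strict_past_M[OF predictable_at_jump_strict_past[OF this]]
  have g: "g k \<in> borel_measurable M" for k
    unfolding g_def .
  have "(\<lambda>\<omega>. enn2real (\<Sum>k. g k \<omega> * ennreal (h (\<xi> (Suc k) \<omega>)))) \<in> borel_measurable M"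
    using g mark_measurable h by measurable
  then show ?thesis
  proof (rule measurable_cong[THEN iffD1, rotated])
    fix \<omega> assume \<omega>: "\<omega> \<in> space M"
    have "(\<Sum>k. g k \<omega> * ennreal (h (\<xi> (Suc k) \<omega>))) = ennreal (jump_integral r D h s t \<omega>)"
      unfolding jump_integral_eq_jump_sum[OF \<omega>] jump_sum_def C_def g_def by (intro suminf_cong) auto
    then show "enn2real (\<Sum>k. g k \<omega> * ennreal (h (\<xi> (Suc k) \<omega>))) = jump_integral r D h s t \<omega>"
      using jump_integral_nonneg[OF \<omega>] by simp
  qed
qed

text \<open>Campbell's formula for the integrand \<open>Z * exp (- r (t - u)) * D\<close> on \<open>(s, t]\<close>, which is predictable because
  \<open>Z\<close> is known at the start of the interval.\<close>

lemma jump_integral_moment: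
  assumes Z: "Z \<in> borel_measurable (F s)" and Z_nonneg: "\<And>\<omega>. 0 \<le> Z \<omega>"
    and D': "(\<lambda>p. D' (fst p) (snd p) * indicator {0<..} (fst p)) \<in> borel_measurable (borel \<Otimes>\<^sub>M M)"
    and eq: "\<forall>\<omega>\<in>space M. AE u in lborel. 0 < u \<longrightarrow> D u \<omega> = D' u \<omega>"
  shows "moment (\<lambda>\<omega>. Z \<omega> * jump_integral r D h s t \<omega>) = moment (\<lambda>\<omega>. h (\<xi> 1 \<omega>)) *
    exp_convolution r s t (\<lambda>u. moment (\<lambda>\<omega>. Z \<omega> * (D' u \<omega> * l u \<omega>)))"
proof -
  define C where "C D p = ennreal (Z (snd p)) * (ennreal (exp (- r * (t - fst p))) *
    ennreal (D (fst p) (snd p))) * indicator {s<..t} (fst p)" for D and p :: "real \<times> 'a"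
  have "C D = (\<lambda>p. ennreal (if s < fst p then Z (snd p) else 0) * (ennreal (exp (- r * (t - fst p))) *
      ennreal (D (fst p) (snd p))) * indicator {s<..t} (fst p))"
    unfolding C_def by (auto simp: fun_eq_iff split: split_indicator)
  also have "\<dots> \<in> borel_measurable predictable"
    using measurable_after_predictable[OF s(1) Z] D by measurable
  finally have C: "C D \<in> borel_measurable predictable" .
  have Z_M [measurable]: "Z \<in> borel_measurable M"
    using Z by (rule measurable_F_M)
  have "(\<lambda>p. C D' p * indicator {0<..} (fst p)) = (\<lambda>p. ennreal (Z (snd p)) * (ennreal (exp (- r * (t - fst p))) *
      ennreal (D' (fst p) (snd p) * indicator {0<..} (fst p))) * indicator {s<..t} (fst p))"
    unfolding C_def by (auto simp: fun_eq_iff split: split_indicator)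
  also have "\<dots> \<in> borel_measurable (borel \<Otimes>\<^sub>M M)"
    using D' by measurable
  finally have C': "(\<lambda>p. C D' p * indicator {0<..} (fst p)) \<in> borel_measurable (borel \<Otimes>\<^sub>M M)" .
  have CC': "AE u in lborel. 0 < u \<longrightarrow> C D (u, \<omega>) = C D' (u, \<omega>)" if "\<omega> \<in> space M" for \<omega>
    using bspec[OF eq that] unfolding C_def by eventually_elim auto
  have "moment (\<lambda>\<omega>. Z \<omega> * jump_integral r D h s t \<omega>) =
      (\<integral>\<^sup>+\<omega>. jump_sum (\<lambda>t. N t \<omega>) (\<lambda>k u. C D (u, \<omega>) * ennreal (h (\<xi> k \<omega>))) \<partial>M)"
  proof (rule nn_integral_cong)
    fix \<omega> assume \<omega>: "\<omega> \<in> space M"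
    show "ennreal (Z \<omega> * jump_integral r D h s t \<omega>) =
        jump_sum (\<lambda>t. N t \<omega>) (\<lambda>k u. C D (u, \<omega>) * ennreal (h (\<xi> k \<omega>)))"
      unfolding ennreal_mult'[OF Z_nonneg] jump_integral_eq_jump_sum[OF \<omega>] jump_sum_def C_def
        ennreal_suminf_cmult[symmetric]
      by (intro suminf_cong) (auto simp: ac_simps)
  qed
  also have "\<dots> = moment (\<lambda>\<omega>. h (\<xi> 1 \<omega>)) *
      (\<integral>\<^sup>+u\<in>{0<..}. (\<integral>\<^sup>+\<omega>. C D' (u, \<omega>) * ennreal (l u \<omega>) \<partial>M) \<partial>lborel)"
    by (rule campbell_formula[OF C _ C' CC', where h = "\<lambda>x. ennreal (h x)"]) (use h in measurable)
  also have "(\<integral>\<^sup>+u\<in>{0<..}. (\<integral>\<^sup>+\<omega>. C D' (u, \<omega>) * ennreal (l u \<omega>) \<partial>M) \<partial>lborel) =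
      exp_convolution r s t (\<lambda>u. moment (\<lambda>\<omega>. Z \<omega> * (D' u \<omega> * l u \<omega>)))"
  proof (rule nn_integral_cong_AE)
    show "AE u in lborel. (\<integral>\<^sup>+\<omega>. C D' (u, \<omega>) * ennreal (l u \<omega>) \<partial>M) * indicator {0<..} u =
        ennreal (exp (- r * (t - u))) * moment (\<lambda>\<omega>. Z \<omega> * (D' u \<omega> * l u \<omega>)) * indicator {s..t} u"
      using AE_lborel_singleton[of s]
    proof eventually_elim
      case (elim u)
      show ?case
      proof (cases "s < u \<and> u \<le> t")
        case True
        then have u: "0 < u" using s by simp
        have [measurable]: "l u \<in> borel_measurable M" "(\<lambda>\<omega>. D' u \<omega>) \<in> borel_measurable M"
          using u l_measurable measurable_Pair2[OF D', of u] by auto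
        have "(\<integral>\<^sup>+\<omega>. C D' (u, \<omega>) * ennreal (l u \<omega>) \<partial>M) =
            (\<integral>\<^sup>+\<omega>. ennreal (exp (- r * (t - u))) * ennreal (Z \<omega> * (D' u \<omega> * l u \<omega>)) \<partial>M)"
          unfolding C_def using True u l_nonneg Z_nonneg
          by (intro nn_integral_cong) (simp add: ennreal_mult' ennreal_mult''[of "l u _"] ac_simps)
        also have "\<dots> = ennreal (exp (- r * (t - u))) * moment (\<lambda>\<omega>. Z \<omega> * (D' u \<omega> * l u \<omega>))"
          by (rule nn_integral_cmult) measurable
        finally show ?thesis
          using True u by simp
      next
        case False
        then show ?thesis
          using elim unfolding C_def by (auto split: split_indicator)
      qed
    qed
  qed
  finally show ?thesis .
qed

end

section \<open>Equations for the first two moments\<close>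

lemma moment_add:
  assumes "X \<in> borel_measurable M" "Y \<in> borel_measurable M"
    and "\<And>\<omega>. \<omega> \<in> space M \<Longrightarrow> 0 \<le> X \<omega>" "\<And>\<omega>. \<omega> \<in> space M \<Longrightarrow> 0 \<le> Y \<omega>"
  shows "moment (\<lambda>\<omega>. X \<omega> + Y \<omega>) = moment X + moment Y"
proof -
  have "moment (\<lambda>\<omega>. X \<omega> + Y \<omega>) = (\<integral>\<^sup>+\<omega>. ennreal (X \<omega>) + ennreal (Y \<omega>) \<partial>M)"
    using assms by (intro nn_integral_cong) simp
  also have "\<dots> = moment X + moment Y"
    using assms by (intro nn_integral_add) auto
  finally show ?thesis .
qed

lemma moment_cmult: "X \<in> borel_measurable M \<Longrightarrow> 0 \<le> c \<Longrightarrow> moment (\<lambda>\<omega>. c * X \<omega>) = ennreal c * moment X"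
  by (simp add: ennreal_mult' nn_integral_cmult)

lemma moment_mono: "(\<And>\<omega>. \<omega> \<in> space M \<Longrightarrow> X \<omega> \<le> Y \<omega>) \<Longrightarrow> moment X \<le> moment Y"
  by (intro nn_integral_mono ennreal_leI)

lemma mark_linear: "0 \<le> c \<Longrightarrow> moment (\<lambda>\<omega>. c * \<xi> 1 \<omega>) = ennreal (c * \<mu>)"
  unfolding ennreal_mult'[of c \<mu>] mark_mean[symmetric] by (intro moment_cmult mark_measurable) auto

lemma mark_quadratic: "0 \<le> c \<Longrightarrow> moment (\<lambda>\<omega>. c * (\<xi> 1 \<omega>)\<^sup>2) = ennreal (c * (\<psi>\<^sup>2 + \<mu>\<^sup>2))"
  unfolding ennreal_mult'[of c "\<psi>\<^sup>2 + \<mu>\<^sup>2"] mark_second_moment[symmetric]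
  using mark_measurable[of 1] by (intro moment_cmult) auto

lemma plain_jump_integral:
  assumes s: "0 \<le> s" "s \<le> t" and h: "h \<in> borel_measurable borel" "\<forall>x>0. 0 \<le> h x"
  shows "jump_integral r (\<lambda>_ _. 1) h s t \<in> borel_measurable M"
    and "\<And>\<omega>. \<omega> \<in> space M \<Longrightarrow> 0 \<le> jump_integral r (\<lambda>_ _. 1) h s t \<omega>"
    and "Z \<in> borel_measurable (F s) \<Longrightarrow> (\<And>\<omega>. 0 \<le> Z \<omega>) \<Longrightarrow>
      moment (\<lambda>\<omega>. Z \<omega> * jump_integral r (\<lambda>_ _. 1) h s t \<omega>) =
      moment (\<lambda>\<omega>. h (\<xi> 1 \<omega>)) * exp_convolution r s t (\<lambda>u. moment (\<lambda>\<omega>. Z \<omega> * l u \<omega>))"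
  using jump_integral_measurable[OF s _ _ h, where D = "\<lambda>_ _. 1" and r = r]
    jump_integral_nonneg[OF s _ _ h, where D = "\<lambda>_ _. 1" and r = r]
    jump_integral_moment[OF s _ _ h, where D = "\<lambda>_ _. 1" and D' = "\<lambda>_ _. 1" and Z = Z and r = r] by simp_all

text \<open>Without jumps the intensity is a convex combination of \<open>\<theta>\<close> and its last value.\<close>

lemma relaxation_bounds:
  assumes "0 \<le> s" "s \<le> t" "\<omega> \<in> space M"
  shows "0 \<le> \<theta> + exp (- \<kappa> * (t - s)) * (l s \<omega> - \<theta>)"
    and "\<theta> + exp (- \<kappa> * (t - s)) * (l s \<omega> - \<theta>) \<le> \<theta> + l s \<omega>"
proof -
  have e: "exp (- \<kappa> * (t - s)) \<le> 1"
    using \<kappa>_pos assms by simp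
  have eq: "\<theta> + exp (- \<kappa> * (t - s)) * (l s \<omega> - \<theta>) =
      \<theta> * (1 - exp (- \<kappa> * (t - s))) + exp (- \<kappa> * (t - s)) * l s \<omega>"
    by (simp add: algebra_simps)
  have "exp (- \<kappa> * (t - s)) * l s \<omega> \<le> 1 * l s \<omega>" "\<theta> * (1 - exp (- \<kappa> * (t - s))) \<le> \<theta> * 1"
    using e l_nonneg[OF assms(1,3)] \<theta>_nonneg by (intro mult_right_mono mult_left_mono; simp)+
  then show "\<theta> + exp (- \<kappa> * (t - s)) * (l s \<omega> - \<theta>) \<le> \<theta> + l s \<omega>"
    unfolding eq by simp
  show "0 \<le> \<theta> + exp (- \<kappa> * (t - s)) * (l s \<omega> - \<theta>)"
    unfolding eq using e l_nonneg[OF assms(1,3)] \<theta>_nonneg by simp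
qed

text \<open>Campbell's formula with kernel \<open>exp (- \<kappa> (t - u))\<close>, applied to the path formula.\<close>

lemma mean_equation:
  assumes s: "0 \<le> s" "s \<le> t" and Z: "Z \<in> borel_measurable (F s)" and Z_nonneg: "\<And>\<omega>. 0 \<le> Z \<omega>"
  shows "moment (\<lambda>\<omega>. Z \<omega> * l t \<omega>) =
    moment (\<lambda>\<omega>. Z \<omega> * (\<theta> + exp (- \<kappa> * (t - s)) * (l s \<omega> - \<theta>))) +
    ennreal (\<eta> * \<mu>) * exp_convolution \<kappa> s t (\<lambda>u. moment (\<lambda>\<omega>. Z \<omega> * l u \<omega>))"
proof -
  have \<eta>: "(\<lambda>x. \<eta> * x) \<in> borel_measurable borel" "\<forall>x>0. 0 \<le> \<eta> * x"
    using \<eta>_pos by auto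
  note J = plain_jump_integral[OF s \<eta>, where r = \<kappa>]
  note [measurable] = measurable_F_M[OF Z] l_measurable[OF s(1)] J(1)
  have "moment (\<lambda>\<omega>. Z \<omega> * l t \<omega>) = moment (\<lambda>\<omega>. Z \<omega> * (\<theta> + exp (- \<kappa> * (t - s)) * (l s \<omega> - \<theta>)) +
      Z \<omega> * jump_integral \<kappa> (\<lambda>_ _. 1) (\<lambda>x. \<eta> * x) s t \<omega>)"
    by (intro nn_integral_cong) (simp only: intensity_path[OF _ s] distrib_left)
  also have "\<dots> = moment (\<lambda>\<omega>. Z \<omega> * (\<theta> + exp (- \<kappa> * (t - s)) * (l s \<omega> - \<theta>))) +
      moment (\<lambda>\<omega>. Z \<omega> * jump_integral \<kappa> (\<lambda>_ _. 1) (\<lambda>x. \<eta> * x) s t \<omega>)"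
    using Z_nonneg relaxation_bounds(1)[OF s] J(2) by (intro moment_add mult_nonneg_nonneg) auto
  finally show ?thesis
    using J(3)[OF Z Z_nonneg] mark_linear[of \<eta>] \<eta>_pos by simp
qed

text \<open>The value of \<open>exp (\<kappa> t) * (l t - \<theta>)\<close> between the \<open>j\<close>-th and the next jump, where it is constant in time.\<close>

definition scaled_level :: "nat \<Rightarrow> 'a \<Rightarrow> real" where
  "scaled_level j \<omega> = l 0 \<omega> - \<theta> + (\<Sum>k=1..j. \<eta> * (exp (\<kappa> * \<tau> k \<omega>) * \<xi> k \<omega>))"

text \<open>The left limit of the intensity, given by a formula that makes sense at all times.\<close>

definition left_intensity :: "real \<Rightarrow> 'a \<Rightarrow> real" where
  "left_intensity u \<omega> = \<theta> + exp (- \<kappa> * u) * scaled_level (left_count (\<lambda>t. N t \<omega>) u) \<omega>"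

lemma intensity_scaled_level:
  assumes \<omega>: "\<omega> \<in> space M" and t: "0 \<le> t"
  shows "l t \<omega> = \<theta> + exp (- \<kappa> * t) * scaled_level (N t \<omega>) \<omega>"
proof -
  have I: "{N 0 \<omega><..N t \<omega>} = {1..N t \<omega>}"
    using N_zero[OF \<omega>] by auto
  have "exp (- \<kappa> * (t - \<tau> k \<omega>)) = exp (- \<kappa> * t) * exp (\<kappa> * \<tau> k \<omega>)" for k
    by (simp add: exp_add[symmetric] algebra_simps)
  then show ?thesis
    using intensity_path[OF \<omega> order_refl t] unfolding jump_integral_def scaled_level_def I
    by (simp add: sum_distrib_left distrib_left right_diff_distrib mult.assoc mult.left_commute)
qed

lemma left_intensity_limit:
  assumes u: "0 < u" and \<omega>: "\<omega> \<in> space M"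
  shows "((\<lambda>r. l r \<omega>) \<longlongrightarrow> left_intensity u \<omega>) (at_left u)"
proof -
  interpret counting_path "\<lambda>t. N t \<omega>" by (rule path[OF \<omega>])
  let ?c = "scaled_level (left_count (\<lambda>t. N t \<omega>) u) \<omega>"
  have "eventually (\<lambda>r. 0 < r) (at_left u)"
    using u by (auto simp: eventually_at_left_field)
  then have "eventually (\<lambda>r. \<theta> + exp (- \<kappa> * r) * ?c = l r \<omega>) (at_left u)"
    using left_count_eventually[OF u]
    by eventually_elim (simp add: intensity_scaled_level[OF \<omega>])
  moreover have "((\<lambda>r. \<theta> + exp (- \<kappa> * r) * ?c) \<longlongrightarrow> left_intensity u \<omega>) (at_left u)"
    unfolding left_intensity_def by (intro tendsto_intros)
  ultimately show ?thesis
    by (rule Lim_transform_eventually[rotated])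
qed

lemma left_intensity_nonneg:
  assumes u: "0 < u" and \<omega>: "\<omega> \<in> space M"
  shows "0 \<le> left_intensity u \<omega>"
proof (rule tendsto_lowerbound[OF left_intensity_limit[OF assms]])
  show "eventually (\<lambda>r. 0 \<le> l r \<omega>) (at_left u)"
    unfolding eventually_at_left_field using u l_nonneg[OF _ \<omega>] by (intro exI[of _ 0]) auto
qed simp

lemma left_intensity_predictable: "(\<lambda>p. left_intensity (fst p) (snd p)) \<in> borel_measurable predictable"
  by (rule left_limit_predictable[OF l_adapted left_intensity_limit])

lemma left_intensity_AE_eq:
  assumes \<omega>: "\<omega> \<in> space M"
  shows "AE u in lborel. 0 < u \<longrightarrow> left_intensity u \<omega> = l u \<omega>"
  using counting_path.AE_left_count[OF path[OF \<omega>]]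
  by eventually_elim (simp add: left_intensity_def intensity_scaled_level[OF \<omega>])

lemma left_intensity_jump_time:
  assumes \<omega>: "\<omega> \<in> space M" and k: "reached (\<lambda>t. N t \<omega>) (Suc k)"
  shows "left_intensity (\<tau> (Suc k) \<omega>) \<omega> =
    \<theta> + exp (- \<kappa> * \<tau> (Suc k) \<omega>) * scaled_level k \<omega>"
  unfolding left_intensity_def counting_path.left_count_jump_time[OF path[OF \<omega>] k] ..

text \<open>Each jump raises the level \<open>r\<close> by \<open>d = \<eta> exp (\<kappa> T) \<xi>\<close>, and the square telescopes by
  \<open>(r + d)\<^sup>2 = r\<^sup>2 + 2 r d + d\<^sup>2\<close>.  Here \<open>r = exp (\<kappa> T) (l\<^sub>- - \<theta>)\<close> with \<open>l\<^sub>-\<close> the intensity just before the jump;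
  the term with \<open>\<theta>\<close> stands on the left so that all summands are nonnegative.\<close>

lemma scaled_level_square:
  assumes \<omega>: "\<omega> \<in> space M" and t: "0 \<le> t" and j: "j \<le> N t \<omega>"
  defines "T k \<equiv> \<tau> k \<omega>"
  shows "(scaled_level j \<omega>)\<^sup>2 + (\<Sum>k=1..j. exp (2 * \<kappa> * T k) * (2 * \<theta> * \<eta> * \<xi> k \<omega>)) =
    (l 0 \<omega> - \<theta>)\<^sup>2 + (\<Sum>k=1..j. exp (2 * \<kappa> * T k) * left_intensity (T k) \<omega> * (2 * \<eta> * \<xi> k \<omega>))
      + (\<Sum>k=1..j. exp (2 * \<kappa> * T k) * (\<eta>\<^sup>2 * (\<xi> k \<omega>)\<^sup>2))"
  using j
proof (induction j)
  case 0
  then show ?case by (simp add: scaled_level_def)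
next
  case (Suc j)
  have reached: "reached (\<lambda>t. N t \<omega>) (Suc j)"
    using Suc.prems t unfolding reached_def by blast
  define r where "r = scaled_level j \<omega>"
  define e where "e = exp (\<kappa> * T (Suc j))"
  define x where "x = \<xi> (Suc j) \<omega>"
  have e2: "exp (2 * \<kappa> * T (Suc j)) = e * e"
    unfolding e_def by (simp add: exp_add[symmetric])
  have level: "scaled_level (Suc j) \<omega> = r + \<eta> * (e * x)"
    unfolding scaled_level_def r_def e_def x_def T_def by simp
  have "exp (- \<kappa> * T (Suc j)) * e = 1"
    unfolding e_def by (simp add: exp_minus)
  then have left: "e * left_intensity (T (Suc j)) \<omega> = e * \<theta> + r"
    unfolding left_intensity_jump_time[OF \<omega> reached, folded T_def] r_def by (simp add: algebra_simps)
  have "(r + \<eta> * (e * x))\<^sup>2 + e * e * (2 * \<theta> * \<eta> * x) =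
      r\<^sup>2 + e * (e * left_intensity (T (Suc j)) \<omega>) * (2 * \<eta> * x) + e * e * (\<eta>\<^sup>2 * x\<^sup>2)"
    unfolding left by (simp add: power2_eq_square algebra_simps)
  then show ?case
    using Suc.IH Suc.prems unfolding level e2 x_def[symmetric] r_def[symmetric]
    by (simp add: e2[unfolded mult.assoc] x_def[symmetric] mult.assoc)
qed

lemma square_path:
  assumes \<omega>: "\<omega> \<in> space M" and t: "0 \<le> t"
  shows "(l t \<omega> - \<theta>)\<^sup>2 + jump_integral (2 * \<kappa>) (\<lambda>_ _. 1) (\<lambda>x. 2 * \<theta> * \<eta> * x) 0 t \<omega> =
    exp (- (2 * \<kappa>) * t) * (l 0 \<omega> - \<theta>)\<^sup>2
    + jump_integral (2 * \<kappa>) left_intensity (\<lambda>x. 2 * \<eta> * x) 0 t \<omega>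
    + jump_integral (2 * \<kappa>) (\<lambda>_ _. 1) (\<lambda>x. \<eta>\<^sup>2 * x\<^sup>2) 0 t \<omega>"
proof -
  have I: "{N 0 \<omega><..N t \<omega>} = {1..N t \<omega>}"
    using N_zero[OF \<omega>] by auto
  define E where "E = exp (- (2 * \<kappa>) * t)"
  have split: "exp (- (2 * \<kappa>) * (t - \<tau> k \<omega>)) = E * exp (2 * \<kappa> * \<tau> k \<omega>)" for k
    unfolding E_def by (simp add: exp_add[symmetric] algebra_simps)
  have "(exp (- \<kappa> * t))\<^sup>2 = E"
    unfolding E_def by (simp add: power2_eq_square exp_add[symmetric])
  then have sq: "(l t \<omega> - \<theta>)\<^sup>2 = E * (scaled_level (N t \<omega>) \<omega>)\<^sup>2"
    unfolding intensity_scaled_level[OF \<omega> t] by (simp add: power_mult_distrib)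
  have "E * ((scaled_level (N t \<omega>) \<omega>)\<^sup>2 + (\<Sum>k=1..N t \<omega>. exp (2 * \<kappa> * \<tau> k \<omega>) * (2 * \<theta> * \<eta> * \<xi> k \<omega>))) =
    E * ((l 0 \<omega> - \<theta>)\<^sup>2 + (\<Sum>k=1..N t \<omega>. exp (2 * \<kappa> * \<tau> k \<omega>) * left_intensity (\<tau> k \<omega>) \<omega> * (2 * \<eta> * \<xi> k \<omega>))
      + (\<Sum>k=1..N t \<omega>. exp (2 * \<kappa> * \<tau> k \<omega>) * (\<eta>\<^sup>2 * (\<xi> k \<omega>)\<^sup>2)))"
    unfolding scaled_level_square[OF \<omega> t order_refl] ..
  then show ?thesis
    unfolding jump_integral_def sq split I E_def[symmetric]
    by (simp only: distrib_left sum_distrib_left mult.assoc mult_1_left)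
qed

lemma jump_coefficients:
  shows "(\<lambda>x. 2 * \<eta> * x) \<in> borel_measurable borel" "\<forall>x>0. 0 \<le> 2 * \<eta> * x"
    and "(\<lambda>x. 2 * \<theta> * \<eta> * x) \<in> borel_measurable borel" "\<forall>x>0. 0 \<le> 2 * \<theta> * \<eta> * x"
    and "(\<lambda>x. \<eta>\<^sup>2 * x\<^sup>2) \<in> borel_measurable borel" "\<forall>x>0. 0 \<le> \<eta>\<^sup>2 * x\<^sup>2"
  using \<eta>_pos \<theta>_nonneg by auto

lemma intensity_after_zero_measurable:
  "(\<lambda>p. l (fst p) (snd p) * indicator {0<..} (fst p)) \<in> borel_measurable (borel \<Otimes>\<^sub>M M)"
proof -
  have "(\<lambda>p. l (fst p) (snd p) * indicator {0<..} (fst p)) =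
      (\<lambda>p. l (max 0 (fst p)) (snd p) * indicator {0<..} (fst p))"
    by (auto simp: fun_eq_iff max_def split: split_indicator)
  then show ?thesis
    using intensity_measurable_pair by simp
qed

text \<open>The square formula under the expectation: each of the three sums over jumps becomes a time integral,
  with the left limit of the intensity replaced by the intensity.  Nothing is subtracted, so the equation
  holds with values in \<open>[0, \<infinity>]\<close>.\<close>

lemma second_moment_equation:
  assumes t: "0 \<le> t" and Z: "Z \<in> borel_measurable (F 0)" and Z_nonneg: "\<And>\<omega>. 0 \<le> Z \<omega>"
  shows "moment (\<lambda>\<omega>. Z \<omega> * (l t \<omega> - \<theta>)\<^sup>2) +
      ennreal (2 * \<theta> * \<eta> * \<mu>) * exp_convolution (2 * \<kappa>) 0 t (\<lambda>u. moment (\<lambda>\<omega>. Z \<omega> * l u \<omega>)) =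
    moment (\<lambda>\<omega>. Z \<omega> * (exp (- (2 * \<kappa>) * t) * (l 0 \<omega> - \<theta>)\<^sup>2)) +
      ennreal (2 * \<eta> * \<mu>) * exp_convolution (2 * \<kappa>) 0 t (\<lambda>u. moment (\<lambda>\<omega>. Z \<omega> * (l u \<omega>)\<^sup>2)) +
      ennreal (\<eta>\<^sup>2 * (\<psi>\<^sup>2 + \<mu>\<^sup>2)) * exp_convolution (2 * \<kappa>) 0 t (\<lambda>u. moment (\<lambda>\<omega>. Z \<omega> * l u \<omega>))"
proof -
  note h = jump_coefficients
  note J1 = plain_jump_integral[OF order_refl t h(3,4), where r = "2 * \<kappa>"]
  note J3 = plain_jump_integral[OF order_refl t h(5,6), where r = "2 * \<kappa>"]
  have L: "\<forall>u>0. \<forall>\<omega>\<in>space M. 0 \<le> left_intensity u \<omega>"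
    "\<forall>\<omega>\<in>space M. AE u in lborel. 0 < u \<longrightarrow> left_intensity u \<omega> = l u \<omega>"
    using left_intensity_nonneg left_intensity_AE_eq by auto
  note J2 = jump_integral_measurable[OF order_refl t left_intensity_predictable L(1) h(1,2), where r = "2 * \<kappa>"]
    jump_integral_nonneg[OF order_refl t left_intensity_predictable L(1) h(1,2), where r = "2 * \<kappa>"]
    jump_integral_moment[OF order_refl t left_intensity_predictable L(1) h(1,2) Z Z_nonneg
      intensity_after_zero_measurable L(2), where r = "2 * \<kappa>"]
  note [measurable] = measurable_F_M[OF Z] l_measurable[OF order_refl] l_measurable[OF t] J1(1) J2(1) J3(1)
  have "moment (\<lambda>\<omega>. Z \<omega> * (l t \<omega> - \<theta>)\<^sup>2) +
      moment (\<lambda>\<omega>. Z \<omega> * jump_integral (2 * \<kappa>) (\<lambda>_ _. 1) (\<lambda>x. 2 * \<theta> * \<eta> * x) 0 t \<omega>) =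
    moment (\<lambda>\<omega>. Z \<omega> * (l t \<omega> - \<theta>)\<^sup>2 +
      Z \<omega> * jump_integral (2 * \<kappa>) (\<lambda>_ _. 1) (\<lambda>x. 2 * \<theta> * \<eta> * x) 0 t \<omega>)"
    using Z_nonneg J1(2) by (intro moment_add[symmetric]) auto
  also have "\<dots> = moment (\<lambda>\<omega>. Z \<omega> * (exp (- (2 * \<kappa>) * t) * (l 0 \<omega> - \<theta>)\<^sup>2) +
      Z \<omega> * jump_integral (2 * \<kappa>) left_intensity (\<lambda>x. 2 * \<eta> * x) 0 t \<omega> +
      Z \<omega> * jump_integral (2 * \<kappa>) (\<lambda>_ _. 1) (\<lambda>x. \<eta>\<^sup>2 * x\<^sup>2) 0 t \<omega>)"
    by (intro nn_integral_cong) (simp only: distrib_left[symmetric] square_path[OF _ t])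
  also have "\<dots> = moment (\<lambda>\<omega>. Z \<omega> * (exp (- (2 * \<kappa>) * t) * (l 0 \<omega> - \<theta>)\<^sup>2)) +
      moment (\<lambda>\<omega>. Z \<omega> * jump_integral (2 * \<kappa>) left_intensity (\<lambda>x. 2 * \<eta> * x) 0 t \<omega>) +
      moment (\<lambda>\<omega>. Z \<omega> * jump_integral (2 * \<kappa>) (\<lambda>_ _. 1) (\<lambda>x. \<eta>\<^sup>2 * x\<^sup>2) 0 t \<omega>)"
    using Z_nonneg J2(2) J3(2) by (subst moment_add; simp)+
  finally show ?thesis
    unfolding J1(3)[OF Z Z_nonneg] J2(3) J3(3)[OF Z Z_nonneg]
    using mark_linear[of "2 * \<eta>"] mark_linear[of "2 * \<theta> * \<eta>"] mark_quadratic[of "\<eta>\<^sup>2"] \<eta>_pos \<theta>_nonneg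
    by (simp add: power2_eq_square)
qed

section \<open>Uniform moment bounds\<close>

lemma initial_in_strict_past:
  assumes "f \<in> borel_measurable (F 0)"
  shows "f \<in> borel_measurable (strict_past M F N (Suc k))"
proof -
  have "A \<in> sets (strict_past M F N (Suc k))" if "A \<in> sets (F 0)" for A
  proof -
    have "A \<inter> {\<omega> \<in> space M. N 0 \<omega> < Suc k} = A"
      using in_F_imp_subset[OF that] N_zero by auto
    then show ?thesis
      using in_strict_past[OF order_refl that, of "Suc k"] by simp
  qed
  then have "subalgebra (strict_past M F N (Suc k)) (F 0)"
    unfolding subalgebra_def by (auto simp only: space_strict_past space_F)
  then show ?thesis
    using assms by (rule measurable_from_subalg)
qed

lemma nn_integral_initial_mark:
  assumes "Z \<in> borel_measurable (F 0)" "h \<in> borel_measurable borel" "1 \<le> k"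
  shows "(\<integral>\<^sup>+\<omega>. ennreal (Z \<omega>) * h (\<xi> k \<omega>) \<partial>M) = moment Z * (\<integral>\<^sup>+\<omega>. h (\<xi> 1 \<omega>) \<partial>M)"
  using nn_integral_mult_mark[OF initial_in_strict_past[of "\<lambda>\<omega>. ennreal (Z \<omega>)"], of h "k - 1"] assms
  by simp

lemma mark_nonneg: "1 \<le> k \<Longrightarrow> \<omega> \<in> space M \<Longrightarrow> 0 \<le> \<eta> * \<xi> k \<omega>"
  using \<xi>_pos[of k \<omega>] \<eta>_pos by simp

text \<open>A bound that is uniform in time, depending only on the initial intensity and the marks of the first
  \<open>n\<close> jumps.\<close>

lemma intensity_le_initial:
  assumes \<omega>: "\<omega> \<in> space M" and t: "0 \<le> t" and n: "N t \<omega> \<le> n"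
  shows "l t \<omega> \<le> \<theta> + l 0 \<omega> + (\<Sum>k=1..n. \<eta> * \<xi> k \<omega>)"
proof -
  interpret counting_path "\<lambda>t. N t \<omega>" by (rule path[OF \<omega>])
  have "jump_integral \<kappa> (\<lambda>_ _. 1) (\<lambda>x. \<eta> * x) 0 t \<omega> \<le> (\<Sum>k\<in>{N 0 \<omega><..N t \<omega>}. \<eta> * \<xi> k \<omega>)"
    unfolding jump_integral_def
  proof (rule sum_mono)
    fix k assume k: "k \<in> {N 0 \<omega><..N t \<omega>}"
    then have "\<tau> k \<omega> \<le> t"
      using count_ge_iff[OF t, of k] by simp
    then have "exp (- \<kappa> * (t - \<tau> k \<omega>)) \<le> 1"
      using \<kappa>_pos by simp
    then show "exp (- \<kappa> * (t - \<tau> k \<omega>)) * 1 * (\<eta> * \<xi> k \<omega>) \<le> \<eta> * \<xi> k \<omega>"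
      using mark_nonneg[OF _ \<omega>, of k] k by (simp add: mult_left_le_one_le)
  qed
  also have "\<dots> \<le> (\<Sum>k=1..n. \<eta> * \<xi> k \<omega>)"
    using n mark_nonneg[OF _ \<omega>] by (intro sum_mono2) auto
  finally show ?thesis
    using intensity_path[OF \<omega> order_refl t] relaxation_bounds[OF order_refl t \<omega>] by simp
qed

lemma weighted_square_finite:
  assumes Z: "Z \<in> borel_measurable (F 0)" and Z_nonneg: "\<And>\<omega>. 0 \<le> Z \<omega>"
    and p: "moment Z < \<infinity>"
    and q: "moment (\<lambda>\<omega>. Z \<omega> * (l 0 \<omega>)\<^sup>2) < \<infinity>"
  shows "moment (\<lambda>\<omega>. Z \<omega> * (\<theta> + l 0 \<omega> + (\<Sum>k=1..n. \<eta> * \<xi> k \<omega>))\<^sup>2) < \<infinity>"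
proof -
  have [measurable]: "Z \<in> borel_measurable M" "l 0 \<in> borel_measurable M"
    using measurable_F_M[OF Z] l_measurable by auto
  have sum_finite: "moment (\<lambda>\<omega>. Z \<omega> * (a \<omega> + b \<omega>)\<^sup>2) < \<infinity>"
    if [measurable]: "a \<in> borel_measurable M" "b \<in> borel_measurable M"
      and fin: "moment (\<lambda>\<omega>. Z \<omega> * (a \<omega>)\<^sup>2) < \<infinity>" "moment (\<lambda>\<omega>. Z \<omega> * (b \<omega>)\<^sup>2) < \<infinity>"
    for a b :: "'a \<Rightarrow> real"
  proof -
    have "(a \<omega> + b \<omega>)\<^sup>2 \<le> 2 * (a \<omega>)\<^sup>2 + 2 * (b \<omega>)\<^sup>2" for \<omega>
      using zero_le_power2[of "a \<omega> - b \<omega>"] by (simp add: power2_sum power2_diff)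
    from mult_left_mono[OF this Z_nonneg]
    have "moment (\<lambda>\<omega>. Z \<omega> * (a \<omega> + b \<omega>)\<^sup>2) \<le> moment (\<lambda>\<omega>. 2 * (Z \<omega> * (a \<omega>)\<^sup>2) + 2 * (Z \<omega> * (b \<omega>)\<^sup>2))"
      by (intro moment_mono) (simp add: distrib_left mult.left_commute)
    also have "\<dots> = moment (\<lambda>\<omega>. 2 * (Z \<omega> * (a \<omega>)\<^sup>2)) + moment (\<lambda>\<omega>. 2 * (Z \<omega> * (b \<omega>)\<^sup>2))"
      using Z_nonneg by (intro moment_add) auto
    also have "\<dots> = ennreal 2 * moment (\<lambda>\<omega>. Z \<omega> * (a \<omega>)\<^sup>2) + ennreal 2 * moment (\<lambda>\<omega>. Z \<omega> * (b \<omega>)\<^sup>2)"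
      by (intro arg_cong2[where f = "(+)"] moment_cmult) auto
    also have "\<dots> < \<infinity>"
      using fin by (simp add: ennreal_mult_less_top)
    finally show ?thesis .
  qed
  show ?thesis
  proof (induction n)
    case 0
    have "moment (\<lambda>\<omega>. Z \<omega> * \<theta>\<^sup>2) < \<infinity>"
      using p by (simp add: ennreal_mult'' nn_integral_multc ennreal_mult_less_top)
    then show ?case
      using sum_finite[of "\<lambda>_. \<theta>" "l 0"] q by simp
  next
    case (Suc n)
    have [measurable]: "\<xi> (Suc n) \<in> borel_measurable M"
      by (rule mark_measurable) simp
    have sum [measurable]: "(\<lambda>\<omega>. \<Sum>k=1..n. \<eta> * \<xi> k \<omega>) \<in> borel_measurable M"
      using mark_measurable by (intro borel_measurable_sum borel_measurable_times) auto
    have "moment (\<lambda>\<omega>. Z \<omega> * (\<eta> * \<xi> (Suc n) \<omega>)\<^sup>2) =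
        (\<integral>\<^sup>+\<omega>. ennreal (Z \<omega>) * ennreal (\<eta>\<^sup>2 * (\<xi> (Suc n) \<omega>)\<^sup>2) \<partial>M)"
      using Z_nonneg by (intro nn_integral_cong) (simp add: ennreal_mult' power_mult_distrib)
    also have "\<dots> = moment Z * ennreal (\<eta>\<^sup>2 * (\<psi>\<^sup>2 + \<mu>\<^sup>2))"
      using nn_integral_initial_mark[OF Z, of "\<lambda>x. ennreal (\<eta>\<^sup>2 * x\<^sup>2)" "Suc n"] mark_quadratic[of "\<eta>\<^sup>2"]
      by simp
    also have "\<dots> < \<infinity>"
      using p by (simp add: ennreal_mult_less_top del: ennreal_plus)
    finally have new: "moment (\<lambda>\<omega>. Z \<omega> * (\<eta> * \<xi> (Suc n) \<omega>)\<^sup>2) < \<infinity>" .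
    have "(\<lambda>\<omega>. \<theta> + l 0 \<omega> + (\<Sum>k=1..n. \<eta> * \<xi> k \<omega>)) \<in> borel_measurable M"
      "(\<lambda>\<omega>. \<eta> * \<xi> (Suc n) \<omega>) \<in> borel_measurable M"
      by measurable
    from sum_finite[OF this Suc.IH new] show ?case
      by (simp add: add.assoc)
  qed
qed

text \<open>Multiplication by this weight discards everything after the \<open>n\<close>-th jump.  It is formulated with the
  left limit of the count in order to be predictable.\<close>

definition truncation :: "nat \<Rightarrow> real \<Rightarrow> 'a \<Rightarrow> real" where
  "truncation n u \<omega> = (if left_count (\<lambda>t. N t \<omega>) u < n then 1 else 0)"

lemma truncation_predictable: "(\<lambda>p. truncation n (fst p) (snd p)) \<in> borel_measurable predictable"
proof -
  have "(\<lambda>p. if real (left_count (\<lambda>t. N t (snd p)) (fst p)) < real n then 1 else 0 :: real)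
      \<in> borel_measurable predictable"
    using left_count_predictable by measurable
  then show ?thesis
    unfolding truncation_def by simp
qed

lemma truncation_product_measurable:
  "(\<lambda>p. truncation n (fst p) (snd p) * indicator {0<..} (fst p)) \<in> borel_measurable (borel \<Otimes>\<^sub>M M)"
proof -
  have "(\<lambda>p. ennreal (truncation n (fst p) (snd p))) \<in> borel_measurable predictable"
    using truncation_predictable by measurable
  note [measurable] = predictable_imp_product_measurable[OF this]
  have "(\<lambda>p. enn2real (ennreal (truncation n (fst p) (snd p)) * indicator {0<..} (fst p)))
      \<in> borel_measurable (borel \<Otimes>\<^sub>M M)"
    by measurable
  also have "(\<lambda>p. enn2real (ennreal (truncation n (fst p) (snd p)) * indicator {0<..} (fst p))) =
      (\<lambda>p. truncation n (fst p) (snd p) * indicator {0<..} (fst p))"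
    by (auto simp: truncation_def split: split_indicator)
  finally show ?thesis .
qed

lemma truncation_nonneg: "0 \<le> truncation n u \<omega>"
  by (simp add: truncation_def)

text \<open>If the truncation has not been reached at time \<open>t\<close>, none of the earlier jumps is discarded.\<close>

lemma jump_integral_truncated:
  assumes \<omega>: "\<omega> \<in> space M" and t: "0 \<le> t" and n: "left_count (\<lambda>t. N t \<omega>) t < n"
  shows "jump_integral r (\<lambda>u \<omega>. truncation n u \<omega> * D u \<omega>) h 0 t \<omega> = jump_integral r D h 0 t \<omega>"
  unfolding jump_integral_def
proof (rule sum.cong[OF refl])
  interpret counting_path "\<lambda>t. N t \<omega>" by (rule path[OF \<omega>])
  fix k assume "k \<in> {N 0 \<omega><..N t \<omega>}"
  then have "left_count (\<lambda>t. N t \<omega>) (\<tau> k \<omega>) \<le> left_count (\<lambda>t. N t \<omega>) t"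
    using count_ge_iff[OF t, of k] by (intro left_count_mono) auto
  then show "exp (- r * (t - \<tau> k \<omega>)) * (truncation n (\<tau> k \<omega>) \<omega> * D (\<tau> k \<omega>) \<omega>) * h (\<xi> k \<omega>) =
      exp (- r * (t - \<tau> k \<omega>)) * D (\<tau> k \<omega>) \<omega> * h (\<xi> k \<omega>)"
    using n by (simp add: truncation_def)
qed

text \<open>Each truncated moment \<open>w n\<close> is bounded by some constant, so the contraction estimate applies to it and
  replaces that constant by one that does not depend on \<open>n\<close>.  Every path has finitely many jumps up to
  time \<open>t\<close>, so \<open>w n t\<close> dominates the moment over \<open>{N t < n}\<close>, and these increase to the full moment.\<close>

lemma bounded_of_truncated_equation:
  fixes f :: "real \<Rightarrow> 'a \<Rightarrow> real"
  defines "w n t \<equiv> moment (\<lambda>\<omega>. truncation n t \<omega> * f t \<omega>)"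
  assumes a: "0 \<le> a" "a < k" "0 \<le> b"
    and f: "\<And>t. 0 \<le> t \<Longrightarrow> f t \<in> borel_measurable M"
    and finite: "\<And>n. \<exists>K. \<forall>t\<ge>0. w n t \<le> ennreal K"
    and step: "\<And>n t. 0 \<le> t \<Longrightarrow> w n t \<le> ennreal b + ennreal a * exp_convolution k 0 t (w n)"
    and t: "0 \<le> t"
  shows "moment (f t) \<le> ennreal (b * k / (k - a))"
proof -
  have [measurable]: "N t \<in> M \<rightarrow>\<^sub>M count_space UNIV" "f t \<in> borel_measurable M"
    using N_adapted[OF t] f[OF t] by (auto intro: measurable_F_M)
  have "ennreal (f t \<omega>) = (SUP n. if N t \<omega> < n then ennreal (f t \<omega>) else 0)" for \<omega>
  proof (rule antisym)
    show "ennreal (f t \<omega>) \<le> (SUP n. if N t \<omega> < n then ennreal (f t \<omega>) else 0)"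
      by (rule SUP_upper2[of "Suc (N t \<omega>)"]) auto
    show "(SUP n. if N t \<omega> < n then ennreal (f t \<omega>) else 0) \<le> ennreal (f t \<omega>)"
      by (rule SUP_least) auto
  qed
  then have "moment (f t) = (\<integral>\<^sup>+\<omega>. (SUP n. if N t \<omega> < n then ennreal (f t \<omega>) else 0) \<partial>M)"
    by simp
  also have "\<dots> = (SUP n. \<integral>\<^sup>+\<omega>. (if N t \<omega> < n then ennreal (f t \<omega>) else 0) \<partial>M)"
    by (rule nn_integral_monotone_convergence_SUP) (auto simp: incseq_def le_fun_def)
  also have "\<dots> \<le> ennreal (b * k / (k - a))"
  proof (rule SUP_least)
    fix n
    obtain K where K: "\<And>t. 0 \<le> t \<Longrightarrow> w n t \<le> ennreal K"
      using finite by blast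
    have "(\<integral>\<^sup>+\<omega>. (if N t \<omega> < n then ennreal (f t \<omega>) else 0) \<partial>M) \<le> w n t"
      unfolding w_def
    proof (rule nn_integral_mono)
      fix \<omega> assume "\<omega> \<in> space M"
      from counting_path.left_count_le[OF path[OF this] t]
      show "(if N t \<omega> < n then ennreal (f t \<omega>) else 0) \<le> ennreal (truncation n t \<omega> * f t \<omega>)"
        by (auto simp: truncation_def)
    qed
    also have "w n t \<le> ennreal (b * k / (k - a))"
      by (rule volterra_contraction_bound[where s = 0 and K = K, OF a K step t])
    finally show "(\<integral>\<^sup>+\<omega>. (if N t \<omega> < n then ennreal (f t \<omega>) else 0) \<partial>M) \<le> ennreal (b * k / (k - a))" .
  qed
  finally show ?thesis .
qed

context
  fixes Z :: "'a \<Rightarrow> real" and p x y :: real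
  assumes stable: "\<eta> * \<mu> < \<kappa>" and Z: "Z \<in> borel_measurable (F 0)" and Z_nonneg: "\<And>\<omega>. 0 \<le> Z \<omega>"
    and p: "moment Z = ennreal p" "0 \<le> p"
    and x: "moment (\<lambda>\<omega>. Z \<omega> * l 0 \<omega>) = ennreal x" "0 \<le> x"
    and y: "moment (\<lambda>\<omega>. Z \<omega> * (l 0 \<omega>)\<^sup>2) = ennreal y" "0 \<le> y"
begin

text \<open>Up to the \<open>n\<close>-th jump the intensity is at most \<open>\<theta> + l 0\<close> plus the jumps caused by the first \<open>n\<close> marks.
  These marks are independent of the initial information, so the square of this bound has finite weighted
  mean.\<close>

lemma truncated_moments_finite:
  assumes f: "\<And>t \<omega>. 0 \<le> t \<Longrightarrow> \<omega> \<in> space M \<Longrightarrow> f t \<omega> \<le> Z \<omega> * (1 + (l t \<omega>)\<^sup>2)"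
  shows "\<exists>K. \<forall>t\<ge>0. moment (\<lambda>\<omega>. truncation n t \<omega> * f t \<omega>) \<le> ennreal K"
proof -
  let ?A = "\<lambda>\<omega>. \<theta> + l 0 \<omega> + (\<Sum>k=1..n. \<eta> * \<xi> k \<omega>)"
  have [measurable]: "Z \<in> borel_measurable M" "l 0 \<in> borel_measurable M" "(\<lambda>\<omega>. \<Sum>k=1..n. \<eta> * \<xi> k \<omega>) \<in> borel_measurable M"
    using measurable_F_M[OF Z] l_measurable mark_measurable by (auto intro!: borel_measurable_sum borel_measurable_times)
  have "(\<lambda>\<omega>. Z \<omega> * (?A \<omega>)\<^sup>2) \<in> borel_measurable M"
    by measurable
  then have "moment (\<lambda>\<omega>. Z \<omega> + Z \<omega> * (?A \<omega>)\<^sup>2) = moment Z + moment (\<lambda>\<omega>. Z \<omega> * (?A \<omega>)\<^sup>2)"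
    using Z_nonneg by (intro moment_add) auto
  also have "\<dots> < \<infinity>"
    using weighted_square_finite[OF Z Z_nonneg] p y by simp
  finally have "ennreal (enn2real (moment (\<lambda>\<omega>. Z \<omega> + Z \<omega> * (?A \<omega>)\<^sup>2))) = moment (\<lambda>\<omega>. Z \<omega> + Z \<omega> * (?A \<omega>)\<^sup>2)"
    by simp
  moreover have "moment (\<lambda>\<omega>. truncation n t \<omega> * f t \<omega>) \<le> moment (\<lambda>\<omega>. Z \<omega> + Z \<omega> * (?A \<omega>)\<^sup>2)" if t: "0 \<le> t" for t
  proof (rule moment_mono)
    fix \<omega> assume \<omega>: "\<omega> \<in> space M"
    show "truncation n t \<omega> * f t \<omega> \<le> Z \<omega> + Z \<omega> * (?A \<omega>)\<^sup>2"
    proof (cases "left_count (\<lambda>t. N t \<omega>) t < n")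
      case True
      then have "N t \<omega> \<le> n"
        using counting_path.count_le_left_count[OF path[OF \<omega>] t] by simp
      from power_mono[OF intensity_le_initial[OF \<omega> t this] l_nonneg[OF t \<omega>], of 2]
      have "Z \<omega> * (1 + (l t \<omega>)\<^sup>2) \<le> Z \<omega> * (1 + (?A \<omega>)\<^sup>2)"
        using Z_nonneg by (intro mult_left_mono) auto
      then show ?thesis
        using f[OF t \<omega>] True by (simp add: truncation_def distrib_left)
    qed (use Z_nonneg in \<open>simp add: truncation_def\<close>)
  qed
  ultimately show ?thesis
    by (intro exI[of _ "enn2real (moment (\<lambda>\<omega>. Z \<omega> + Z \<omega> * (?A \<omega>)\<^sup>2))"]) auto
qed

text \<open>The truncated mean satisfies the equation of the mean as an inequality, because the truncation is at
  most \<open>1\<close> and, where it does not vanish at time \<open>t\<close>, it discards no jump before \<open>t\<close>.\<close>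

lemma mean_bounded:
  assumes "0 \<le> t"
  shows "moment (\<lambda>\<omega>. Z \<omega> * l t \<omega>) \<le> ennreal ((\<theta> * p + x) * \<kappa> / (\<kappa> - \<eta> * \<mu>))"
proof (rule bounded_of_truncated_equation[where f = "\<lambda>t \<omega>. Z \<omega> * l t \<omega>", OF _ stable])
  have [measurable]: "Z \<in> borel_measurable M"
    by (rule measurable_F_M[OF Z])
  note l_measurable[measurable]
  show "0 \<le> \<eta> * \<mu>" "0 \<le> \<theta> * p + x"
    using \<eta>_pos mean_nonneg \<theta>_nonneg p x by auto
  show "(\<lambda>\<omega>. Z \<omega> * l t \<omega>) \<in> borel_measurable M" if "0 \<le> t" for t
    using that by measurable
  show "\<exists>K. \<forall>t\<ge>0. moment (\<lambda>\<omega>. truncation n t \<omega> * (Z \<omega> * l t \<omega>)) \<le> ennreal K" for n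
  proof (rule truncated_moments_finite)
    have "v \<le> 1 + v\<^sup>2" for v :: real
      using zero_le_power2[of "v - 1"] zero_le_power2[of v]
      unfolding power2_diff one_power2 mult_1_right by linarith
    then show "Z \<omega> * l t \<omega> \<le> Z \<omega> * (1 + (l t \<omega>)\<^sup>2)" for t \<omega>
      by (intro mult_left_mono Z_nonneg)
  qed
  fix n and t :: real assume t: "0 \<le> t"
  have \<eta>: "(\<lambda>x. \<eta> * x) \<in> borel_measurable borel" "\<forall>x>0. 0 \<le> \<eta> * x"
    using \<eta>_pos by auto
  have tr: "\<forall>u>0. \<forall>\<omega>\<in>space M. 0 \<le> truncation n u \<omega>"
    "\<forall>\<omega>\<in>space M. AE u in lborel. 0 < u \<longrightarrow> truncation n u \<omega> = truncation n u \<omega>"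
    using truncation_nonneg by auto
  let ?J = "jump_integral \<kappa> (truncation n) (\<lambda>x. \<eta> * x) 0 t"
  note J = jump_integral_measurable[OF order_refl t truncation_predictable[of n] tr(1) \<eta>, where r = \<kappa>]
    jump_integral_nonneg[OF order_refl t truncation_predictable[of n] tr(1) \<eta>, where r = \<kappa>]
    jump_integral_moment[OF order_refl t truncation_predictable[of n] tr(1) \<eta> Z Z_nonneg
      truncation_product_measurable tr(2), where r = \<kappa>]
  note [measurable] = l_measurable[OF order_refl] J(1)
  have "moment (\<lambda>\<omega>. truncation n t \<omega> * (Z \<omega> * l t \<omega>)) \<le> moment (\<lambda>\<omega>. (\<theta> * Z \<omega> + Z \<omega> * l 0 \<omega>) + Z \<omega> * ?J \<omega>)"
  proof (rule moment_mono)
    fix \<omega> assume \<omega>: "\<omega> \<in> space M"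
    show "truncation n t \<omega> * (Z \<omega> * l t \<omega>) \<le> (\<theta> * Z \<omega> + Z \<omega> * l 0 \<omega>) + Z \<omega> * ?J \<omega>"
    proof (cases "left_count (\<lambda>t. N t \<omega>) t < n")
      case True
      have "l t \<omega> \<le> \<theta> + l 0 \<omega> + ?J \<omega>"
        using jump_integral_truncated[OF \<omega> t True, of \<kappa> "\<lambda>_ _. 1"] intensity_path[OF \<omega> order_refl t]
          relaxation_bounds(2)[OF order_refl t \<omega>] by simp
      from mult_left_mono[OF this Z_nonneg[of \<omega>]] show ?thesis
        using True by (simp add: truncation_def algebra_simps)
    qed (use Z_nonneg J(2)[OF \<omega>] l_nonneg[OF order_refl \<omega>] \<theta>_nonneg in \<open>simp add: truncation_def[of n t]\<close>)
  qed
  also have "\<dots> = (moment (\<lambda>\<omega>. \<theta> * Z \<omega>) + moment (\<lambda>\<omega>. Z \<omega> * l 0 \<omega>)) + moment (\<lambda>\<omega>. Z \<omega> * ?J \<omega>)"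
    using Z_nonneg J(2) l_nonneg[OF order_refl] \<theta>_nonneg by (simp add: moment_add del: ennreal_plus)
  also have "moment (\<lambda>\<omega>. \<theta> * Z \<omega>) = ennreal \<theta> * moment Z"
    using \<theta>_nonneg by (intro moment_cmult) auto
  also have "(ennreal \<theta> * moment Z + moment (\<lambda>\<omega>. Z \<omega> * l 0 \<omega>)) + moment (\<lambda>\<omega>. Z \<omega> * ?J \<omega>) =
      (ennreal \<theta> * ennreal p + ennreal x) + moment (\<lambda>\<omega>. Z \<omega> * ?J \<omega>)"
    unfolding p x ..
  also have "\<dots> = ennreal (\<theta> * p + x) + ennreal (\<eta> * \<mu>) *
      exp_convolution \<kappa> 0 t (\<lambda>u. moment (\<lambda>\<omega>. truncation n u \<omega> * (Z \<omega> * l u \<omega>)))"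
    using J(3) mark_linear[of \<eta>] \<eta>_pos p x \<theta>_nonneg by (simp add: ennreal_mult mult.left_commute)
  finally show "moment (\<lambda>\<omega>. truncation n t \<omega> * (Z \<omega> * l t \<omega>)) \<le> \<dots>" .
qed (rule assms)

text \<open>The argument for the mean applies to the second moment, with \<open>2\<kappa>\<close> and \<open>2\<eta>\<mu>\<close> in place of \<open>\<kappa>\<close> and \<open>\<eta>\<mu>\<close>;
  the terms that are linear in the intensity are controlled by the bound on the mean.\<close>

lemma second_moment_bounded:
  "\<exists>K\<ge>0. \<forall>t\<ge>0. moment (\<lambda>\<omega>. Z \<omega> * (l t \<omega>)\<^sup>2) \<le> ennreal K"
proof -
  define K where "K = (\<theta> * p + x) * \<kappa> / (\<kappa> - \<eta> * \<mu>)"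
  have K: "0 \<le> K"
    unfolding K_def using stable p x \<theta>_nonneg \<kappa>_pos by simp
  \<comment> \<open>The second moment of a jump of the intensity.\<close>
  define R where "R = \<eta>\<^sup>2 * (\<psi>\<^sup>2 + \<mu>\<^sup>2)"
  have R: "0 \<le> R"
    unfolding R_def by simp
  define b where "b = y + \<theta>\<^sup>2 * p + 2 * \<theta> * K + R * (K * (1 / (2 * \<kappa>)))"
  have b: "0 \<le> b"
    unfolding b_def using p y K R \<theta>_nonneg \<kappa>_pos by simp
  have "moment (\<lambda>\<omega>. Z \<omega> * (l t \<omega>)\<^sup>2) \<le> ennreal (b * (2 * \<kappa>) / (2 * \<kappa> - 2 * \<eta> * \<mu>))" if "0 \<le> t" for t
  proof (rule bounded_of_truncated_equation[where f = "\<lambda>t \<omega>. Z \<omega> * (l t \<omega>)\<^sup>2", OF _ _ b])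
    have [measurable]: "Z \<in> borel_measurable M"
      by (rule measurable_F_M[OF Z])
    note l_measurable[measurable]
    show "0 \<le> 2 * \<eta> * \<mu>" "2 * \<eta> * \<mu> < 2 * \<kappa>"
      using stable \<eta>_pos mean_nonneg by auto
    show "(\<lambda>\<omega>. Z \<omega> * (l t \<omega>)\<^sup>2) \<in> borel_measurable M" if "0 \<le> t" for t
      using that by measurable
    show "\<exists>K. \<forall>t\<ge>0. moment (\<lambda>\<omega>. truncation n t \<omega> * (Z \<omega> * (l t \<omega>)\<^sup>2)) \<le> ennreal K" for n
      using Z_nonneg by (intro truncated_moments_finite mult_left_mono) auto
    fix n and t :: real assume t: "0 \<le> t"
    note [measurable] = l_measurable[OF order_refl] l_measurable[OF t]
    note h = jump_coefficients
    have D: "(\<lambda>p. truncation n (fst p) (snd p) * left_intensity (fst p) (snd p)) \<in> borel_measurable predictable"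
      using truncation_predictable left_intensity_predictable by measurable
    have D_nonneg: "\<forall>u>0. \<forall>\<omega>\<in>space M. 0 \<le> truncation n u \<omega> * left_intensity u \<omega>"
      using truncation_nonneg left_intensity_nonneg by auto
    have "(\<lambda>p. (truncation n (fst p) (snd p) * indicator {0<..} (fst p)) * (l (fst p) (snd p) * indicator {0<..} (fst p)))
        \<in> borel_measurable (borel \<Otimes>\<^sub>M M)"
      using truncation_product_measurable intensity_after_zero_measurable by measurable
    also have "(\<lambda>p. (truncation n (fst p) (snd p) * indicator {0<..} (fst p)) * (l (fst p) (snd p) * indicator {0<..} (fst p))) =
        (\<lambda>p. truncation n (fst p) (snd p) * l (fst p) (snd p) * indicator {0<..} (fst p))"
      by (auto simp: fun_eq_iff split: split_indicator)
    finally have D': "(\<lambda>p. truncation n (fst p) (snd p) * l (fst p) (snd p) * indicator {0<..} (fst p))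
        \<in> borel_measurable (borel \<Otimes>\<^sub>M M)" .
    have eq: "\<forall>\<omega>\<in>space M. AE u in lborel. 0 < u \<longrightarrow>
        truncation n u \<omega> * left_intensity u \<omega> = truncation n u \<omega> * l u \<omega>"
    proof
      fix \<omega> assume "\<omega> \<in> space M"
      from left_intensity_AE_eq[OF this]
      show "AE u in lborel. 0 < u \<longrightarrow> truncation n u \<omega> * left_intensity u \<omega> = truncation n u \<omega> * l u \<omega>"
        by eventually_elim simp
    qed
    let ?J2 = "jump_integral (2 * \<kappa>) (\<lambda>u \<omega>. truncation n u \<omega> * left_intensity u \<omega>) (\<lambda>x. 2 * \<eta> * x) 0 t"
    let ?J3 = "jump_integral (2 * \<kappa>) (\<lambda>_ _. 1) (\<lambda>x. \<eta>\<^sup>2 * x\<^sup>2) 0 t"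
    note J2 = jump_integral_measurable[OF order_refl t D D_nonneg h(1,2), where r = "2 * \<kappa>"]
      jump_integral_nonneg[OF order_refl t D D_nonneg h(1,2), where r = "2 * \<kappa>"]
      jump_integral_moment[OF order_refl t D D_nonneg h(1,2) Z Z_nonneg D' eq, where r = "2 * \<kappa>"]
    note J3 = plain_jump_integral[OF order_refl t h(5,6), where r = "2 * \<kappa>"]
    note [measurable] = J2(1) J3(1)
    have "moment (\<lambda>\<omega>. truncation n t \<omega> * (Z \<omega> * (l t \<omega>)\<^sup>2)) \<le>
        moment (\<lambda>\<omega>. Z \<omega> * (l 0 \<omega>)\<^sup>2 + \<theta>\<^sup>2 * Z \<omega> + 2 * \<theta> * (Z \<omega> * l t \<omega>) + Z \<omega> * ?J2 \<omega> + Z \<omega> * ?J3 \<omega>)"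
    proof (rule moment_mono)
      fix \<omega> assume \<omega>: "\<omega> \<in> space M"
      show "truncation n t \<omega> * (Z \<omega> * (l t \<omega>)\<^sup>2) \<le>
          Z \<omega> * (l 0 \<omega>)\<^sup>2 + \<theta>\<^sup>2 * Z \<omega> + 2 * \<theta> * (Z \<omega> * l t \<omega>) + Z \<omega> * ?J2 \<omega> + Z \<omega> * ?J3 \<omega>"
      proof (cases "left_count (\<lambda>t. N t \<omega>) t < n")
        case True
        have "exp (- (2 * \<kappa>) * t) * (l 0 \<omega> - \<theta>)\<^sup>2 \<le> 1 * (l 0 \<omega> - \<theta>)\<^sup>2"
          using \<kappa>_pos t by (intro mult_right_mono) auto
        moreover have "(l 0 \<omega> - \<theta>)\<^sup>2 \<le> (l 0 \<omega>)\<^sup>2 + \<theta>\<^sup>2"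
          using l_nonneg[OF order_refl \<omega>] \<theta>_nonneg by (simp add: power2_diff)
        moreover have "(l t \<omega>)\<^sup>2 \<le> (l t \<omega> - \<theta>)\<^sup>2 + 2 * \<theta> * l t \<omega>"
          by (simp add: power2_diff mult.commute mult.left_commute)
        ultimately have "(l t \<omega>)\<^sup>2 \<le> (l 0 \<omega>)\<^sup>2 + \<theta>\<^sup>2 + 2 * \<theta> * l t \<omega> + ?J2 \<omega> + ?J3 \<omega>"
          using square_path[OF \<omega> t] plain_jump_integral(2)[OF order_refl t h(3,4) \<omega>, where r = "2 * \<kappa>"]
          unfolding jump_integral_truncated[OF \<omega> t True] by linarith
        from mult_left_mono[OF this Z_nonneg[of \<omega>]] show ?thesis
          using True by (simp add: truncation_def algebra_simps)
      qed (use Z_nonneg J2(2)[OF \<omega>] J3(2)[OF \<omega>] l_nonneg[OF t \<omega>] \<theta>_nonneg in \<open>simp add: truncation_def[of n t]\<close>)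
    qed
    also have "\<dots> = moment (\<lambda>\<omega>. Z \<omega> * (l 0 \<omega>)\<^sup>2) + moment (\<lambda>\<omega>. \<theta>\<^sup>2 * Z \<omega>) +
        moment (\<lambda>\<omega>. 2 * \<theta> * (Z \<omega> * l t \<omega>)) + moment (\<lambda>\<omega>. Z \<omega> * ?J2 \<omega>) + moment (\<lambda>\<omega>. Z \<omega> * ?J3 \<omega>)"
      using Z_nonneg J2(2) J3(2) l_nonneg[OF t] \<theta>_nonneg by (simp add: moment_add del: ennreal_plus)
    also have "moment (\<lambda>\<omega>. \<theta>\<^sup>2 * Z \<omega>) = ennreal (\<theta>\<^sup>2) * moment Z"
      by (rule moment_cmult) auto
    also have "moment (\<lambda>\<omega>. 2 * \<theta> * (Z \<omega> * l t \<omega>)) = ennreal (2 * \<theta>) * moment (\<lambda>\<omega>. Z \<omega> * l t \<omega>)"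
      using \<theta>_nonneg by (intro moment_cmult) auto
    finally have split: "moment (\<lambda>\<omega>. truncation n t \<omega> * (Z \<omega> * (l t \<omega>)\<^sup>2)) \<le>
        moment (\<lambda>\<omega>. Z \<omega> * (l 0 \<omega>)\<^sup>2) + ennreal (\<theta>\<^sup>2) * moment Z +
        ennreal (2 * \<theta>) * moment (\<lambda>\<omega>. Z \<omega> * l t \<omega>) + moment (\<lambda>\<omega>. Z \<omega> * ?J2 \<omega>) + moment (\<lambda>\<omega>. Z \<omega> * ?J3 \<omega>)" .
    note split
    also have "\<dots> \<le> ennreal y + ennreal (\<theta>\<^sup>2) * ennreal p + ennreal (2 * \<theta>) * ennreal K +
        ennreal (2 * \<eta> * \<mu>) * exp_convolution (2 * \<kappa>) 0 t (\<lambda>u. moment (\<lambda>\<omega>. truncation n u \<omega> * (Z \<omega> * (l u \<omega>)\<^sup>2))) +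
        ennreal R * ennreal (K * (1 / (2 * \<kappa>)))"
    proof (intro add_mono mult_left_mono)
      show "moment (\<lambda>\<omega>. Z \<omega> * l t \<omega>) \<le> ennreal K"
        unfolding K_def by (rule mean_bounded[OF t])
      show "moment (\<lambda>\<omega>. Z \<omega> * ?J2 \<omega>) \<le> ennreal (2 * \<eta> * \<mu>) *
          exp_convolution (2 * \<kappa>) 0 t (\<lambda>u. moment (\<lambda>\<omega>. truncation n u \<omega> * (Z \<omega> * (l u \<omega>)\<^sup>2)))"
        using J2(3) mark_linear[of "2 * \<eta>"] \<eta>_pos by (simp add: power2_eq_square ac_simps)
      have "exp_convolution (2 * \<kappa>) 0 t (\<lambda>u. moment (\<lambda>\<omega>. Z \<omega> * l u \<omega>)) \<le> ennreal (K * (1 / (2 * \<kappa>)))"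
        using \<kappa>_pos t K mean_bounded unfolding K_def by (intro exp_convolution_le) auto
      then show "moment (\<lambda>\<omega>. Z \<omega> * ?J3 \<omega>) \<le> ennreal R * ennreal (K * (1 / (2 * \<kappa>)))"
        unfolding J3(3)[OF Z Z_nonneg] R_def mark_quadratic[OF zero_le_power2] by (intro mult_left_mono) auto
    qed (use p y in auto)
    also have "\<dots> = ennreal b + ennreal (2 * \<eta> * \<mu>) *
        exp_convolution (2 * \<kappa>) 0 t (\<lambda>u. moment (\<lambda>\<omega>. truncation n u \<omega> * (Z \<omega> * (l u \<omega>)\<^sup>2)))"
    proof -
      have "ennreal b = ennreal y + ennreal (\<theta>\<^sup>2) * ennreal p + ennreal (2 * \<theta>) * ennreal K +
          ennreal R * ennreal (K * (1 / (2 * \<kappa>)))"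
        unfolding b_def using p y K R \<theta>_nonneg \<kappa>_pos
        by (simp add: ennreal_mult[symmetric] ennreal_plus[symmetric] del: ennreal_plus)
      then show ?thesis
        by (simp add: ac_simps)
    qed
    finally show "moment (\<lambda>\<omega>. truncation n t \<omega> * (Z \<omega> * (l t \<omega>)\<^sup>2)) \<le> \<dots>" .
  qed (rule that)
  moreover have "0 \<le> b * (2 * \<kappa>) / (2 * \<kappa> - 2 * \<eta> * \<mu>)"
    using b stable \<kappa>_pos by simp
  ultimately show ?thesis by blast
qed

end

section \<open>Solutions of the moment equations\<close>

definition decay :: real where "decay = \<kappa> - \<eta> * \<mu>"
definition equilibrium :: real where "equilibrium = \<kappa> * \<theta> / decay"
definition jump_power :: real where "jump_power = \<eta>\<^sup>2 * (\<psi>\<^sup>2 + \<mu>\<^sup>2)"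

text \<open>The following three functions turn out to be the conditional moments of the intensity given the
  initial information, as functions of the initial intensity \<open>x\<close>: the mean at time \<open>t\<close>, the variance at
  time \<open>t\<close>, and the mean of the product of the intensities at times \<open>s \<le> t\<close>.\<close>

definition cond_mean :: "real \<Rightarrow> real \<Rightarrow> real" where
  "cond_mean x t = (x - equilibrium) * exp (- decay * t) + equilibrium"

definition cond_var :: "real \<Rightarrow> real \<Rightarrow> real" where
  "cond_var x t = jump_power * ((x - equilibrium) * (exp (- decay * t) - (exp (- decay * t))\<^sup>2) / decay
     + equilibrium * (1 - (exp (- decay * t))\<^sup>2) / (2 * decay))"

definition cond_product :: "real \<Rightarrow> real \<Rightarrow> real \<Rightarrow> real" where
  "cond_product x s t = cond_var x s * exp (- decay * (t - s)) + cond_mean x s * cond_mean x t"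

lemma expectation_path_measurable:
  fixes f :: "real \<Rightarrow> real"
  assumes [measurable]: "Z \<in> borel_measurable M" "f \<in> borel_measurable borel"
  shows "(\<lambda>u. expectation (\<lambda>\<omega>. Z \<omega> * f (l (max 0 u) \<omega>))) \<in> borel_measurable borel"
proof (rule borel_measurable_lebesgue_integral)
  note [measurable] = intensity_measurable_pair
  have "(\<lambda>p. Z (snd p) * f (l (max 0 (fst p)) (snd p))) \<in> borel_measurable (borel \<Otimes>\<^sub>M M)"
    by measurable
  then show "(\<lambda>(u, \<omega>). Z \<omega> * f (l (max 0 u) \<omega>)) \<in> borel_measurable (borel \<Otimes>\<^sub>M M)"
    by (simp add: case_prod_beta')
qed

lemma integrable_of_bound:
  assumes "f \<in> borel_measurable M" "\<And>\<omega>. \<omega> \<in> space M \<Longrightarrow> 0 \<le> f \<omega>"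
    and "moment (\<lambda>\<omega>. f \<omega>) \<le> ennreal K"
  shows "integrable M f" "moment (\<lambda>\<omega>. f \<omega>) = ennreal (expectation f)"
    "0 \<le> expectation f" "0 \<le> K \<Longrightarrow> expectation f \<le> K"
proof -
  have ae: "AE \<omega> in M. 0 \<le> f \<omega>"
    using assms(2) by (rule AE_I2)
  show int: "integrable M f"
    using assms(3) by (intro integrableI_nonneg assms(1) ae) (auto intro: le_less_trans)
  then show eq: "moment (\<lambda>\<omega>. f \<omega>) = ennreal (expectation f)"
    using ae by (rule nn_integral_eq_integral)
  show "0 \<le> expectation f"
    using ae by (rule integral_nonneg_AE)
  show "expectation f \<le> K" if "0 \<le> K"
    using assms(3) that unfolding eq by (simp add: ennreal_le_iff)
qed

text \<open>The unknown is centred at \<open>\<theta>\<close>, which removes the inhomogeneous term outside the integral, and then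
  matched with the exponential that solves \<open>g' = - \<kappa> g + \<eta>\<mu> (g + \<theta> E Z)\<close>.  The start \<open>s\<close> and the weight \<open>Z\<close> are
  arbitrary so that \<open>Z\<close> may contain \<open>l s\<close>.\<close>

lemma mean_solution:
  assumes stable: "\<eta> * \<mu> < \<kappa>" and s: "0 \<le> s" and Z: "Z \<in> borel_measurable (F s)"
    and Z_nonneg: "\<And>\<omega>. 0 \<le> Z \<omega>" and Z_int: "integrable M Z"
    and K: "\<And>t. s \<le> t \<Longrightarrow> moment (\<lambda>\<omega>. Z \<omega> * l t \<omega>) \<le> ennreal K" "0 \<le> K"
    and t: "s \<le> t"
  shows "integrable M (\<lambda>\<omega>. Z \<omega> * l t \<omega>)"
    and "expectation (\<lambda>\<omega>. Z \<omega> * l t \<omega>) =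
      (expectation (\<lambda>\<omega>. Z \<omega> * l s \<omega>) - equilibrium * expectation Z) * exp (- decay * (t - s))
        + equilibrium * expectation Z"
proof -
  have decay: "0 < decay"
    using stable by (simp add: decay_def)
  have [measurable]: "Z \<in> borel_measurable M"
    by (rule measurable_F_M[OF Z])
  define p where "p = expectation Z"
  define f where "f u = expectation (\<lambda>\<omega>. Z \<omega> * l (max 0 u) \<omega>)" for u
  have f_meas [measurable]: "f \<in> borel_measurable borel"
    unfolding f_def[abs_def] by (rule expectation_path_measurable[where f = "\<lambda>x. x"]) auto
  have f_eq: "f u = expectation (\<lambda>\<omega>. Z \<omega> * l u \<omega>)" if "0 \<le> u" for u
    using that by (simp add: f_def max_absorb2)
  have int: "integrable M (\<lambda>\<omega>. Z \<omega> * l u \<omega>)"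
    and nn: "moment (\<lambda>\<omega>. Z \<omega> * l u \<omega>) = ennreal (f u)"
    and bound: "0 \<le> f u \<and> f u \<le> K" if u: "s \<le> u" for u
  proof -
    have u0: "0 \<le> u" using s u by simp
    have *: "(\<lambda>\<omega>. Z \<omega> * l u \<omega>) \<in> borel_measurable M" "\<And>\<omega>. \<omega> \<in> space M \<Longrightarrow> 0 \<le> Z \<omega> * l u \<omega>"
      using l_measurable[OF u0] Z_nonneg l_nonneg[OF u0] by auto
    show "integrable M (\<lambda>\<omega>. Z \<omega> * l u \<omega>)" "moment (\<lambda>\<omega>. Z \<omega> * l u \<omega>) = ennreal (f u)"
      "0 \<le> f u \<and> f u \<le> K"
      using integrable_of_bound[OF * K(1)[OF u]] K(2) unfolding f_eq[OF u0] by auto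
  qed
  have eq: "f t = \<theta> * p + exp (- \<kappa> * (t - s)) * (f s - \<theta> * p) +
      \<eta> * \<mu> * (LINT u:{s..t}|lborel. exp (- \<kappa> * (t - u)) * f u)" if t: "s \<le> t" for t
  proof -
    let ?I = "LINT u:{s..t}|lborel. exp (- \<kappa> * (t - u)) * f u"
    have kernel: "exp_convolution \<kappa> s t (\<lambda>u. ennreal (f u)) = ennreal ?I"
      using kernel_integral(2)[OF f_meas, of \<kappa> s t K] \<kappa>_pos bound by auto
    have I: "0 \<le> ?I"
      unfolding set_lebesgue_integral_def using bound by (intro integral_nonneg_AE AE_I2) (auto split: split_indicator)
    have base_eq: "Z \<omega> * (\<theta> + exp (- \<kappa> * (t - s)) * (l s \<omega> - \<theta>)) =
        \<theta> * Z \<omega> + exp (- \<kappa> * (t - s)) * (Z \<omega> * l s \<omega> - \<theta> * Z \<omega>)" for \<omega>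
      by (simp add: algebra_simps)
    have base_int: "integrable M (\<lambda>\<omega>. Z \<omega> * (\<theta> + exp (- \<kappa> * (t - s)) * (l s \<omega> - \<theta>)))"
      unfolding base_eq using Z_int int[of s] by simp
    have base: "expectation (\<lambda>\<omega>. Z \<omega> * (\<theta> + exp (- \<kappa> * (t - s)) * (l s \<omega> - \<theta>))) =
        \<theta> * p + exp (- \<kappa> * (t - s)) * (f s - \<theta> * p)"
      unfolding base_eq p_def f_eq[OF s] using Z_int int[of s] by simp
    have base_nonneg: "AE \<omega> in M. 0 \<le> Z \<omega> * (\<theta> + exp (- \<kappa> * (t - s)) * (l s \<omega> - \<theta>))"
      using Z_nonneg relaxation_bounds(1)[OF s t] by (intro AE_I2 mult_nonneg_nonneg) auto
    have kernel_nn: "exp_convolution \<kappa> s t (\<lambda>u. moment (\<lambda>\<omega>. Z \<omega> * l u \<omega>)) = ennreal ?I"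
      unfolding kernel[symmetric] by (intro nn_integral_cong) (auto simp: nn split: split_indicator)
    have "ennreal (f t) = ennreal (\<theta> * p + exp (- \<kappa> * (t - s)) * (f s - \<theta> * p)) + ennreal (\<eta> * \<mu>) * ennreal ?I"
      using mean_equation[OF s t Z Z_nonneg]
      unfolding nn[OF t] kernel_nn nn_integral_eq_integral[OF base_int base_nonneg] base .
    also have "\<dots> = ennreal (\<theta> * p + exp (- \<kappa> * (t - s)) * (f s - \<theta> * p) + \<eta> * \<mu> * ?I)"
      using integral_nonneg_AE[OF base_nonneg] base I \<eta>_pos mean_nonneg
      by (simp add: ennreal_mult)
    finally show ?thesis
      using bound[OF t] integral_nonneg_AE[OF base_nonneg] base I \<eta>_pos mean_nonneg
      by (subst (asm) ennreal_inj) auto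
  qed
  have f_kernel: "set_integrable lborel {s..t} (\<lambda>u. exp (- \<kappa> * (t - u)) * f u)" for t
    using kernel_integral(1)[OF f_meas, of \<kappa> s t K] \<kappa>_pos bound by auto
  have const_int: "set_integrable lborel {s..t} (\<lambda>u. exp (- \<kappa> * (t - u)) * (\<theta> * p))" for t
    by (intro borel_integrable_atLeastAtMost' continuous_intros)
  show "integrable M (\<lambda>\<omega>. Z \<omega> * l t \<omega>)"
    by (rule int[OF t])
  define g where "g t = (f s - equilibrium * p) * exp (- decay * (t - s)) + equilibrium * p - \<theta> * p" for t
  have "f t - \<theta> * p = g t"
  proof (rule linear_volterra_solution[where f = "\<lambda>u. f u - \<theta> * p" and h = "\<lambda>_. \<eta> * \<mu> * (\<theta> * p)" and k = \<kappa>
        and a = "\<eta> * \<mu>" and K = "K + \<bar>\<theta> * p\<bar>" and L = "\<bar>f s - equilibrium * p\<bar> + \<bar>equilibrium * p\<bar> + \<bar>\<theta> * p\<bar>"])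
    show "0 \<le> \<eta> * \<mu>"
      using \<eta>_pos mean_nonneg by simp
    show "\<bar>f t - \<theta> * p\<bar> \<le> K + \<bar>\<theta> * p\<bar>" if "s \<le> t" for t
      using bound[OF that] by linarith
    show "set_integrable lborel {s..t} (\<lambda>u. exp (- \<kappa> * (t - u)) * (f u - \<theta> * p))" for t
      using set_integral_diff(1)[OF f_kernel[of t] const_int] by (simp add: right_diff_distrib)
    show "f t - \<theta> * p = exp (- \<kappa> * (t - s)) * (f s - \<theta> * p) +
        (LINT u:{s..t}|lborel. exp (- \<kappa> * (t - u)) * (\<eta> * \<mu> * (f u - \<theta> * p) + \<eta> * \<mu> * (\<theta> * p)))" if "s \<le> t" for t
    proof -
      have "(\<lambda>u. exp (- \<kappa> * (t - u)) * (\<eta> * \<mu> * (f u - \<theta> * p) + \<eta> * \<mu> * (\<theta> * p))) =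
          (\<lambda>u. (\<eta> * \<mu>) * (exp (- \<kappa> * (t - u)) * f u))"
        by (simp add: fun_eq_iff algebra_simps)
      then show ?thesis
        using eq[OF that] by (simp only: set_integral_mult_right)
    qed
    show "\<bar>g t\<bar> \<le> \<bar>f s - equilibrium * p\<bar> + \<bar>equilibrium * p\<bar> + \<bar>\<theta> * p\<bar>" if "s \<le> t" for t
    proof -
      have "\<bar>(f s - equilibrium * p) * exp (- decay * (t - s))\<bar> \<le> \<bar>f s - equilibrium * p\<bar> * 1"
        unfolding abs_mult using that decay by (intro mult_left_mono) auto
      then show ?thesis
        unfolding g_def
        using abs_triangle_ineq4[of "(f s - equilibrium * p) * exp (- decay * (t - s)) + equilibrium * p" "\<theta> * p"]
          abs_triangle_ineq[of "(f s - equilibrium * p) * exp (- decay * (t - s))" "equilibrium * p"]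
        by linarith
    qed
    show "(g has_real_derivative - \<kappa> * g t + (\<eta> * \<mu> * g t + \<eta> * \<mu> * (\<theta> * p))) (at t)" for t
    proof -
      have "(g has_real_derivative (f s - equilibrium * p) * (exp (- decay * (t - s)) * (- decay))) (at t)"
        unfolding g_def by (auto intro!: derivative_eq_intros)
      moreover have "decay * equilibrium = \<kappa> * \<theta>"
        using decay by (simp add: equilibrium_def)
      then have "- \<kappa> * g t + (\<eta> * \<mu> * g t + \<eta> * \<mu> * (\<theta> * p)) =
          (f s - equilibrium * p) * (exp (- decay * (t - s)) * (- decay))"
      proof -
        assume de: "decay * equilibrium = \<kappa> * \<theta>"
        have "- \<kappa> * g t + (\<eta> * \<mu> * g t + \<eta> * \<mu> * (\<theta> * p)) = - decay * g t + (\<kappa> - decay) * (\<theta> * p)"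
          unfolding decay_def by (simp add: algebra_simps)
        also have "\<dots> = (f s - equilibrium * p) * (exp (- decay * (t - s)) * (- decay)) - (decay * equilibrium) * p + \<kappa> * \<theta> * p"
          unfolding g_def by (simp add: algebra_simps)
        finally show ?thesis
          unfolding de by simp
      qed
      ultimately show ?thesis by simp
    qed
  qed (use stable t in \<open>auto simp: g_def\<close>)
  then show "expectation (\<lambda>\<omega>. Z \<omega> * l t \<omega>) =
      (expectation (\<lambda>\<omega>. Z \<omega> * l s \<omega>) - equilibrium * expectation Z) * exp (- decay * (t - s))
        + equilibrium * expectation Z"
    using t s unfolding g_def p_def f_eq[OF s] by (simp add: f_eq)
qed

text \<open>The centred second moment \<open>z\<close> solves \<open>z' = - 2\<kappa> z + 2\<eta>\<mu> z + h\<close>, where \<open>h\<close> is affine in the known mean.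
  The solution is a quadratic polynomial in \<open>exp (- decay * t)\<close>.\<close>

lemma second_moment_solution:
  assumes stable: "\<eta> * \<mu> < \<kappa>" and Z: "Z \<in> borel_measurable (F 0)"
    and Z_nonneg: "\<And>\<omega>. 0 \<le> Z \<omega>" and Z_int: "integrable M Z"
    and K: "\<And>t. 0 \<le> t \<Longrightarrow> moment (\<lambda>\<omega>. Z \<omega> * l t \<omega>) \<le> ennreal K" "0 \<le> K"
    and K2: "\<And>t. 0 \<le> t \<Longrightarrow> moment (\<lambda>\<omega>. Z \<omega> * (l t \<omega>)\<^sup>2) \<le> ennreal K2" "0 \<le> K2"
    and t: "0 \<le> t"
  defines "p \<equiv> expectation Z" and "x \<equiv> expectation (\<lambda>\<omega>. Z \<omega> * l 0 \<omega>)"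
    and "y \<equiv> expectation (\<lambda>\<omega>. Z \<omega> * (l 0 \<omega>)\<^sup>2)" and "c \<equiv> equilibrium" and "e \<equiv> exp (- decay * t)"
  shows "integrable M (\<lambda>\<omega>. Z \<omega> * (l t \<omega>)\<^sup>2)"
    and "expectation (\<lambda>\<omega>. Z \<omega> * (l t \<omega>)\<^sup>2) =
      jump_power * ((x - c * p) * (e - e\<^sup>2) / decay + c * p * (1 - e\<^sup>2) / (2 * decay))
      + (y - 2 * c * x + c\<^sup>2 * p) * e\<^sup>2 + 2 * c * (x - c * p) * e + c\<^sup>2 * p"
proof -
  have decay: "0 < decay"
    using stable by (simp add: decay_def)
  have [measurable]: "Z \<in> borel_measurable M"
    by (rule measurable_F_M[OF Z])
  define f where "f u = expectation (\<lambda>\<omega>. Z \<omega> * l (max 0 u) \<omega>)" for u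
  define f2 where "f2 u = expectation (\<lambda>\<omega>. Z \<omega> * (l (max 0 u) \<omega>)\<^sup>2)" for u
  have f_meas [measurable]: "f \<in> borel_measurable borel"
    unfolding f_def[abs_def] by (rule expectation_path_measurable[where f = "\<lambda>x. x"]) auto
  have f2_meas [measurable]: "f2 \<in> borel_measurable borel"
    unfolding f2_def[abs_def] by (rule expectation_path_measurable[where f = "\<lambda>x. x\<^sup>2"]) auto
  have f_eq: "f u = expectation (\<lambda>\<omega>. Z \<omega> * l u \<omega>)"
    and f2_eq: "f2 u = expectation (\<lambda>\<omega>. Z \<omega> * (l u \<omega>)\<^sup>2)" if "0 \<le> u" for u
    using that by (simp_all add: f_def f2_def max_absorb2)
  have int: "integrable M (\<lambda>\<omega>. Z \<omega> * l u \<omega>)" "integrable M (\<lambda>\<omega>. Z \<omega> * (l u \<omega>)\<^sup>2)"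
    and nn: "moment (\<lambda>\<omega>. Z \<omega> * l u \<omega>) = ennreal (f u)"
    and nn2: "moment (\<lambda>\<omega>. Z \<omega> * (l u \<omega>)\<^sup>2) = ennreal (f2 u)"
    and bound: "0 \<le> f u \<and> f u \<le> K" and bound2: "0 \<le> f2 u \<and> f2 u \<le> K2" if u: "0 \<le> u" for u
  proof -
    note [measurable] = l_measurable[OF u]
    have *: "(\<lambda>\<omega>. Z \<omega> * l u \<omega>) \<in> borel_measurable M" "\<And>\<omega>. \<omega> \<in> space M \<Longrightarrow> 0 \<le> Z \<omega> * l u \<omega>"
      using Z_nonneg l_nonneg[OF u] by auto
    have **: "(\<lambda>\<omega>. Z \<omega> * (l u \<omega>)\<^sup>2) \<in> borel_measurable M" "\<And>\<omega>. \<omega> \<in> space M \<Longrightarrow> 0 \<le> Z \<omega> * (l u \<omega>)\<^sup>2"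
      using Z_nonneg by auto
    show "integrable M (\<lambda>\<omega>. Z \<omega> * l u \<omega>)" "moment (\<lambda>\<omega>. Z \<omega> * l u \<omega>) = ennreal (f u)"
      "0 \<le> f u \<and> f u \<le> K"
      using integrable_of_bound[OF * K(1)[OF u]] K(2) unfolding f_eq[OF u] by auto
    show "integrable M (\<lambda>\<omega>. Z \<omega> * (l u \<omega>)\<^sup>2)" "moment (\<lambda>\<omega>. Z \<omega> * (l u \<omega>)\<^sup>2) = ennreal (f2 u)"
      "0 \<le> f2 u \<and> f2 u \<le> K2"
      using integrable_of_bound[OF ** K2(1)[OF u]] K2(2) unfolding f2_eq[OF u] by auto
  qed
  have f0: "f 0 = x" "f2 0 = y"
    by (simp_all add: f_eq f2_eq x_def y_def)
  have f_sol: "f u = (x - c * p) * exp (- decay * u) + c * p" if "0 \<le> u" for u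
    using mean_solution(2)[OF stable order_refl Z Z_nonneg Z_int K that]
    unfolding f_eq[OF that] x_def p_def c_def by simp
  define z where "z u = f2 u - 2 * \<theta> * f u + \<theta>\<^sup>2 * p" for u
  have z_eq: "z u = expectation (\<lambda>\<omega>. Z \<omega> * (l u \<omega> - \<theta>)\<^sup>2)"
    and z_int: "integrable M (\<lambda>\<omega>. Z \<omega> * (l u \<omega> - \<theta>)\<^sup>2)" if u: "0 \<le> u" for u
  proof -
    have *: "Z \<omega> * (l u \<omega> - \<theta>)\<^sup>2 = Z \<omega> * (l u \<omega>)\<^sup>2 - 2 * \<theta> * (Z \<omega> * l u \<omega>) + \<theta>\<^sup>2 * Z \<omega>" for \<omega>
      by (simp add: power2_diff algebra_simps)
    show "z u = expectation (\<lambda>\<omega>. Z \<omega> * (l u \<omega> - \<theta>)\<^sup>2)"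
      unfolding * z_def f_eq[OF u] f2_eq[OF u] p_def using int[OF u] Z_int by simp
    show "integrable M (\<lambda>\<omega>. Z \<omega> * (l u \<omega> - \<theta>)\<^sup>2)"
      unfolding * using int[OF u] Z_int by simp
  qed
  have k2: "0 \<le> 2 * \<kappa>"
    using \<kappa>_pos by simp
  have f_kernel: "set_integrable lborel {0..t} (\<lambda>u. exp (- (2 * \<kappa>) * (t - u)) * f u)"
    and f_kernel_nn: "exp_convolution (2 * \<kappa>) 0 t (\<lambda>u. ennreal (f u)) =
      ennreal (LINT u:{0..t}|lborel. exp (- (2 * \<kappa>) * (t - u)) * f u)" for t
    using bound by (intro kernel_integral[OF f_meas k2, of 0 t K]; simp)+
  have f2_kernel: "set_integrable lborel {0..t} (\<lambda>u. exp (- (2 * \<kappa>) * (t - u)) * f2 u)"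
    and f2_kernel_nn: "exp_convolution (2 * \<kappa>) 0 t (\<lambda>u. ennreal (f2 u)) =
      ennreal (LINT u:{0..t}|lborel. exp (- (2 * \<kappa>) * (t - u)) * f2 u)" for t
    using bound2 by (intro kernel_integral[OF f2_meas k2, of 0 t K2]; simp)+
  have const_kernel: "set_integrable lborel {0..t} (\<lambda>u. exp (- (2 * \<kappa>) * (t - u)) * r)" for t r
    by (intro borel_integrable_atLeastAtMost' continuous_intros)
  define I where "I t = (LINT u:{0..t}|lborel. exp (- (2 * \<kappa>) * (t - u)) * f u)" for t
  define I2 where "I2 t = (LINT u:{0..t}|lborel. exp (- (2 * \<kappa>) * (t - u)) * f2 u)" for t
  have eq: "z t + 2 * \<theta> * \<eta> * \<mu> * I t = exp (- (2 * \<kappa>) * t) * z 0 + 2 * \<eta> * \<mu> * I2 t + jump_power * I t"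
    if t: "0 \<le> t" for t
  proof -
    have nonneg: "0 \<le> I t" "0 \<le> I2 t" "0 \<le> z t" "0 \<le> z 0"
      unfolding I_def I2_def set_lebesgue_integral_def z_eq[OF t] z_eq[OF order_refl] using bound bound2 Z_nonneg
      by (auto intro!: integral_nonneg_AE AE_I2 split: split_indicator)
    have "moment (\<lambda>\<omega>. Z \<omega> * (l t \<omega> - \<theta>)\<^sup>2) = ennreal (z t)"
      unfolding z_eq[OF t] using Z_nonneg by (intro nn_integral_eq_integral z_int[OF t]) auto
    moreover have "moment (\<lambda>\<omega>. Z \<omega> * (exp (- (2 * \<kappa>) * t) * (l 0 \<omega> - \<theta>)\<^sup>2)) = ennreal (exp (- (2 * \<kappa>) * t) * z 0)"
    proof -
      have "moment (\<lambda>\<omega>. exp (- (2 * \<kappa>) * t) * (Z \<omega> * (l 0 \<omega> - \<theta>)\<^sup>2)) =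
          ennreal (expectation (\<lambda>\<omega>. exp (- (2 * \<kappa>) * t) * (Z \<omega> * (l 0 \<omega> - \<theta>)\<^sup>2)))"
        using Z_nonneg z_int[OF order_refl] by (intro nn_integral_eq_integral) auto
      moreover have "Z \<omega> * (exp (- (2 * \<kappa>) * t) * (l 0 \<omega> - \<theta>)\<^sup>2) = exp (- (2 * \<kappa>) * t) * (Z \<omega> * (l 0 \<omega> - \<theta>)\<^sup>2)" for \<omega>
        by (rule mult.left_commute)
      ultimately show ?thesis
        unfolding z_eq[OF order_refl] by (simp only: integral_mult_right_zero)
    qed
    moreover have "exp_convolution (2 * \<kappa>) 0 t (\<lambda>u. moment (\<lambda>\<omega>. Z \<omega> * l u \<omega>)) = ennreal (I t)"
      unfolding I_def f_kernel_nn[symmetric] by (intro nn_integral_cong) (auto simp: nn split: split_indicator)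
    moreover have "exp_convolution (2 * \<kappa>) 0 t (\<lambda>u. moment (\<lambda>\<omega>. Z \<omega> * (l u \<omega>)\<^sup>2)) = ennreal (I2 t)"
      unfolding I2_def f2_kernel_nn[symmetric] by (intro nn_integral_cong) (auto simp: nn2 split: split_indicator)
    ultimately have "ennreal (z t) + ennreal (2 * \<theta> * \<eta> * \<mu>) * ennreal (I t) =
        ennreal (exp (- (2 * \<kappa>) * t) * z 0) + ennreal (2 * \<eta> * \<mu>) * ennreal (I2 t) + ennreal jump_power * ennreal (I t)"
      using second_moment_equation[OF t Z Z_nonneg] unfolding jump_power_def by simp
    moreover have pos: "0 \<le> 2 * \<theta> * \<eta> * \<mu>" "0 \<le> 2 * \<eta> * \<mu>" "0 \<le> jump_power"
      using \<theta>_nonneg \<eta>_pos mean_nonneg by (auto simp: jump_power_def)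
    ultimately have "ennreal (z t + 2 * \<theta> * \<eta> * \<mu> * I t) =
        ennreal (exp (- (2 * \<kappa>) * t) * z 0 + 2 * \<eta> * \<mu> * I2 t + jump_power * I t)"
      using nonneg by (simp add: ennreal_mult')
    then show ?thesis
      using nonneg pos by (subst (asm) ennreal_inj) auto
  qed
  show "integrable M (\<lambda>\<omega>. Z \<omega> * (l t \<omega>)\<^sup>2)"
    by (rule int(2)[OF t])
  define a where "a = 2 * \<eta> * \<mu>"
  define h where "h u = a * \<theta> * ((x - c * p) * exp (- decay * u) + c * p - \<theta> * p) +
    jump_power * ((x - c * p) * exp (- decay * u) + c * p)" for u
  \<comment> \<open>The coefficients of the powers of \<open>exp (- decay * u)\<close> in the candidate solution for \<open>z\<close>.\<close>
  define A where "A = (y - 2 * c * x + c\<^sup>2 * p) - jump_power * (x - c * p) / decay - jump_power * c * p / (2 * decay)"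
  define B where "B = jump_power * (x - c * p) / decay + 2 * (c - \<theta>) * (x - c * p)"
  define C where "C = jump_power * c * p / (2 * decay) + c\<^sup>2 * p - 2 * \<theta> * c * p + \<theta>\<^sup>2 * p"
  define g where "g u = A * (exp (- decay * u))\<^sup>2 + B * exp (- decay * u) + C" for u
  have "z t = g t"
  proof (rule linear_volterra_solution[where f = z and h = h and k = "2 * \<kappa>"
        and a = a and K = "K2 + 2 * \<theta> * K + \<bar>\<theta>\<^sup>2 * p\<bar>" and L = "\<bar>A\<bar> + \<bar>B\<bar> + \<bar>C\<bar>"])
    show "0 \<le> a" "a < 2 * \<kappa>"
      using \<eta>_pos mean_nonneg stable by (auto simp: a_def)
    show "\<bar>z t\<bar> \<le> K2 + 2 * \<theta> * K + \<bar>\<theta>\<^sup>2 * p\<bar>" if "0 \<le> t" for t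
    proof -
      have "0 \<le> \<theta> * f t" "\<theta> * f t \<le> \<theta> * K"
        using bound[OF that] \<theta>_nonneg by (auto intro: mult_left_mono)
      moreover have "\<theta>\<^sup>2 * p \<le> \<bar>\<theta>\<^sup>2 * p\<bar>" "- (\<theta>\<^sup>2 * p) \<le> \<bar>\<theta>\<^sup>2 * p\<bar>"
        by simp_all
      ultimately show ?thesis
        using bound2[OF that] unfolding z_def mult.assoc by (intro abs_leI) linarith+
    qed
    show "set_integrable lborel {0..t} (\<lambda>u. exp (- (2 * \<kappa>) * (t - u)) * z u)" for t
    proof -
      have "(\<lambda>u. exp (- (2 * \<kappa>) * (t - u)) * z u) = (\<lambda>u. exp (- (2 * \<kappa>) * (t - u)) * f2 u -
          2 * \<theta> * (exp (- (2 * \<kappa>) * (t - u)) * f u) + exp (- (2 * \<kappa>) * (t - u)) * (\<theta>\<^sup>2 * p))"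
        unfolding z_def by (simp add: fun_eq_iff algebra_simps)
      then show ?thesis
        using f2_kernel[of t] f_kernel[of t] const_kernel[of t]
        by (simp only:) (intro set_integral_add(1) set_integral_diff(1) set_integrable_mult_right)
    qed
    show "z t = exp (- (2 * \<kappa>) * (t - 0)) * z 0 +
        (LINT u:{0..t}|lborel. exp (- (2 * \<kappa>) * (t - u)) * (a * z u + h u))" if t: "0 \<le> t" for t
    proof -
      have h_f: "h u = a * \<theta> * (f u - \<theta> * p) + jump_power * f u" if "0 \<le> u" for u
        unfolding h_def f_sol[OF that] ..
      have "(LINT u:{0..t}|lborel. exp (- (2 * \<kappa>) * (t - u)) * (a * z u + h u)) =
          (LINT u:{0..t}|lborel. a * (exp (- (2 * \<kappa>) * (t - u)) * f2 u) +
            (jump_power - a * \<theta>) * (exp (- (2 * \<kappa>) * (t - u)) * f u))"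
      proof (rule set_lebesgue_integral_cong)
        show "\<forall>u. u \<in> {0..t} \<longrightarrow> exp (- (2 * \<kappa>) * (t - u)) * (a * z u + h u) =
          a * (exp (- (2 * \<kappa>) * (t - u)) * f2 u) + (jump_power - a * \<theta>) * (exp (- (2 * \<kappa>) * (t - u)) * f u)"
          unfolding z_def by (auto simp: h_f power2_eq_square algebra_simps)
      qed simp
      also have "\<dots> = a * I2 t + (jump_power - a * \<theta>) * I t"
        unfolding I_def I2_def using f2_kernel[of t] f_kernel[of t]
        by (subst set_integral_add(2)) (simp_all only: set_integrable_mult_right set_integral_mult_right)
      finally show ?thesis
        using eq[OF t] unfolding a_def by (simp add: algebra_simps)
    qed
    show "\<bar>g t\<bar> \<le> \<bar>A\<bar> + \<bar>B\<bar> + \<bar>C\<bar>" if "0 \<le> t" for t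
    proof -
      have e: "exp (- decay * t) \<le> 1"
        using that decay by simp
      then have "(exp (- decay * t))\<^sup>2 \<le> 1"
        by (intro power_le_one) auto
      then have "\<bar>A * (exp (- decay * t))\<^sup>2\<bar> \<le> \<bar>A\<bar> * 1" "\<bar>B * exp (- decay * t)\<bar> \<le> \<bar>B\<bar> * 1"
        unfolding abs_mult using e by (intro mult_left_mono; simp)+
      then show ?thesis
        unfolding g_def by linarith
    qed
    show "continuous_on UNIV h"
      unfolding h_def by (intro continuous_intros)
    show "g 0 = z 0"
      unfolding g_def A_def B_def C_def z_def f0 using decay by (simp add: power2_eq_square field_simps)
    show "(g has_real_derivative - (2 * \<kappa>) * g u + (a * g u + h u)) (at u)" for u
    proof -
      define E where "E = exp (- decay * u)"
      have "(g has_real_derivative - 2 * decay * A * E\<^sup>2 - decay * B * E) (at u)"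
        unfolding g_def E_def by (auto intro!: derivative_eq_intros simp: power2_eq_square)
      moreover have "- 2 * decay * A * E\<^sup>2 - decay * B * E = - (2 * \<kappa>) * g u + (a * g u + h u)"
      proof -
        have de: "\<kappa> * \<theta> = decay * c"
          using decay by (simp add: equilibrium_def c_def)
        have a: "a = 2 * \<kappa> - 2 * decay"
          unfolding a_def decay_def by simp
        have B: "decay * B = jump_power * (x - c * p) + a * \<theta> * (x - c * p)"
        proof -
          have "decay * B = jump_power * (x - c * p) + 2 * (decay * c - decay * \<theta>) * (x - c * p)"
            unfolding B_def using decay by (simp add: field_simps)
          then show ?thesis
            unfolding a de[symmetric] by (simp add: algebra_simps)
        qed
        have C: "2 * decay * C = jump_power * (c * p) + a * \<theta> * (c * p - \<theta> * p)"
        proof -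
          have "2 * decay * C = jump_power * (c * p) + 2 * (decay * c) * c * p - 4 * \<theta> * (decay * c) * p + 2 * decay * \<theta>\<^sup>2 * p"
            unfolding C_def using decay by (simp add: field_simps power2_eq_square)
          also have "\<dots> = jump_power * (c * p) + 2 * (\<kappa> * \<theta>) * c * p - 2 * \<theta> * (decay * c) * p - 2 * \<theta> * (\<kappa> * \<theta>) * p + 2 * decay * \<theta>\<^sup>2 * p"
            unfolding de[symmetric] by (simp add: algebra_simps)
          also have "\<dots> = jump_power * (c * p) + a * \<theta> * (c * p - \<theta> * p)"
            unfolding a by (simp add: algebra_simps power2_eq_square)
          finally show ?thesis .
        qed
        have "- (2 * \<kappa>) * g u + (a * g u + h u) = - 2 * decay * g u + h u"
          unfolding a by (simp add: algebra_simps)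
        also have "\<dots> = - 2 * decay * A * E\<^sup>2 - 2 * (decay * B) * E - 2 * decay * C + h u"
          unfolding g_def E_def by (simp add: algebra_simps)
        finally have generator: "- (2 * \<kappa>) * g u + (a * g u + h u) =
            - 2 * decay * A * E\<^sup>2 - 2 * (decay * B) * E - 2 * decay * C + h u" .
        have source: "h u = decay * B * E + 2 * decay * C"
          unfolding B C h_def E_def[symmetric] by (simp add: algebra_simps)
        show ?thesis
          unfolding generator unfolding source by (simp add: algebra_simps)
      qed
      ultimately show ?thesis by simp
    qed
  qed (use t in auto)
  then have "f2 t = g t + 2 * \<theta> * ((x - c * p) * e + c * p) - \<theta>\<^sup>2 * p"
    unfolding z_def f_sol[OF t] e_def by simp
  also have "\<dots> = jump_power * ((x - c * p) * (e - e\<^sup>2) / decay + c * p * (1 - e\<^sup>2) / (2 * decay))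
      + (y - 2 * c * x + c\<^sup>2 * p) * e\<^sup>2 + 2 * c * (x - c * p) * e + c\<^sup>2 * p"
    unfolding g_def e_def[symmetric] A_def B_def C_def using decay by (simp add: field_simps)
  finally show "expectation (\<lambda>\<omega>. Z \<omega> * (l t \<omega>)\<^sup>2) = \<dots>"
    unfolding f2_eq[OF t] .
qed

section \<open>Moments given the initial information\<close>

lemma cond_mean_nonneg:
  assumes "\<eta> * \<mu> < \<kappa>" "0 \<le> x" "0 \<le> t"
  shows "0 \<le> cond_mean x t"
proof -
  have d: "0 < decay" and c: "0 \<le> equilibrium"
    using assms \<theta>_nonneg \<kappa>_pos by (auto simp: decay_def equilibrium_def)
  have "exp (- decay * t) \<le> 1"
    using d assms by simp
  moreover have "cond_mean x t = x * exp (- decay * t) + equilibrium * (1 - exp (- decay * t))"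
    unfolding cond_mean_def by (simp add: algebra_simps)
  ultimately show ?thesis
    using c assms by simp
qed

lemma cond_var_nonneg:
  assumes "\<eta> * \<mu> < \<kappa>" "0 \<le> x" "0 \<le> t"
  shows "0 \<le> cond_var x t"
proof -
  have d: "0 < decay" and c: "0 \<le> equilibrium" and j: "0 \<le> jump_power"
    using assms \<theta>_nonneg \<kappa>_pos by (auto simp: decay_def equilibrium_def jump_power_def)
  define e where "e = exp (- decay * t)"
  have e: "0 \<le> e" "e \<le> 1"
    unfolding e_def using d assms by auto
  have "cond_var x t = jump_power * (x * (e * (1 - e)) / decay + equilibrium * (1 - e)\<^sup>2 / (2 * decay))"
    unfolding cond_var_def e_def[symmetric] using d by (simp add: field_simps power2_eq_square)
  then show ?thesis
    using d c j e assms by simp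
qed

lemma cond_product_nonneg:
  assumes "\<eta> * \<mu> < \<kappa>" "0 \<le> x" "0 \<le> s" "s \<le> t"
  shows "0 \<le> cond_product x s t"
  unfolding cond_product_def using cond_mean_nonneg[OF assms(1,2)] cond_var_nonneg[OF assms(1-3)] assms
  by (intro add_nonneg_nonneg mult_nonneg_nonneg) auto

text \<open>On an initial event \<open>B\<close> with bounded initial intensity all moments are finite.  For the product moment
  the equation of the mean is restarted at time \<open>s\<close> with weight \<open>1\<^sub>B * l s\<close>, whose initial data are the
  first and second moments at time \<open>s\<close>.\<close>

lemma moments_on_bounded_event:
  assumes stable: "\<eta> * \<mu> < \<kappa>" and B: "B \<in> sets (F 0)" and L: "\<And>\<omega>. \<omega> \<in> B \<Longrightarrow> l 0 \<omega> \<le> L"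
    and s: "0 \<le> s" and t: "s \<le> t"
  shows "(\<integral>\<^sup>+\<omega>\<in>B. ennreal (l t \<omega>) \<partial>M) = (\<integral>\<^sup>+\<omega>\<in>B. ennreal (cond_mean (l 0 \<omega>) t) \<partial>M)"
    and "(\<integral>\<^sup>+\<omega>\<in>B. ennreal (l s \<omega> * l t \<omega>) \<partial>M) = (\<integral>\<^sup>+\<omega>\<in>B. ennreal (cond_product (l 0 \<omega>) s t) \<partial>M)"
proof -
  have t0: "0 \<le> t" using s t by simp
  have decay: "0 < decay"
    using stable by (simp add: decay_def)
  have B_M [measurable]: "B \<in> events"
    using B filtration_subset by auto
  note [measurable] = l_measurable[OF order_refl] l_measurable[OF s] l_measurable[OF t0]
  define Z where "Z = (indicator B :: 'a \<Rightarrow> real)"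
  have Z: "Z \<in> borel_measurable (F 0)" and Z_nonneg: "\<And>\<omega>. 0 \<le> Z \<omega>" and Z_int: "integrable M Z"
    unfolding Z_def using B by (auto intro!: integrable_real_indicator simp: emeasure_eq_measure)
  have Z_l0: "Z \<omega> * l 0 \<omega> \<le> \<bar>L\<bar>" and Z_l0_sq: "Z \<omega> * (l 0 \<omega>)\<^sup>2 \<le> L\<^sup>2" if "\<omega> \<in> space M" for \<omega>
    using L[of \<omega>] power_mono[OF L[of \<omega>] l_nonneg[OF order_refl that], of 2] by (auto simp: Z_def split: split_indicator)
  have [measurable]: "Z \<in> borel_measurable M"
    by (rule measurable_F_M[OF Z])
  have int0: "integrable M (\<lambda>\<omega>. Z \<omega> * l 0 \<omega>)" "integrable M (\<lambda>\<omega>. Z \<omega> * (l 0 \<omega>)\<^sup>2)"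
  proof -
    show "integrable M (\<lambda>\<omega>. Z \<omega> * l 0 \<omega>)"
      using Z_l0 l_nonneg[OF order_refl] Z_nonneg
      by (intro integrable_const_bound[where B = "\<bar>L\<bar>"] AE_I2) auto
    show "integrable M (\<lambda>\<omega>. Z \<omega> * (l 0 \<omega>)\<^sup>2)"
      using Z_l0_sq Z_nonneg by (intro integrable_const_bound[where B = "L\<^sup>2"] AE_I2) auto
  qed
  define p where "p = expectation Z"
  define x where "x = expectation (\<lambda>\<omega>. Z \<omega> * l 0 \<omega>)"
  define y where "y = expectation (\<lambda>\<omega>. Z \<omega> * (l 0 \<omega>)\<^sup>2)"
  have nn0: "moment Z = ennreal p" "moment (\<lambda>\<omega>. Z \<omega> * l 0 \<omega>) = ennreal x"
    "moment (\<lambda>\<omega>. Z \<omega> * (l 0 \<omega>)\<^sup>2) = ennreal y"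
    unfolding p_def x_def y_def using Z_int int0 Z_nonneg l_nonneg[OF order_refl]
    by (auto intro!: nn_integral_eq_integral AE_I2)
  have pxy: "0 \<le> p" "0 \<le> x" "0 \<le> y"
    unfolding p_def x_def y_def using Z_nonneg l_nonneg[OF order_refl] by (auto intro!: integral_nonneg_AE AE_I2)
  define K where "K = (\<theta> * p + x) * \<kappa> / (\<kappa> - \<eta> * \<mu>)"
  have K: "moment (\<lambda>\<omega>. Z \<omega> * l t \<omega>) \<le> ennreal K" if "0 \<le> t" for t
    unfolding K_def by (rule mean_bounded[OF stable Z Z_nonneg nn0(1) pxy(1) nn0(2) pxy(2) nn0(3) pxy(3) that])
  have K0: "0 \<le> K"
    unfolding K_def using stable pxy \<theta>_nonneg \<kappa>_pos by simp
  obtain K2 where K2: "0 \<le> K2" "\<And>t. 0 \<le> t \<Longrightarrow> moment (\<lambda>\<omega>. Z \<omega> * (l t \<omega>)\<^sup>2) \<le> ennreal K2"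
    using second_moment_bounded[OF stable Z Z_nonneg nn0(1) pxy(1) nn0(2) pxy(2) nn0(3) pxy(3)] by blast
  let ?c = equilibrium
  have first: "integrable M (\<lambda>\<omega>. Z \<omega> * l t \<omega>)"
    "expectation (\<lambda>\<omega>. Z \<omega> * l t \<omega>) = (x - ?c * p) * exp (- decay * t) + ?c * p" if "0 \<le> t" for t
    using mean_solution[OF stable order_refl Z Z_nonneg Z_int K K0 that] unfolding x_def p_def by simp_all
  have to_nn: "(\<integral>\<^sup>+\<omega>\<in>B. ennreal (f \<omega>) \<partial>M) = ennreal (expectation (\<lambda>\<omega>. Z \<omega> * f \<omega>))"
    if "integrable M (\<lambda>\<omega>. Z \<omega> * f \<omega>)" "\<And>\<omega>. \<omega> \<in> space M \<Longrightarrow> 0 \<le> f \<omega>" for f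
  proof -
    have "(\<integral>\<^sup>+\<omega>\<in>B. ennreal (f \<omega>) \<partial>M) = moment (\<lambda>\<omega>. Z \<omega> * f \<omega>)"
      unfolding Z_def by (intro nn_integral_cong) (auto split: split_indicator)
    also have "\<dots> = ennreal (expectation (\<lambda>\<omega>. Z \<omega> * f \<omega>))"
      using that Z_nonneg by (intro nn_integral_eq_integral AE_I2) auto
    finally show ?thesis .
  qed
  have mean_split: "Z \<omega> * cond_mean (l 0 \<omega>) t = (Z \<omega> * l 0 \<omega> - ?c * Z \<omega>) * exp (- decay * t) + ?c * Z \<omega>" for \<omega>
    unfolding cond_mean_def by (simp add: algebra_simps)
  have "integrable M (\<lambda>\<omega>. Z \<omega> * cond_mean (l 0 \<omega>) t)"
    "expectation (\<lambda>\<omega>. Z \<omega> * cond_mean (l 0 \<omega>) t) = (x - ?c * p) * exp (- decay * t) + ?c * p"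
    unfolding mean_split x_def p_def using Z_int int0(1) by simp_all
  then show "(\<integral>\<^sup>+\<omega>\<in>B. ennreal (l t \<omega>) \<partial>M) = (\<integral>\<^sup>+\<omega>\<in>B. ennreal (cond_mean (l 0 \<omega>) t) \<partial>M)"
    using first[OF t0] l_nonneg[OF t0] cond_mean_nonneg[OF stable l_nonneg[OF order_refl] t0]
    by (subst (1 2) to_nn) auto
  define e where "e = exp (- decay * s)"
  define d where "d = exp (- decay * (t - s))"
  have et: "exp (- decay * t) = e * d"
    unfolding e_def d_def by (simp add: exp_add[symmetric] algebra_simps)
  define X where "X = (x - ?c * p) * e + ?c * p"
  define Y where "Y = jump_power * ((x - ?c * p) * (e - e\<^sup>2) / decay + ?c * p * (1 - e\<^sup>2) / (2 * decay))
      + (y - 2 * ?c * x + ?c\<^sup>2 * p) * e\<^sup>2 + 2 * ?c * (x - ?c * p) * e + ?c\<^sup>2 * p"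
  have X: "expectation (\<lambda>\<omega>. Z \<omega> * l s \<omega>) = X"
    unfolding X_def e_def by (rule first(2)[OF s])
  have Y: "expectation (\<lambda>\<omega>. Z \<omega> * (l s \<omega>)\<^sup>2) = Y"
    using second_moment_solution(2)[OF stable Z Z_nonneg Z_int K K0 K2(2,1) s]
    unfolding Y_def e_def x_def y_def p_def by simp
  \<comment> \<open>The weight has to be nonnegative everywhere, while the intensity is so on the sample space.\<close>
  define W where "W \<omega> = Z \<omega> * max 0 (l s \<omega>)" for \<omega>
  have W_eq: "W \<omega> = Z \<omega> * l s \<omega>" if "\<omega> \<in> space M" for \<omega>
    using l_nonneg[OF s that] by (simp add: W_def)
  have W: "W \<in> borel_measurable (F s)" and W_nonneg: "\<And>\<omega>. 0 \<le> W \<omega>"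
    using measurable_F_mono[OF Z s] l_adapted[OF s] Z_nonneg unfolding W_def by auto
  have W_int: "integrable M W"
    using first(1)[OF s] by (subst Bochner_Integration.integrable_cong[OF refl W_eq]) auto
  have W_bound: "moment (\<lambda>\<omega>. W \<omega> * l r \<omega>) \<le> ennreal (2 * K2)" if r: "s \<le> r" for r
  proof -
    have r0: "0 \<le> r" using s r by simp
    note [measurable] = l_measurable[OF r0]
    have "moment (\<lambda>\<omega>. W \<omega> * l r \<omega>) \<le> (\<integral>\<^sup>+\<omega>. ennreal (Z \<omega> * (l s \<omega>)\<^sup>2) + ennreal (Z \<omega> * (l r \<omega>)\<^sup>2) \<partial>M)"
    proof (rule nn_integral_mono)
      fix \<omega> assume \<omega>: "\<omega> \<in> space M"
      have "l s \<omega> * l r \<omega> \<le> (l s \<omega>)\<^sup>2 + (l r \<omega>)\<^sup>2"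
        using zero_le_power2[of "l s \<omega> - l r \<omega>"] mult_nonneg_nonneg[OF l_nonneg[OF s \<omega>] l_nonneg[OF r0 \<omega>]]
        unfolding power2_diff by linarith
      from mult_left_mono[OF this Z_nonneg[of \<omega>]]
      have "ennreal (W \<omega> * l r \<omega>) \<le> ennreal (Z \<omega> * (l s \<omega>)\<^sup>2 + Z \<omega> * (l r \<omega>)\<^sup>2)"
        unfolding W_eq[OF \<omega>] by (intro ennreal_leI) (simp add: algebra_simps)
      then show "ennreal (W \<omega> * l r \<omega>) \<le> ennreal (Z \<omega> * (l s \<omega>)\<^sup>2) + ennreal (Z \<omega> * (l r \<omega>)\<^sup>2)"
        using Z_nonneg[of \<omega>] by simp
    qed
    also have "\<dots> = moment (\<lambda>\<omega>. Z \<omega> * (l s \<omega>)\<^sup>2) + moment (\<lambda>\<omega>. Z \<omega> * (l r \<omega>)\<^sup>2)"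
      by (rule nn_integral_add) measurable
    also have "\<dots> \<le> ennreal K2 + ennreal K2"
      by (intro add_mono K2 s r0)
    finally show ?thesis
      using K2(1) by (simp add: ennreal_plus[symmetric] del: ennreal_plus)
  qed
  have W_exp: "expectation W = X" "expectation (\<lambda>\<omega>. W \<omega> * l s \<omega>) = Y"
    unfolding X[symmetric] Y[symmetric]
    by (auto intro!: Bochner_Integration.integral_cong simp: W_eq power2_eq_square)
  have W_sol: "integrable M (\<lambda>\<omega>. W \<omega> * l t \<omega>)" "expectation (\<lambda>\<omega>. W \<omega> * l t \<omega>) = (Y - ?c * X) * d + ?c * X"
    using mean_solution[OF stable s W W_nonneg W_int W_bound _ t] K2(1) unfolding W_exp d_def by simp_all
  have prod_int: "integrable M (\<lambda>\<omega>. Z \<omega> * (l s \<omega> * l t \<omega>))"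
  proof -
    have "integrable M (\<lambda>\<omega>. Z \<omega> * (l s \<omega> * l t \<omega>)) \<longleftrightarrow> integrable M (\<lambda>\<omega>. W \<omega> * l t \<omega>)"
      by (rule Bochner_Integration.integrable_cong) (auto simp: W_eq)
    then show ?thesis
      using W_sol(1) by simp
  qed
  have prod_exp: "expectation (\<lambda>\<omega>. Z \<omega> * (l s \<omega> * l t \<omega>)) = (Y - ?c * X) * d + ?c * X"
    unfolding W_sol(2)[symmetric] by (intro Bochner_Integration.integral_cong) (auto simp: W_eq)
  \<comment> \<open>The product moment is a quadratic polynomial in the initial intensity, with these lower coefficients.\<close>
  define A1 where "A1 = jump_power * (e - e\<^sup>2) / decay * d - 2 * ?c * e\<^sup>2 * d + ?c * e + ?c * e * d"
  define A0 where "A0 = jump_power * (?c * (1 - e\<^sup>2) / (2 * decay) - ?c * (e - e\<^sup>2) / decay) * d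
    + ?c\<^sup>2 * e\<^sup>2 * d - ?c\<^sup>2 * e - ?c\<^sup>2 * e * d + ?c\<^sup>2"
  have product_split: "Z \<omega> * cond_product (l 0 \<omega>) s t =
      e\<^sup>2 * d * (Z \<omega> * (l 0 \<omega>)\<^sup>2) + A1 * (Z \<omega> * l 0 \<omega>) + A0 * Z \<omega>" for \<omega>
    unfolding cond_product_def cond_var_def cond_mean_def et A1_def A0_def e_def[symmetric] d_def[symmetric]
    by (simp add: algebra_simps power2_eq_square diff_divide_distrib add_divide_distrib)
  have "integrable M (\<lambda>\<omega>. Z \<omega> * cond_product (l 0 \<omega>) s t)"
    "expectation (\<lambda>\<omega>. Z \<omega> * cond_product (l 0 \<omega>) s t) = e\<^sup>2 * d * y + A1 * x + A0 * p"
    unfolding product_split x_def y_def p_def using Z_int int0 by simp_all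
  moreover have "e\<^sup>2 * d * y + A1 * x + A0 * p = (Y - ?c * X) * d + ?c * X"
    unfolding X_def Y_def A1_def A0_def
    by (simp add: algebra_simps power2_eq_square diff_divide_distrib add_divide_distrib)
  ultimately show "(\<integral>\<^sup>+\<omega>\<in>B. ennreal (l s \<omega> * l t \<omega>) \<partial>M) = (\<integral>\<^sup>+\<omega>\<in>B. ennreal (cond_product (l 0 \<omega>) s t) \<partial>M)"
    using prod_int prod_exp l_nonneg[OF t0] l_nonneg[OF s] cond_product_nonneg[OF stable l_nonneg[OF order_refl] s t]
    by (subst (1 2) to_nn) auto
qed

text \<open>Events of bounded initial intensity exhaust the space, since the initial intensity is finite.\<close>

lemma nn_integral_by_initial_level:
  assumes [measurable]: "f \<in> borel_measurable M" "g \<in> borel_measurable M" and A: "A \<in> sets (F 0)"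
    and eq: "\<And>B L. B \<in> sets (F 0) \<Longrightarrow> (\<And>\<omega>. \<omega> \<in> B \<Longrightarrow> l 0 \<omega> \<le> L) \<Longrightarrow>
      (\<integral>\<^sup>+\<omega>\<in>B. f \<omega> \<partial>M) = (\<integral>\<^sup>+\<omega>\<in>B. g \<omega> \<partial>M)"
  shows "(\<integral>\<^sup>+\<omega>\<in>A. f \<omega> \<partial>M) = (\<integral>\<^sup>+\<omega>\<in>A. g \<omega> \<partial>M)"
proof -
  define B where "B n = A \<inter> {\<omega> \<in> space M. l 0 \<omega> \<le> real n}" for n
  have B: "B n \<in> sets (F 0)" for n
  proof -
    have "{\<omega> \<in> space (F 0). l 0 \<omega> \<le> real n} \<in> sets (F 0)"
      using l_adapted[of 0] by measurable
    then show ?thesis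
      unfolding B_def using A by (auto simp: space_F)
  qed
  have [measurable]: "B n \<in> events" for n
    using B filtration_subset by blast
  have B_mono: "\<omega> \<in> B m \<Longrightarrow> m \<le> n \<Longrightarrow> \<omega> \<in> B n" for \<omega> m n
    unfolding B_def by auto
  have lim: "(\<integral>\<^sup>+\<omega>\<in>A. h \<omega> \<partial>M) = (SUP n. \<integral>\<^sup>+\<omega>\<in>B n. h \<omega> \<partial>M)" if [measurable]: "h \<in> borel_measurable M" for h
  proof -
    have "(\<integral>\<^sup>+\<omega>\<in>A. h \<omega> \<partial>M) = (\<integral>\<^sup>+\<omega>. (SUP n. h \<omega> * indicator (B n) \<omega>) \<partial>M)"
    proof (rule nn_integral_cong)
      fix \<omega> assume \<omega>: "\<omega> \<in> space M"
      show "h \<omega> * indicator A \<omega> = (SUP n. h \<omega> * indicator (B n) \<omega>)"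
      proof (rule antisym)
        obtain n :: nat where "l 0 \<omega> \<le> real n" using real_arch_simple by blast
        then show "h \<omega> * indicator A \<omega> \<le> (SUP n. h \<omega> * indicator (B n) \<omega>)"
          using \<omega> by (intro SUP_upper2[of n]) (auto simp: B_def split: split_indicator)
        show "(SUP n. h \<omega> * indicator (B n) \<omega>) \<le> h \<omega> * indicator A \<omega>"
          by (intro SUP_least) (auto simp: B_def split: split_indicator)
      qed
    qed
    also have "\<dots> = (SUP n. \<integral>\<^sup>+\<omega>\<in>B n. h \<omega> \<partial>M)"
      by (rule nn_integral_monotone_convergence_SUP)
        (auto simp: incseq_def le_fun_def split: split_indicator dest: B_mono)
    finally show ?thesis .
  qed
  have "(\<integral>\<^sup>+\<omega>\<in>B n. f \<omega> \<partial>M) = (\<integral>\<^sup>+\<omega>\<in>B n. g \<omega> \<partial>M)" for n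
    by (rule eq[OF B, of _ "real n"]) (auto simp: B_def)
  then show ?thesis
    by (simp add: lim)
qed

lemma cond_product_measurable:
  "(\<lambda>p. cond_product (fst p) (fst (snd p)) (snd (snd p))) \<in> borel_measurable (borel \<Otimes>\<^sub>M (borel \<Otimes>\<^sub>M borel))"
  unfolding cond_product_def cond_var_def cond_mean_def by measurable

lemma cond_mean_integral:
  assumes stable: "\<eta> * \<mu> < \<kappa>" and A: "A \<in> sets (F 0)" and t: "0 \<le> t"
  shows "(\<integral>\<^sup>+\<omega>\<in>A. ennreal (l t \<omega>) \<partial>M) = (\<integral>\<^sup>+\<omega>\<in>A. ennreal (cond_mean (l 0 \<omega>) t) \<partial>M)"
proof (rule nn_integral_by_initial_level[OF _ _ A])
  note [measurable] = l_measurable[OF order_refl] l_measurable[OF t]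
  show "(\<lambda>\<omega>. ennreal (cond_mean (l 0 \<omega>) t)) \<in> borel_measurable M"
    unfolding cond_mean_def by measurable
qed (use l_measurable[OF t] moments_on_bounded_event(1)[OF stable _ _ order_refl t] in auto)

lemma cond_product_integral:
  assumes stable: "\<eta> * \<mu> < \<kappa>" and A: "A \<in> sets (F 0)" and s: "0 \<le> s" and t: "s \<le> t"
  shows "(\<integral>\<^sup>+\<omega>\<in>A. ennreal (l s \<omega> * l t \<omega>) \<partial>M) = (\<integral>\<^sup>+\<omega>\<in>A. ennreal (cond_product (l 0 \<omega>) s t) \<partial>M)"
proof (rule nn_integral_by_initial_level[OF _ _ A])
  have t0: "0 \<le> t" using s t by simp
  note [measurable] = l_measurable[OF order_refl] l_measurable[OF s] l_measurable[OF t0]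
  show "(\<lambda>\<omega>. ennreal (cond_product (l 0 \<omega>) s t)) \<in> borel_measurable M"
    unfolding cond_product_def cond_var_def cond_mean_def by measurable
  show "(\<lambda>\<omega>. ennreal (l s \<omega> * l t \<omega>)) \<in> borel_measurable M"
    by measurable
qed (use moments_on_bounded_event(2)[OF stable _ _ s t] in auto)

end

section \<open>Independent time change\<close>

lemma generated_sigma_measurable:
  assumes "\<And>i. i \<in> I \<Longrightarrow> X i \<in> \<Omega> \<rightarrow> space S"
  shows "space (generated_sigma \<Omega> I X S) = \<Omega>"
    and "i \<in> I \<Longrightarrow> X i \<in> generated_sigma \<Omega> I X S \<rightarrow>\<^sub>M S"
proof -
  let ?C = "{X i -` B \<inter> \<Omega> | i B. i \<in> I \<and> B \<in> sets S}"
  have C: "?C \<subseteq> Pow \<Omega>"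
    by auto
  show sp: "space (generated_sigma \<Omega> I X S) = \<Omega>"
    unfolding generated_sigma_def by (rule space_measure_of[OF C])
  show "X i \<in> generated_sigma \<Omega> I X S \<rightarrow>\<^sub>M S" if "i \<in> I"
  proof (rule measurableI)
    show "X i -` B \<inter> space (generated_sigma \<Omega> I X S) \<in> sets (generated_sigma \<Omega> I X S)" if "B \<in> sets S" for B
      unfolding sp unfolding generated_sigma_def sets_measure_of[OF C]
      using \<open>i \<in> I\<close> that by (intro sigma_sets.Basic) blast
  qed (use assms[OF that] sp in auto)
qed

context hawkes_process
begin

lemma hawkes_generators:
  "sets (F 0) \<union> sets (generated_sigma (space M) {0..} N (count_space UNIV))
    \<union> sets (generated_sigma (space M) {0..} l borel) \<subseteq> Pow (space M)"
  using in_F_imp_subset sets.space_closed[of "generated_sigma (space M) {0..} N (count_space UNIV)"]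
    sets.space_closed[of "generated_sigma (space M) {0..} l borel"]
  by (auto simp: generated_sigma_measurable(1))

lemma space_hawkes_sigma: "space (hawkes_sigma M F N l) = space M"
  unfolding hawkes_sigma_def by (rule space_measure_of[OF hawkes_generators])

lemma initial_subalgebra_hawkes: "subalgebra (hawkes_sigma M F N l) (F 0)"
  unfolding subalgebra_def space_hawkes_sigma space_F
  unfolding hawkes_sigma_def sets_measure_of[OF hawkes_generators] by (auto intro: sigma_sets.Basic)

lemma l_hawkes_measurable:
  assumes "0 \<le> t"
  shows "l t \<in> borel_measurable (hawkes_sigma M F N l)"
proof -
  have "subalgebra (hawkes_sigma M F N l) (generated_sigma (space M) {0..} l borel)"
    unfolding subalgebra_def space_hawkes_sigma
    unfolding hawkes_sigma_def sets_measure_of[OF hawkes_generators]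
    by (auto simp: generated_sigma_measurable(1) intro: sigma_sets.Basic)
  then show ?thesis
    by (rule measurable_from_subalg) (use assms in \<open>auto intro!: generated_sigma_measurable(2)\<close>)
qed

text \<open>If the moments of the Hawkes process at fixed times are known on initial events, the moments at random
  times independent of the process follow by substituting the times and averaging over them.\<close>

lemma nn_integral_time_change:
  fixes \<Phi> :: "real \<times> real \<Rightarrow> ennreal"
  assumes indep: "indep_set (sets G) (sets (hawkes_sigma M F N l))" and G: "space G = space M"
    and S: "S \<in> borel_measurable G" and T: "T \<in> borel_measurable G"
    and \<Phi>: "\<Phi> \<in> borel_measurable (borel \<Otimes>\<^sub>M borel)"
    and \<Psi>: "\<Psi> \<in> borel_measurable (borel \<Otimes>\<^sub>M (borel \<Otimes>\<^sub>M borel))"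
    and order: "AE \<omega> in M. 0 \<le> S \<omega> \<and> S \<omega> \<le> T \<omega>"
    and moments: "\<And>s t. 0 \<le> s \<Longrightarrow> s \<le> t \<Longrightarrow>
      (\<integral>\<^sup>+\<omega>\<in>A. \<Phi> (l s \<omega>, l t \<omega>) \<partial>M) = (\<integral>\<^sup>+\<omega>\<in>A. \<Psi> (l 0 \<omega>, s, t) \<partial>M)"
    and A: "A \<in> sets (F 0)"
  shows "(\<integral>\<^sup>+\<omega>\<in>A. \<Phi> (l (S \<omega>) \<omega>, l (T \<omega>) \<omega>) \<partial>M) =
    (\<integral>\<^sup>+\<omega>\<in>A. (\<integral>\<^sup>+\<omega>'. \<Psi> (l 0 \<omega>, S \<omega>', T \<omega>') \<partial>M) \<partial>M)"
proof -
  let ?H = "hawkes_sigma M F N l"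
  interpret pair_sigma_finite M M ..
  have G_M: "subalgebra M G"
    using indep G by (auto simp: indep_sets2_eq subalgebra_def)
  have A_H [measurable]: "A \<in> sets ?H" and A_M [measurable]: "A \<in> events"
    using A initial_subalgebra_hawkes filtration_subset by (auto simp: subalgebra_def)
  have S_M [measurable]: "S \<in> borel_measurable M" and T_M [measurable]: "T \<in> borel_measurable M"
    using measurable_from_subalg[OF G_M] S T by auto
  note [measurable] = \<Phi> \<Psi> l_measurable[OF order_refl]
  have path: "(\<lambda>p. l (max 0 (X (fst p))) (snd p)) \<in> borel_measurable (G \<Otimes>\<^sub>M ?H)"
    if X: "X \<in> borel_measurable G" for X
  proof -
    have "(\<lambda>p. (X (fst p), snd p)) \<in> G \<Otimes>\<^sub>M ?H \<rightarrow>\<^sub>M borel \<Otimes>\<^sub>M ?H"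
      using X by measurable
    from measurable_compose[OF this intensity_jointly_measurable[OF space_hawkes_sigma l_hawkes_measurable]]
    show ?thesis by simp
  qed
  have joint: "(\<lambda>p. \<Phi> (l (max 0 (S (fst p))) (snd p), l (max 0 (T (fst p))) (snd p)) * indicator A (snd p))
      \<in> borel_measurable (G \<Otimes>\<^sub>M ?H)"
    using path[OF S] path[OF T] by measurable
  have "(\<integral>\<^sup>+\<omega>\<in>A. \<Phi> (l (S \<omega>) \<omega>, l (T \<omega>) \<omega>) \<partial>M) =
      (\<integral>\<^sup>+\<omega>. \<Phi> (l (max 0 (S \<omega>)) \<omega>, l (max 0 (T \<omega>)) \<omega>) * indicator A \<omega> \<partial>M)"
    by (rule nn_integral_cong_AE) (use order in eventually_elim, simp add: max_def)
  also have "\<dots> = (\<integral>\<^sup>+\<omega>'. \<integral>\<^sup>+\<omega>. \<Phi> (l (max 0 (S \<omega>')) \<omega>, l (max 0 (T \<omega>')) \<omega>) * indicator A \<omega> \<partial>M \<partial>M)"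
    using indep_set_nn_integral_pair[OF indep G space_hawkes_sigma joint] by simp
  also have "\<dots> = (\<integral>\<^sup>+\<omega>'. \<integral>\<^sup>+\<omega>. \<Psi> (l 0 \<omega>, S \<omega>', T \<omega>') * indicator A \<omega> \<partial>M \<partial>M)"
    by (rule nn_integral_cong_AE) (use order in eventually_elim, simp add: max_def moments)
  also have "\<dots> = (\<integral>\<^sup>+\<omega>. \<integral>\<^sup>+\<omega>'. \<Psi> (l 0 \<omega>, S \<omega>', T \<omega>') * indicator A \<omega> \<partial>M \<partial>M)"
    by (rule Fubini'[symmetric]) measurable
  also have "\<dots> = (\<integral>\<^sup>+\<omega>\<in>A. (\<integral>\<^sup>+\<omega>'. \<Psi> (l 0 \<omega>, S \<omega>', T \<omega>') \<partial>M) \<partial>M)"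
  proof (rule nn_integral_cong)
    fix \<omega>
    have "(\<lambda>\<omega>'. \<Psi> (l 0 \<omega>, S \<omega>', T \<omega>')) \<in> borel_measurable M"
      by measurable
    then show "(\<integral>\<^sup>+\<omega>'. \<Psi> (l 0 \<omega>, S \<omega>', T \<omega>') * indicator A \<omega> \<partial>M) = (\<integral>\<^sup>+\<omega>'. \<Psi> (l 0 \<omega>, S \<omega>', T \<omega>') \<partial>M) * indicator A \<omega>"
      by (rule nn_integral_multc)
  qed
  finally show ?thesis .
qed

lemma time_changed_intensity_measurable:
  assumes indep: "indep_set (sets G) (sets (hawkes_sigma M F N l))" and G: "space G = space M"
    and S: "S \<in> borel_measurable G" "\<And>\<omega>. 0 \<le> S \<omega>"
  shows "(\<lambda>\<omega>. l (S \<omega>) \<omega>) \<in> borel_measurable M"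
proof -
  have "subalgebra M G"
    using indep G by (auto simp: indep_sets2_eq subalgebra_def)
  then have [measurable]: "S \<in> borel_measurable M"
    using S measurable_from_subalg by blast
  have "(\<lambda>\<omega>. (S \<omega>, \<omega>)) \<in> M \<rightarrow>\<^sub>M borel \<Otimes>\<^sub>M M"
    by measurable
  from measurable_compose[OF this intensity_measurable_pair] show ?thesis
    using S(2) by (simp add: max_absorb2)
qed

lemma exp_decay_integrable:
  assumes stable: "\<eta> * \<mu> < \<kappa>" and [measurable]: "S \<in> borel_measurable M" and S: "AE \<omega> in M. 0 \<le> S \<omega>"
  shows "integrable M (\<lambda>\<omega>. exp (- decay * S \<omega>))"
proof (rule integrable_const_bound[where B = 1])
  show "AE \<omega> in M. norm (exp (- decay * S \<omega>)) \<le> 1"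
    using S
  proof eventually_elim
    case (elim \<omega>)
    then have "0 \<le> decay * S \<omega>"
      using stable by (simp add: decay_def)
    then show ?case by simp
  qed
qed measurable

lemma time_changed_cond_mean:
  assumes stable: "\<eta> * \<mu> < \<kappa>"
    and indep: "indep_set (sets G) (sets (hawkes_sigma M F N l))" and G: "space G = space M"
    and S: "S \<in> borel_measurable G" "\<And>\<omega>. 0 \<le> S \<omega>"
  defines "m \<equiv> \<lambda>x. (x - equilibrium) * expectation (\<lambda>\<omega>. exp (- decay * S \<omega>)) + equilibrium"
  shows "AE \<omega> in M. nn_cond_exp M (F 0) (\<lambda>\<omega>. ennreal (l (S \<omega>) \<omega>)) \<omega> = ennreal (m (l 0 \<omega>))"
    and "\<And>\<omega>. \<omega> \<in> space M \<Longrightarrow> 0 \<le> m (l 0 \<omega>)"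
proof -
  interpret finite_measure_subalgebra M "F 0"
    by unfold_locales (use filtration_subset space_F in \<open>auto simp: subalgebra_def\<close>)
  have "subalgebra M G"
    using indep G by (auto simp: indep_sets2_eq subalgebra_def)
  then have [measurable]: "S \<in> borel_measurable M"
    using S measurable_from_subalg by blast
  note [measurable] = time_changed_intensity_measurable[OF indep G S]
  have int: "integrable M (\<lambda>\<omega>. exp (- decay * S \<omega>))"
    using S by (intro exp_decay_integrable[OF stable]) auto
  have m: "0 \<le> m (l 0 \<omega>)" "(\<integral>\<^sup>+\<omega>'. ennreal (cond_mean (l 0 \<omega>) (S \<omega>')) \<partial>M) = ennreal (m (l 0 \<omega>))"
    if \<omega>: "\<omega> \<in> space M" for \<omega>
  proof -
    have nonneg: "AE \<omega>' in M. 0 \<le> cond_mean (l 0 \<omega>) (S \<omega>')"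
      using cond_mean_nonneg[OF stable l_nonneg[OF order_refl \<omega>]] S by auto
    have cm: "integrable M (\<lambda>\<omega>'. cond_mean (l 0 \<omega>) (S \<omega>'))"
      "expectation (\<lambda>\<omega>'. cond_mean (l 0 \<omega>) (S \<omega>')) = m (l 0 \<omega>)"
      unfolding cond_mean_def m_def using int by (simp_all add: prob_space)
    show "0 \<le> m (l 0 \<omega>)"
      unfolding cm(2)[symmetric] by (rule integral_nonneg_AE[OF nonneg])
    show "(\<integral>\<^sup>+\<omega>'. ennreal (cond_mean (l 0 \<omega>) (S \<omega>')) \<partial>M) = ennreal (m (l 0 \<omega>))"
      unfolding cm(2)[symmetric] by (rule nn_integral_eq_integral[OF cm(1) nonneg])
  qed
  then show "\<And>\<omega>. \<omega> \<in> space M \<Longrightarrow> 0 \<le> m (l 0 \<omega>)"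
    by simp
  have "AE \<omega> in M. ennreal (m (l 0 \<omega>)) = nn_cond_exp M (F 0) (\<lambda>\<omega>. ennreal (l (S \<omega>) \<omega>)) \<omega>"
  proof (rule nn_cond_exp_charact)
    fix A assume A: "A \<in> sets (F 0)"
    have "(\<integral>\<^sup>+\<omega>\<in>A. ennreal (l (S \<omega>) \<omega>) \<partial>M) = (\<integral>\<^sup>+\<omega>\<in>A. (\<integral>\<^sup>+\<omega>'. ennreal (cond_mean (l 0 \<omega>) (S \<omega>')) \<partial>M) \<partial>M)"
    proof -
      have \<Psi>: "(\<lambda>p. ennreal (cond_mean (fst p) (snd (snd p)))) \<in> borel_measurable (borel \<Otimes>\<^sub>M (borel \<Otimes>\<^sub>M borel))"
        unfolding cond_mean_def by measurable
      show ?thesis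
        using nn_integral_time_change[OF indep G S(1) S(1), of "\<lambda>p. ennreal (snd p)", OF _ \<Psi> _ _ A]
          cond_mean_integral[OF stable A] S(2) by simp
    qed
    also have "\<dots> = (\<integral>\<^sup>+\<omega>\<in>A. ennreal (m (l 0 \<omega>)) \<partial>M)"
      by (intro nn_integral_cong) (simp add: m)
    finally show "(\<integral>\<^sup>+\<omega>\<in>A. ennreal (l (S \<omega>) \<omega>) \<partial>M) = (\<integral>\<^sup>+\<omega>\<in>A. ennreal (m (l 0 \<omega>)) \<partial>M)" .
  qed (use l_adapted[OF order_refl] in \<open>simp_all add: m_def\<close>)
  then show "AE \<omega> in M. nn_cond_exp M (F 0) (\<lambda>\<omega>. ennreal (l (S \<omega>) \<omega>)) \<omega> = ennreal (m (l 0 \<omega>))"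
    by eventually_elim simp
qed

text \<open>Written in this way, the product moment depends on the times only through \<open>exp (- decay * s)\<close>,
  \<open>exp (- decay * t)\<close>, \<open>exp (- decay * (t + s))\<close> and \<open>exp (- decay * (t - s))\<close>, each to the first power.\<close>

lemma cond_product_exp:
  assumes "\<eta> * \<mu> < \<kappa>"
  shows "cond_product x s t =
    jump_power * ((x - equilibrium) * (exp (- decay * t) - exp (- decay * (t + s))) / decay
      + equilibrium * (exp (- decay * (t - s)) - exp (- decay * (t + s))) / (2 * decay))
    + ((x - equilibrium)\<^sup>2 * exp (- decay * (t + s))
      + equilibrium * (x - equilibrium) * (exp (- decay * t) + exp (- decay * s)) + equilibrium\<^sup>2)"
proof -
  have decay: "0 < decay"
    using assms by (simp add: decay_def)
  define e where "e = exp (- decay * s)"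
  define d where "d = exp (- decay * (t - s))"
  have "exp (- decay * t) = e * d" "exp (- decay * (t + s)) = e\<^sup>2 * d"
    unfolding e_def d_def by (simp_all add: exp_add[symmetric] power2_eq_square algebra_simps)
  then show ?thesis
    unfolding cond_product_def cond_var_def cond_mean_def e_def[symmetric] d_def[symmetric]
    using decay by (simp add: field_simps power2_eq_square)
qed

lemma time_changed_cond_product:
  assumes stable: "\<eta> * \<mu> < \<kappa>"
    and indep: "indep_set (sets G) (sets (hawkes_sigma M F N l))" and G: "space G = space M"
    and S: "S \<in> borel_measurable G" "\<And>\<omega>. 0 \<le> S \<omega>" and T: "T \<in> borel_measurable G" "\<And>\<omega>. 0 \<le> T \<omega>"
    and le: "AE \<omega> in M. S \<omega> \<le> T \<omega>"
  defines "\<phi> \<equiv> \<lambda>X. expectation (\<lambda>\<omega>. exp (- decay * X \<omega>))"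
  defines "q \<equiv> \<lambda>x. jump_power * ((x - equilibrium) * (\<phi> T - \<phi> (\<lambda>\<omega>. T \<omega> + S \<omega>)) / decay
      + equilibrium * (\<phi> (\<lambda>\<omega>. T \<omega> - S \<omega>) - \<phi> (\<lambda>\<omega>. T \<omega> + S \<omega>)) / (2 * decay))
    + ((x - equilibrium)\<^sup>2 * \<phi> (\<lambda>\<omega>. T \<omega> + S \<omega>)
      + equilibrium * (x - equilibrium) * (\<phi> T + \<phi> S) + equilibrium\<^sup>2)"
  shows "AE \<omega> in M. nn_cond_exp M (F 0) (\<lambda>\<omega>. ennreal (l (S \<omega>) \<omega> * l (T \<omega>) \<omega>)) \<omega> = ennreal (q (l 0 \<omega>))"
    and "\<And>\<omega>. \<omega> \<in> space M \<Longrightarrow> 0 \<le> q (l 0 \<omega>)"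
proof -
  interpret finite_measure_subalgebra M "F 0"
    by unfold_locales (use filtration_subset space_F in \<open>auto simp: subalgebra_def\<close>)
  have "subalgebra M G"
    using indep G by (auto simp: indep_sets2_eq subalgebra_def)
  then have [measurable]: "S \<in> borel_measurable M" "T \<in> borel_measurable M"
    using S T measurable_from_subalg by blast+
  note [measurable] = time_changed_intensity_measurable[OF indep G S] time_changed_intensity_measurable[OF indep G T]
  have int: "integrable M (\<lambda>\<omega>. exp (- decay * S \<omega>))" "integrable M (\<lambda>\<omega>. exp (- decay * T \<omega>))"
    "integrable M (\<lambda>\<omega>. exp (- decay * (T \<omega> + S \<omega>)))" "integrable M (\<lambda>\<omega>. exp (- decay * (T \<omega> - S \<omega>)))"
    using S T le by (intro exp_decay_integrable[OF stable]; simp)+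
  have q: "0 \<le> q (l 0 \<omega>)" "(\<integral>\<^sup>+\<omega>'. ennreal (cond_product (l 0 \<omega>) (S \<omega>') (T \<omega>')) \<partial>M) = ennreal (q (l 0 \<omega>))"
    if \<omega>: "\<omega> \<in> space M" for \<omega>
  proof -
    have nonneg: "AE \<omega>' in M. 0 \<le> cond_product (l 0 \<omega>) (S \<omega>') (T \<omega>')"
      using le by eventually_elim (rule cond_product_nonneg[OF stable l_nonneg[OF order_refl \<omega>] S(2)])
    have cp: "integrable M (\<lambda>\<omega>'. cond_product (l 0 \<omega>) (S \<omega>') (T \<omega>'))"
      "expectation (\<lambda>\<omega>'. cond_product (l 0 \<omega>) (S \<omega>') (T \<omega>')) = q (l 0 \<omega>)"
      unfolding cond_product_exp[OF stable] q_def \<phi>_def using int by (simp_all add: prob_space)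
    show "0 \<le> q (l 0 \<omega>)"
      unfolding cp(2)[symmetric] by (rule integral_nonneg_AE[OF nonneg])
    show "(\<integral>\<^sup>+\<omega>'. ennreal (cond_product (l 0 \<omega>) (S \<omega>') (T \<omega>')) \<partial>M) = ennreal (q (l 0 \<omega>))"
      unfolding cp(2)[symmetric] by (rule nn_integral_eq_integral[OF cp(1) nonneg])
  qed
  then show "\<And>\<omega>. \<omega> \<in> space M \<Longrightarrow> 0 \<le> q (l 0 \<omega>)"
    by simp
  have "AE \<omega> in M. ennreal (q (l 0 \<omega>)) = nn_cond_exp M (F 0) (\<lambda>\<omega>. ennreal (l (S \<omega>) \<omega> * l (T \<omega>) \<omega>)) \<omega>"
  proof (rule nn_cond_exp_charact)
    fix A assume A: "A \<in> sets (F 0)"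
    have \<Psi>: "(\<lambda>p. ennreal (cond_product (fst p) (fst (snd p)) (snd (snd p)))) \<in> borel_measurable (borel \<Otimes>\<^sub>M (borel \<Otimes>\<^sub>M borel))"
      using cond_product_measurable by measurable
    have "(\<integral>\<^sup>+\<omega>\<in>A. ennreal (l (S \<omega>) \<omega> * l (T \<omega>) \<omega>) \<partial>M) =
        (\<integral>\<^sup>+\<omega>\<in>A. (\<integral>\<^sup>+\<omega>'. ennreal (cond_product (l 0 \<omega>) (S \<omega>') (T \<omega>')) \<partial>M) \<partial>M)"
      using nn_integral_time_change[OF indep G S(1) T(1), of "\<lambda>p. ennreal (fst p * snd p)", OF _ \<Psi> _ _ A]
        cond_product_integral[OF stable A] S(2) le by simp
    also have "\<dots> = (\<integral>\<^sup>+\<omega>\<in>A. ennreal (q (l 0 \<omega>)) \<partial>M)"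
      by (intro nn_integral_cong) (simp add: q)
    finally show "(\<integral>\<^sup>+\<omega>\<in>A. ennreal (l (S \<omega>) \<omega> * l (T \<omega>) \<omega>) \<partial>M) = (\<integral>\<^sup>+\<omega>\<in>A. ennreal (q (l 0 \<omega>)) \<partial>M)" .
  qed (use l_adapted[OF order_refl] in \<open>simp_all add: q_def\<close>)
  then show "AE \<omega> in M. nn_cond_exp M (F 0) (\<lambda>\<omega>. ennreal (l (S \<omega>) \<omega> * l (T \<omega>) \<omega>)) \<omega> = ennreal (q (l 0 \<omega>))"
    by eventually_elim simp
qed

text \<open>With conditional means \<open>m\<^sub>T\<close> and \<open>m\<^sub>S\<close>, the centred product is the difference of the nonnegative functions
  \<open>l T * l S + m\<^sub>T m\<^sub>S\<close> and \<open>m\<^sub>T * l S + m\<^sub>S * l T\<close>, whose conditional expectations are finite.\<close>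

lemma time_changed_cond_covariance:
  assumes stable: "\<eta> * \<mu> < \<kappa>"
    and indep: "indep_set (sets G) (sets (hawkes_sigma M F N l))" and G: "space G = space M"
    and S: "S \<in> borel_measurable G" "\<And>\<omega>. 0 \<le> S \<omega>" and T: "T \<in> borel_measurable G" "\<And>\<omega>. 0 \<le> T \<omega>"
    and le: "AE \<omega> in M. S \<omega> \<le> T \<omega>"
  defines "\<phi> \<equiv> \<lambda>X. expectation (\<lambda>\<omega>. exp (- decay * X \<omega>))"
  shows "AE \<omega> in M. real_cond_exp M (F 0) (\<lambda>\<omega>. l (T \<omega>) \<omega>) \<omega> = (l 0 \<omega> - equilibrium) * \<phi> T + equilibrium"
    and "AE \<omega> in M. cond_covariance M (F 0) (\<lambda>\<omega>. l (T \<omega>) \<omega>) (\<lambda>\<omega>. l (S \<omega>) \<omega>) \<omega> =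
      jump_power * ((l 0 \<omega> - equilibrium) * (\<phi> T - \<phi> (\<lambda>\<omega>. T \<omega> + S \<omega>)) / decay
        + equilibrium * (\<phi> (\<lambda>\<omega>. T \<omega> - S \<omega>) - \<phi> (\<lambda>\<omega>. T \<omega> + S \<omega>)) / (2 * decay))
      + (l 0 \<omega> - equilibrium)\<^sup>2 * (\<phi> (\<lambda>\<omega>. T \<omega> + S \<omega>) - \<phi> T * \<phi> S)"
proof -
  interpret finite_measure_subalgebra M "F 0"
    by unfold_locales (use filtration_subset space_F in \<open>auto simp: subalgebra_def\<close>)
  define mS where "mS \<omega> = (l 0 \<omega> - equilibrium) * \<phi> S + equilibrium" for \<omega>
  define mT where "mT \<omega> = (l 0 \<omega> - equilibrium) * \<phi> T + equilibrium" for \<omega>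
  define q where "q \<omega> = jump_power * ((l 0 \<omega> - equilibrium) * (\<phi> T - \<phi> (\<lambda>\<omega>. T \<omega> + S \<omega>)) / decay
      + equilibrium * (\<phi> (\<lambda>\<omega>. T \<omega> - S \<omega>) - \<phi> (\<lambda>\<omega>. T \<omega> + S \<omega>)) / (2 * decay))
    + ((l 0 \<omega> - equilibrium)\<^sup>2 * \<phi> (\<lambda>\<omega>. T \<omega> + S \<omega>)
      + equilibrium * (l 0 \<omega> - equilibrium) * (\<phi> T + \<phi> S) + equilibrium\<^sup>2)" for \<omega>
  let ?X = "\<lambda>\<omega>. l (T \<omega>) \<omega>" and ?Y = "\<lambda>\<omega>. l (S \<omega>) \<omega>"
  have X_M [measurable]: "?X \<in> borel_measurable M" and Y_M [measurable]: "?Y \<in> borel_measurable M"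
    using time_changed_intensity_measurable[OF indep G] S T by auto
  have mT_F [measurable]: "mT \<in> borel_measurable (F 0)" and mS_F [measurable]: "mS \<in> borel_measurable (F 0)"
    using l_adapted[OF order_refl] unfolding mT_def mS_def by auto
  have mT_M [measurable]: "mT \<in> borel_measurable M" and mS_M [measurable]: "mS \<in> borel_measurable M"
    using measurable_F_M[OF mT_F] measurable_F_M[OF mS_F] by auto
  have X: "AE \<omega> in M. nn_cond_exp M (F 0) (\<lambda>\<omega>. ennreal (?X \<omega>)) \<omega> = ennreal (mT \<omega>)"
    and mT: "\<And>\<omega>. \<omega> \<in> space M \<Longrightarrow> 0 \<le> mT \<omega>"
    using time_changed_cond_mean[OF stable indep G T] unfolding mT_def \<phi>_def by auto
  have Y: "AE \<omega> in M. nn_cond_exp M (F 0) (\<lambda>\<omega>. ennreal (?Y \<omega>)) \<omega> = ennreal (mS \<omega>)"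
    and mS: "\<And>\<omega>. \<omega> \<in> space M \<Longrightarrow> 0 \<le> mS \<omega>"
    using time_changed_cond_mean[OF stable indep G S] unfolding mS_def \<phi>_def by auto
  have XY: "AE \<omega> in M. nn_cond_exp M (F 0) (\<lambda>\<omega>. ennreal (?Y \<omega> * ?X \<omega>)) \<omega> = ennreal (q \<omega>)"
    and q: "\<And>\<omega>. \<omega> \<in> space M \<Longrightarrow> 0 \<le> q \<omega>"
    using time_changed_cond_product[OF stable indep G S T le] unfolding q_def \<phi>_def by auto
  have nonneg: "0 \<le> ?X \<omega>" "0 \<le> ?Y \<omega>" if "\<omega> \<in> space M" for \<omega>
    using l_nonneg[OF _ that] S(2) T(2) by auto
  have mean: "AE \<omega> in M. real_cond_exp M (F 0) f \<omega> = m \<omega>"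
    if [measurable]: "f \<in> borel_measurable M" and f: "\<And>\<omega>. \<omega> \<in> space M \<Longrightarrow> 0 \<le> f \<omega>" and m: "\<And>\<omega>. \<omega> \<in> space M \<Longrightarrow> 0 \<le> m \<omega>"
      and nn: "AE \<omega> in M. nn_cond_exp M (F 0) (\<lambda>\<omega>. ennreal (f \<omega>)) \<omega> = ennreal (m \<omega>)" for f m
  proof -
    have "AE \<omega> in M. nn_cond_exp M (F 0) (\<lambda>\<omega>. ennreal 0) \<omega> = ennreal 0"
      using nn_cond_exp_F_meas[of "\<lambda>\<omega>. ennreal 0"] by (auto elim: eventually_mono)
    from real_cond_exp_diff_nonneg[OF _ _ f _ nn this m] show ?thesis
      by simp
  qed
  have mean_X: "AE \<omega> in M. real_cond_exp M (F 0) ?X \<omega> = mT \<omega>"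
    by (rule mean[OF X_M nonneg(1) mT X])
  then show "AE \<omega> in M. real_cond_exp M (F 0) ?X \<omega> = (l 0 \<omega> - equilibrium) * \<phi> T + equilibrium"
    unfolding mT_def .
  have mean_Y: "AE \<omega> in M. real_cond_exp M (F 0) ?Y \<omega> = mS \<omega>"
    by (rule mean[OF Y_M nonneg(2) mS Y])
  have "AE \<omega> in M. cond_covariance M (F 0) ?X ?Y \<omega> =
      real_cond_exp M (F 0) (\<lambda>\<omega>. (?Y \<omega> * ?X \<omega> + mT \<omega> * mS \<omega>) - (mT \<omega> * ?Y \<omega> + mS \<omega> * ?X \<omega>)) \<omega>"
    unfolding cond_covariance_def
  proof (rule real_cond_exp_cong)
    show "AE \<omega> in M. (?X \<omega> - real_cond_exp M (F 0) ?X \<omega>) * (?Y \<omega> - real_cond_exp M (F 0) ?Y \<omega>) =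
        (?Y \<omega> * ?X \<omega> + mT \<omega> * mS \<omega>) - (mT \<omega> * ?Y \<omega> + mS \<omega> * ?X \<omega>)"
      using mean_X mean_Y by eventually_elim (simp add: algebra_simps)
  qed measurable
  moreover have "AE \<omega> in M. real_cond_exp M (F 0) (\<lambda>\<omega>. (?Y \<omega> * ?X \<omega> + mT \<omega> * mS \<omega>) - (mT \<omega> * ?Y \<omega> + mS \<omega> * ?X \<omega>)) \<omega> =
      (q \<omega> + mT \<omega> * mS \<omega>) - (mT \<omega> * mS \<omega> + mS \<omega> * mT \<omega>)"
  proof (rule real_cond_exp_diff_nonneg)
    have "AE \<omega> in M. nn_cond_exp M (F 0) (\<lambda>\<omega>. ennreal (?Y \<omega> * ?X \<omega> + mT \<omega> * mS \<omega>)) \<omega> =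
        nn_cond_exp M (F 0) (\<lambda>\<omega>. ennreal (?Y \<omega> * ?X \<omega>) + ennreal (mT \<omega> * mS \<omega>)) \<omega>"
      using nonneg mT mS by (intro nn_cond_exp_cong) (auto intro!: AE_I2)
    moreover have "AE \<omega> in M. nn_cond_exp M (F 0) (\<lambda>\<omega>. ennreal (?Y \<omega> * ?X \<omega>)) \<omega> + nn_cond_exp M (F 0) (\<lambda>\<omega>. ennreal (mT \<omega> * mS \<omega>)) \<omega> =
        nn_cond_exp M (F 0) (\<lambda>\<omega>. ennreal (?Y \<omega> * ?X \<omega>) + ennreal (mT \<omega> * mS \<omega>)) \<omega>"
      by (rule nn_cond_exp_sum) measurable
    moreover have "AE \<omega> in M. ennreal (mT \<omega> * mS \<omega>) = nn_cond_exp M (F 0) (\<lambda>\<omega>. ennreal (mT \<omega> * mS \<omega>)) \<omega>"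
      by (rule nn_cond_exp_F_meas) measurable
    ultimately show "AE \<omega> in M. nn_cond_exp M (F 0) (\<lambda>\<omega>. ennreal (?Y \<omega> * ?X \<omega> + mT \<omega> * mS \<omega>)) \<omega> = ennreal (q \<omega> + mT \<omega> * mS \<omega>)"
      using XY AE_space
    proof eventually_elim
      case (elim \<omega>)
      have "nn_cond_exp M (F 0) (\<lambda>\<omega>. ennreal (?Y \<omega> * ?X \<omega> + mT \<omega> * mS \<omega>)) \<omega> =
          ennreal (q \<omega>) + ennreal (mT \<omega> * mS \<omega>)"
        using elim(1-4) by metis
      then show ?case
        using q[OF elim(5)] mT[OF elim(5)] mS[OF elim(5)] by simp
    qed
    have "AE \<omega> in M. nn_cond_exp M (F 0) (\<lambda>\<omega>. ennreal (mT \<omega> * ?Y \<omega> + mS \<omega> * ?X \<omega>)) \<omega> =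
        nn_cond_exp M (F 0) (\<lambda>\<omega>. ennreal (mT \<omega>) * ennreal (?Y \<omega>) + ennreal (mS \<omega>) * ennreal (?X \<omega>)) \<omega>"
      using nonneg mT mS by (intro nn_cond_exp_cong) (auto intro!: AE_I2 simp: ennreal_mult)
    moreover have "AE \<omega> in M. nn_cond_exp M (F 0) (\<lambda>\<omega>. ennreal (mT \<omega>) * ennreal (?Y \<omega>)) \<omega> + nn_cond_exp M (F 0) (\<lambda>\<omega>. ennreal (mS \<omega>) * ennreal (?X \<omega>)) \<omega> =
        nn_cond_exp M (F 0) (\<lambda>\<omega>. ennreal (mT \<omega>) * ennreal (?Y \<omega>) + ennreal (mS \<omega>) * ennreal (?X \<omega>)) \<omega>"
      by (rule nn_cond_exp_sum) measurable
    moreover have "AE \<omega> in M. ennreal (mT \<omega>) * nn_cond_exp M (F 0) (\<lambda>\<omega>. ennreal (?Y \<omega>)) \<omega> = nn_cond_exp M (F 0) (\<lambda>\<omega>. ennreal (mT \<omega>) * ennreal (?Y \<omega>)) \<omega>"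
      by (rule nn_cond_exp_prod) measurable
    moreover have "AE \<omega> in M. ennreal (mS \<omega>) * nn_cond_exp M (F 0) (\<lambda>\<omega>. ennreal (?X \<omega>)) \<omega> = nn_cond_exp M (F 0) (\<lambda>\<omega>. ennreal (mS \<omega>) * ennreal (?X \<omega>)) \<omega>"
      by (rule nn_cond_exp_prod) measurable
    ultimately show "AE \<omega> in M. nn_cond_exp M (F 0) (\<lambda>\<omega>. ennreal (mT \<omega> * ?Y \<omega> + mS \<omega> * ?X \<omega>)) \<omega> = ennreal (mT \<omega> * mS \<omega> + mS \<omega> * mT \<omega>)"
      using X Y AE_space
    proof eventually_elim
      case (elim \<omega>)
      have "nn_cond_exp M (F 0) (\<lambda>\<omega>. ennreal (mT \<omega> * ?Y \<omega> + mS \<omega> * ?X \<omega>)) \<omega> =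
          ennreal (mT \<omega>) * ennreal (mS \<omega>) + ennreal (mS \<omega>) * ennreal (mT \<omega>)"
        using elim(1-6) by metis
      then show ?case
        using mT[OF elim(7)] mS[OF elim(7)] by (simp add: ennreal_mult[symmetric] ennreal_plus[symmetric] del: ennreal_plus)
    qed
  qed (use nonneg mT mS q in auto)
  ultimately show "AE \<omega> in M. cond_covariance M (F 0) ?X ?Y \<omega> =
      jump_power * ((l 0 \<omega> - equilibrium) * (\<phi> T - \<phi> (\<lambda>\<omega>. T \<omega> + S \<omega>)) / decay
        + equilibrium * (\<phi> (\<lambda>\<omega>. T \<omega> - S \<omega>) - \<phi> (\<lambda>\<omega>. T \<omega> + S \<omega>)) / (2 * decay))
      + (l 0 \<omega> - equilibrium)\<^sup>2 * (\<phi> (\<lambda>\<omega>. T \<omega> + S \<omega>) - \<phi> T * \<phi> S)"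
  proof eventually_elim
    case (elim \<omega>)
    have "q \<omega> - mT \<omega> * mS \<omega> = jump_power * ((l 0 \<omega> - equilibrium) * (\<phi> T - \<phi> (\<lambda>\<omega>. T \<omega> + S \<omega>)) / decay
        + equilibrium * (\<phi> (\<lambda>\<omega>. T \<omega> - S \<omega>) - \<phi> (\<lambda>\<omega>. T \<omega> + S \<omega>)) / (2 * decay))
      + (l 0 \<omega> - equilibrium)\<^sup>2 * (\<phi> (\<lambda>\<omega>. T \<omega> + S \<omega>) - \<phi> T * \<phi> S)"
      unfolding q_def mT_def mS_def by (simp add: algebra_simps power2_eq_square)
    then show ?case
      using elim by (simp add: mult.commute)
  qed
qed

end

section \<open>The inverse subordinator\<close>

context levy_subordinator
begin

text \<open>The Levy measure is infinite, so it charges the positive half-line, where \<open>1 - exp (- x)\<close> is positive.\<close>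

lemma laplace_exponent_pos: "0 < levy_bernstein a b \<nu> 1"
proof -
  let ?g = "\<lambda>x. indicator {0<..} x *\<^sub>R (1 - exp (- 1 * x)) :: real"
  have [measurable_cong]: "sets \<nu> = sets borel"
    by (rule \<nu>_sets)
  have g_meas: "?g \<in> borel_measurable \<nu>"
    by measurable
  have g_nonneg: "0 \<le> ?g x" for x
    by (auto split: split_indicator)
  have bound: "ennreal (?g x) \<le> ennreal (min x 1) * indicator {0<..} x" for x
    using exp_ge_add_one_self[of "- x"] by (auto intro!: ennreal_leI split: split_indicator)
  have "(\<integral>\<^sup>+x. ennreal (?g x) \<partial>\<nu>) \<le> (\<integral>\<^sup>+x\<in>{0<..}. ennreal (min x 1) \<partial>\<nu>)"
    by (intro nn_integral_mono bound)
  then have "(\<integral>\<^sup>+x. ennreal (?g x) \<partial>\<nu>) < \<infinity>"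
    using \<nu>_levy by (rule le_less_trans)
  then have int: "integrable \<nu> ?g"
    using g_nonneg by (intro integrableI_nonneg g_meas AE_I2)
  have "(\<integral>x. ?g x \<partial>\<nu>) \<noteq> 0"
  proof
    assume "(\<integral>x. ?g x \<partial>\<nu>) = 0"
    then have "AE x in \<nu>. ?g x = 0"
      using integral_nonneg_eq_0_iff_AE[OF int] g_nonneg by simp
    then have "AE x in \<nu>. x \<notin> {0<..}"
      by eventually_elim (auto split: split_indicator_asm)
    moreover have "{x \<in> space \<nu>. \<not> x \<notin> {0<..}} = {0<..}"
      using sets_eq_imp_space_eq[OF \<nu>_sets] by auto
    ultimately have "emeasure \<nu> {0<..} = 0"
      by (subst (asm) AE_iff_measurable[where N = "{0<..}"]) (auto simp: \<nu>_sets)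
    moreover have "emeasure \<nu> {0..} \<le> emeasure \<nu> ({..0} \<union> {0<..})"
      by (intro emeasure_mono) (auto simp: \<nu>_sets)
    moreover have "\<dots> \<le> emeasure \<nu> {..0} + emeasure \<nu> {0<..}"
      by (intro emeasure_subadditive) (auto simp: \<nu>_sets)
    ultimately show False
      using \<nu>_half_line \<nu>_infinite by simp
  qed
  moreover have "0 \<le> (\<integral>x. ?g x \<partial>\<nu>)"
    using g_nonneg by (intro integral_nonneg_AE AE_I2)
  ultimately show ?thesis
    using a_nonneg b_nonneg unfolding levy_bernstein_def set_lebesgue_integral_def by simp
qed

text \<open>By Markov's inequality for \<open>exp (- D n)\<close>, the probability that the subordinator has not exceeded \<open>t\<close> at
  time \<open>n\<close> decays exponentially in \<open>n\<close>.\<close>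

lemma AE_exceeds: "AE \<omega> in M. \<exists>r\<ge>0. ennreal t < D r \<omega>"
proof -
  define Q where "Q = {\<omega> \<in> space M. \<forall>n::nat. D (real n) \<omega> \<le> ennreal t}"
  have D_meas [measurable]: "D (real n) \<in> borel_measurable M" for n
    by (rule D_measurable) simp
  have Q [measurable]: "Q \<in> events"
    unfolding Q_def by measurable
  let ?f = "levy_bernstein a b \<nu> 1"
  have le: "prob Q \<le> exp \<bar>t\<bar> * exp (- real n * ?f)" for n
  proof -
    let ?X = "\<lambda>\<omega>. if D (real n) \<omega> = \<infinity> then 0 else exp (- 1 * enn2real (D (real n) \<omega>))"
    have X_int: "integrable M ?X"
      by (rule integrable_const_bound[where B = 1]) (auto intro!: AE_I2)
    have "prob Q = expectation (indicator Q)"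
      by simp
    also have "\<dots> \<le> expectation (\<lambda>\<omega>. exp \<bar>t\<bar> * ?X \<omega>)"
    proof (rule integral_mono)
      show "integrable M (\<lambda>\<omega>. exp \<bar>t\<bar> * ?X \<omega>)"
        using X_int by simp
      fix \<omega> assume "\<omega> \<in> space M"
      show "indicator Q \<omega> \<le> exp \<bar>t\<bar> * ?X \<omega>"
      proof (cases "\<omega> \<in> Q")
        case True
        then have Dt: "D (real n) \<omega> \<le> ennreal t"
          by (simp add: Q_def)
        then have fin: "D (real n) \<omega> \<noteq> \<infinity>"
          by (metis ennreal_neq_top infinity_ennreal_def top.extremum_uniqueI)
        have "enn2real (D (real n) \<omega>) \<le> enn2real (ennreal t)"
          using Dt by (intro enn2real_mono) auto
        also have "\<dots> \<le> \<bar>t\<bar>"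
          by (cases "0 \<le> t") (auto simp: ennreal_neg)
        finally have "1 \<le> exp (\<bar>t\<bar> + - 1 * enn2real (D (real n) \<omega>))"
          by simp
        then show ?thesis
          using True fin by (simp add: exp_add[symmetric])
      qed simp
    qed (auto simp: emeasure_eq_measure)
    also have "\<dots> = exp \<bar>t\<bar> * exp (- real n * ?f)"
      using D_laplace[of 1 "real n"] by simp
    finally show ?thesis .
  qed
  have "(\<lambda>n. exp \<bar>t\<bar> * exp (- ?f) ^ n) \<longlonglongrightarrow> exp \<bar>t\<bar> * 0"
    using laplace_exponent_pos by (intro tendsto_intros LIMSEQ_realpow_zero) auto
  then have "(\<lambda>n. exp \<bar>t\<bar> * exp (- real n * ?f)) \<longlonglongrightarrow> 0"
    by (simp add: exp_of_nat_mult[symmetric])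
  then have "prob Q \<le> 0"
    by (rule LIMSEQ_le_const) (use le in blast)
  then have "Q \<in> null_sets M"
    using measure_nonneg[of M Q] by (auto simp: emeasure_eq_measure null_sets_def)
  then have "AE \<omega> in M. \<omega> \<notin> Q"
    by (rule AE_not_in)
  then show ?thesis
    using AE_space
  proof eventually_elim
    case (elim \<omega>)
    then obtain n :: nat where "ennreal t < D (real n) \<omega>"
      unfolding Q_def by (auto simp: not_le)
    then show ?case
      by (intro exI[of _ "real n"]) auto
  qed
qed

text \<open>Monotonicity can only fail where the infimum defining the larger time is infinite, as such a value is
  replaced by \<open>0\<close>.\<close>

lemma inverse_process_mono:
  assumes "s \<le> t"
  shows "AE \<omega> in M. inverse_process D s \<omega> \<le> inverse_process D t \<omega>"
  using AE_exceeds[of t]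
proof eventually_elim
  case (elim \<omega>)
  then obtain r where r: "0 \<le> r" "ennreal t < D r \<omega>"
    by blast
  have "(INF r\<in>{r. 0 \<le> r \<and> ennreal t < D r \<omega>}. ennreal r) \<le> ennreal r"
    using r by (intro INF_lower) auto
  then have "(INF r\<in>{r. 0 \<le> r \<and> ennreal t < D r \<omega>}. ennreal r) < top"
    using ennreal_less_top le_less_trans by blast
  moreover have "(INF r\<in>{r. 0 \<le> r \<and> ennreal s < D r \<omega>}. ennreal r) \<le> (INF r\<in>{r. 0 \<le> r \<and> ennreal t < D r \<omega>}. ennreal r)"
    using ennreal_leI[OF assms] by (intro INF_superset_mono) (auto intro: le_less_trans)
  ultimately show ?case
    unfolding inverse_process_def by (intro enn2real_mono)
qed

end

section \<open>Moments of the time-changed intensity\<close>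

theorem theorem6:
  fixes M :: "'a measure" and F :: "real \<Rightarrow> 'a measure"
    and N :: "real \<Rightarrow> 'a \<Rightarrow> nat" and l :: "real \<Rightarrow> 'a \<Rightarrow> real" and \<xi> :: "nat \<Rightarrow> 'a \<Rightarrow> real"
    and D :: "real \<Rightarrow> 'a \<Rightarrow> ennreal" and E :: "real \<Rightarrow> 'a \<Rightarrow> real" and \<nu> :: "real measure"
    and \<theta> \<eta> \<kappa> \<mu> \<psi> a b \<gamma> \<rho>\<^sub>1 \<rho>\<^sub>2 :: real
  assumes hawkes: "hawkes_process M F N l \<xi> \<theta> \<eta> \<kappa> \<mu> \<psi>"
    and subordinator: "levy_subordinator M D a b \<nu>"
    and E: "E = inverse_process D"
    and indep: "prob_space.indep_set M
                  (sets (generated_sigma (space M) {0..} E borel)) (sets (hawkes_sigma M F N l))"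
    and \<gamma>: "\<gamma> = \<kappa> - \<eta> * \<mu>" and \<gamma>_pos: "0 < \<gamma>"
    and \<rho>\<^sub>1: "\<rho>\<^sub>1 = \<eta>\<^sup>2 * (\<psi>\<^sup>2 + \<mu>\<^sup>2)"
    and \<rho>\<^sub>2: "\<rho>\<^sub>2 = \<eta>\<^sup>2 * \<kappa> * \<theta> * (\<psi>\<^sup>2 + \<mu>\<^sup>2) / (\<eta> * \<mu> - \<kappa>)"
  shows "(\<forall>t\<ge>0. AE \<omega> in M.
            real_cond_exp M (F 0) (\<lambda>\<omega>. l (E t \<omega>) \<omega>) \<omega> =
              (l 0 \<omega> - \<kappa> * \<theta> / \<gamma>) * (LINT \<omega>|M. exp (- \<gamma> * E t \<omega>)) + \<kappa> * \<theta> / \<gamma>)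
       \<and> (\<forall>t\<ge>0. AE \<omega> in M.
            cond_variance M (F 0) (\<lambda>\<omega>. l (E t \<omega>) \<omega>) \<omega> =
              (\<rho>\<^sub>1 * l 0 \<omega> + \<rho>\<^sub>2) / \<gamma> *
                ((LINT \<omega>|M. exp (- \<gamma> * E t \<omega>)) - (LINT \<omega>|M. exp (- 2 * \<gamma> * E t \<omega>)))
              + \<rho>\<^sub>2 / (2 * \<gamma>) * (LINT \<omega>|M. exp (- 2 * \<gamma> * E t \<omega>) - 1)
              + (l 0 \<omega> - \<kappa> * \<theta> / \<gamma>)\<^sup>2 * cond_variance M (F 0) (\<lambda>\<omega>. exp (- \<gamma> * E t \<omega>)) \<omega>)
       \<and> (\<forall>s t. 0 \<le> s \<longrightarrow> s \<le> t \<longrightarrow> (AE \<omega> in M.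
            cond_covariance M (F 0) (\<lambda>\<omega>. l (E t \<omega>) \<omega>) (\<lambda>\<omega>. l (E s \<omega>) \<omega>) \<omega> =
              (\<rho>\<^sub>1 * l 0 \<omega> + \<rho>\<^sub>2) / (\<eta> * \<mu> - \<kappa>) *
                (real_cond_exp M (F 0) (\<lambda>\<omega>. exp (- \<gamma> * (E t \<omega> + E s \<omega>))) \<omega>
                 - real_cond_exp M (F 0) (\<lambda>\<omega>. exp (- \<gamma> * E t \<omega>)) \<omega>)
              + \<rho>\<^sub>2 / (2 * (\<eta> * \<mu> - \<kappa>)) *
                (real_cond_exp M (F 0) (\<lambda>\<omega>. exp (- \<gamma> * (E t \<omega> - E s \<omega>))) \<omega>
                 - real_cond_exp M (F 0) (\<lambda>\<omega>. exp (- \<gamma> * (E t \<omega> + E s \<omega>))) \<omega>)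
              + (l 0 \<omega> + \<kappa> * \<theta> / (\<eta> * \<mu> - \<kappa>))\<^sup>2 *
                (real_cond_exp M (F 0) (\<lambda>\<omega>. exp (- \<gamma> * (E t \<omega> + E s \<omega>))) \<omega>
                 - real_cond_exp M (F 0) (\<lambda>\<omega>. exp (- \<gamma> * E t \<omega>)) \<omega>
                   * real_cond_exp M (F 0) (\<lambda>\<omega>. exp (- \<gamma> * E s \<omega>)) \<omega>)))"
proof -
  interpret hawkes_process M F N l \<xi> \<theta> \<eta> \<kappa> \<mu> \<psi> by (rule hawkes)
  interpret D: levy_subordinator M D a b \<nu> by (rule subordinator)
  let ?G = "generated_sigma (space M) {0..} E borel"
  let ?H = "hawkes_sigma M F N l"
  have stable: "\<eta> * \<mu> < \<kappa>"
    using \<gamma> \<gamma>_pos by simp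
  have decay: "decay = \<gamma>" and equilibrium: "equilibrium = \<kappa> * \<theta> / \<gamma>"
    and jump_power: "jump_power = \<rho>\<^sub>1" and drift: "\<eta> * \<mu> - \<kappa> = - \<gamma>"
    by (simp_all add: decay_def equilibrium_def jump_power_def \<gamma> \<rho>\<^sub>1)
  have \<rho>\<^sub>2_eq: "\<rho>\<^sub>2 = - \<rho>\<^sub>1 * (\<kappa> * \<theta> / \<gamma>)"
    unfolding \<rho>\<^sub>1 \<rho>\<^sub>2 drift using \<gamma>_pos by (simp add: field_simps)
  have G: "space ?G = space M"
    by (rule generated_sigma_measurable(1)) simp
  have E_G: "E t \<in> borel_measurable ?G" if "0 \<le> t" for t
    by (rule generated_sigma_measurable(2)) (use that in auto)
  have "subalgebra M ?G"
    using indep G by (auto simp: indep_sets2_eq subalgebra_def)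
  then have E_M: "E t \<in> borel_measurable M" if "0 \<le> t" for t
    using E_G[OF that] by (rule measurable_from_subalg)
  have E_nonneg: "0 \<le> E t \<omega>" for t \<omega>
    unfolding E inverse_process_def by simp
  have E_mono: "AE \<omega> in M. E s \<omega> \<le> E t \<omega>" if "s \<le> t" for s t
    unfolding E by (rule D.inverse_process_mono[OF that])
  interpret finite_measure_subalgebra M "F 0"
    by unfold_locales (use filtration_subset space_F in \<open>auto simp: subalgebra_def\<close>)
  have const: "AE \<omega> in M. real_cond_exp M (F 0) f \<omega> = expectation f"
    if "f \<in> borel_measurable ?G" "integrable M f" for f
    by (rule real_cond_exp_independent[OF indep G space_hawkes_sigma initial_subalgebra_hawkes that])
  have exp_const: "AE \<omega> in M. real_cond_exp M (F 0) (\<lambda>\<omega>. exp (- \<gamma> * X \<omega>)) \<omega> = expectation (\<lambda>\<omega>. exp (- \<gamma> * X \<omega>))"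
    if [measurable]: "X \<in> borel_measurable ?G" "X \<in> borel_measurable M" and X: "AE \<omega> in M. 0 \<le> X \<omega>" for X
    using exp_decay_integrable[OF stable that(2) X] unfolding decay by (intro const) auto
  have mean: "AE \<omega> in M. real_cond_exp M (F 0) (\<lambda>\<omega>. l (E t \<omega>) \<omega>) \<omega> =
      (l 0 \<omega> - \<kappa> * \<theta> / \<gamma>) * (LINT \<omega>|M. exp (- \<gamma> * E t \<omega>)) + \<kappa> * \<theta> / \<gamma>" if t: "0 \<le> t" for t
    using time_changed_cond_covariance(1)[OF stable indep G E_G[OF t] E_nonneg E_G[OF t] E_nonneg]
    unfolding decay equilibrium by simp
  have covariance: "AE \<omega> in M. cond_covariance M (F 0) (\<lambda>\<omega>. l (E t \<omega>) \<omega>) (\<lambda>\<omega>. l (E s \<omega>) \<omega>) \<omega> =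
      (\<rho>\<^sub>1 * l 0 \<omega> + \<rho>\<^sub>2) / \<gamma> * (expectation (\<lambda>\<omega>. exp (- \<gamma> * E t \<omega>)) - expectation (\<lambda>\<omega>. exp (- \<gamma> * (E t \<omega> + E s \<omega>))))
      + \<rho>\<^sub>2 / (2 * \<gamma>) * (expectation (\<lambda>\<omega>. exp (- \<gamma> * (E t \<omega> + E s \<omega>))) - expectation (\<lambda>\<omega>. exp (- \<gamma> * (E t \<omega> - E s \<omega>))))
      + (l 0 \<omega> - \<kappa> * \<theta> / \<gamma>)\<^sup>2 * (expectation (\<lambda>\<omega>. exp (- \<gamma> * (E t \<omega> + E s \<omega>)))
        - expectation (\<lambda>\<omega>. exp (- \<gamma> * E t \<omega>)) * expectation (\<lambda>\<omega>. exp (- \<gamma> * E s \<omega>)))"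
    if s: "0 \<le> s" and t: "s \<le> t" for s t
  proof -
    have t0: "0 \<le> t" using s t by simp
    have algebra: "\<rho>\<^sub>1 * ((x - c) * (A - B) / \<gamma> + c * (C - B) / (2 * \<gamma>)) =
        (\<rho>\<^sub>1 * x + - \<rho>\<^sub>1 * c) / \<gamma> * (A - B) + - \<rho>\<^sub>1 * c / (2 * \<gamma>) * (B - C)" for x c A B C :: real
      using \<gamma>_pos by (simp add: field_simps)
    show ?thesis
      using time_changed_cond_covariance(2)[OF stable indep G E_G[OF s] E_nonneg E_G[OF t0] E_nonneg E_mono[OF t]]
      unfolding decay equilibrium jump_power algebra \<rho>\<^sub>2_eq .
  qed
  have variance: "AE \<omega> in M. cond_variance M (F 0) (\<lambda>\<omega>. l (E t \<omega>) \<omega>) \<omega> =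
      (\<rho>\<^sub>1 * l 0 \<omega> + \<rho>\<^sub>2) / \<gamma> * ((LINT \<omega>|M. exp (- \<gamma> * E t \<omega>)) - (LINT \<omega>|M. exp (- 2 * \<gamma> * E t \<omega>)))
      + \<rho>\<^sub>2 / (2 * \<gamma>) * (LINT \<omega>|M. exp (- 2 * \<gamma> * E t \<omega>) - 1)
      + (l 0 \<omega> - \<kappa> * \<theta> / \<gamma>)\<^sup>2 * cond_variance M (F 0) (\<lambda>\<omega>. exp (- \<gamma> * E t \<omega>)) \<omega>" if t: "0 \<le> t" for t
  proof -
    note [measurable] = E_M[OF t] E_G[OF t]
    let ?e = "\<lambda>\<omega>. exp (- \<gamma> * E t \<omega>)" and ?e2 = "\<lambda>\<omega>. exp (- 2 * \<gamma> * E t \<omega>)"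
    have double: "exp (- \<gamma> * (E t \<omega> + E t \<omega>)) = ?e2 \<omega>" for \<omega>
      by (simp add: algebra_simps)
    have square: "(?e \<omega>)\<^sup>2 = ?e2 \<omega>" for \<omega>
      by (simp add: power2_eq_square exp_add[symmetric])
    have int: "integrable M ?e" "integrable M ?e2"
      using exp_decay_integrable[OF stable E_M[OF t]] exp_decay_integrable[OF stable, of "\<lambda>\<omega>. E t \<omega> + E t \<omega>"]
        E_nonneg unfolding decay double by auto
    have "AE \<omega> in M. cond_variance M (F 0) ?e \<omega> =
        real_cond_exp M (F 0) (\<lambda>\<omega>. (?e \<omega> - expectation ?e)\<^sup>2) \<omega>"
      unfolding cond_variance_def
    proof (rule real_cond_exp_cong)
      show "AE \<omega> in M. (?e \<omega> - real_cond_exp M (F 0) ?e \<omega>)\<^sup>2 = (?e \<omega> - expectation ?e)\<^sup>2"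
        using exp_const[OF E_G[OF t] E_M[OF t]] E_nonneg by auto
    qed measurable
    moreover have "AE \<omega> in M. real_cond_exp M (F 0) (\<lambda>\<omega>. (?e \<omega> - expectation ?e)\<^sup>2) \<omega> =
        expectation (\<lambda>\<omega>. (?e \<omega> - expectation ?e)\<^sup>2)"
    proof (rule const)
      have "(?e \<omega> - expectation ?e)\<^sup>2 = ?e2 \<omega> - 2 * expectation ?e * ?e \<omega> + (expectation ?e)\<^sup>2" for \<omega>
        unfolding power2_diff square by (simp add: mult_ac)
      then show "integrable M (\<lambda>\<omega>. (?e \<omega> - expectation ?e)\<^sup>2)"
        using int by simp
    qed measurable
    moreover have "expectation (\<lambda>\<omega>. (?e \<omega> - expectation ?e)\<^sup>2) = expectation ?e2 - expectation ?e * expectation ?e"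
      using variance_eq[of ?e] int unfolding square by (simp only: power2_eq_square)
    ultimately have var_e: "AE \<omega> in M. cond_variance M (F 0) ?e \<omega> = expectation ?e2 - expectation ?e * expectation ?e"
      by auto
    have one: "expectation (\<lambda>\<omega>. exp (- \<gamma> * (E t \<omega> - E t \<omega>))) = 1"
      by (simp add: prob_space)
    have sub: "expectation (\<lambda>\<omega>. ?e2 \<omega> - 1) = expectation ?e2 - 1"
      using int by (simp add: prob_space)
    show ?thesis
      using covariance[OF t order_refl] var_e
    proof eventually_elim
      case (elim \<omega>)
      have "cond_variance M (F 0) (\<lambda>\<omega>. l (E t \<omega>) \<omega>) \<omega> =
          cond_covariance M (F 0) (\<lambda>\<omega>. l (E t \<omega>) \<omega>) (\<lambda>\<omega>. l (E t \<omega>) \<omega>) \<omega>"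
        by (simp add: cond_variance_def cond_covariance_def power2_eq_square)
      then show ?case
        unfolding elim one double sub by simp
    qed
  qed
  have "AE \<omega> in M.
      cond_covariance M (F 0) (\<lambda>\<omega>. l (E t \<omega>) \<omega>) (\<lambda>\<omega>. l (E s \<omega>) \<omega>) \<omega> =
        (\<rho>\<^sub>1 * l 0 \<omega> + \<rho>\<^sub>2) / (\<eta> * \<mu> - \<kappa>) *
          (real_cond_exp M (F 0) (\<lambda>\<omega>. exp (- \<gamma> * (E t \<omega> + E s \<omega>))) \<omega>
           - real_cond_exp M (F 0) (\<lambda>\<omega>. exp (- \<gamma> * E t \<omega>)) \<omega>)
        + \<rho>\<^sub>2 / (2 * (\<eta> * \<mu> - \<kappa>)) *
          (real_cond_exp M (F 0) (\<lambda>\<omega>. exp (- \<gamma> * (E t \<omega> - E s \<omega>))) \<omega>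
           - real_cond_exp M (F 0) (\<lambda>\<omega>. exp (- \<gamma> * (E t \<omega> + E s \<omega>))) \<omega>)
        + (l 0 \<omega> + \<kappa> * \<theta> / (\<eta> * \<mu> - \<kappa>))\<^sup>2 *
          (real_cond_exp M (F 0) (\<lambda>\<omega>. exp (- \<gamma> * (E t \<omega> + E s \<omega>))) \<omega>
           - real_cond_exp M (F 0) (\<lambda>\<omega>. exp (- \<gamma> * E t \<omega>)) \<omega>
             * real_cond_exp M (F 0) (\<lambda>\<omega>. exp (- \<gamma> * E s \<omega>)) \<omega>)" if s: "0 \<le> s" and t: "s \<le> t" for s t
  proof -
    have t0: "0 \<le> t" using s t by simp
    note [measurable] = E_M[OF s] E_G[OF s] E_M[OF t0] E_G[OF t0]
    have "AE \<omega> in M. real_cond_exp M (F 0) (\<lambda>\<omega>. exp (- \<gamma> * (E t \<omega> + E s \<omega>))) \<omega> = expectation (\<lambda>\<omega>. exp (- \<gamma> * (E t \<omega> + E s \<omega>)))"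
      "AE \<omega> in M. real_cond_exp M (F 0) (\<lambda>\<omega>. exp (- \<gamma> * (E t \<omega> - E s \<omega>))) \<omega> = expectation (\<lambda>\<omega>. exp (- \<gamma> * (E t \<omega> - E s \<omega>)))"
      "AE \<omega> in M. real_cond_exp M (F 0) (\<lambda>\<omega>. exp (- \<gamma> * E t \<omega>)) \<omega> = expectation (\<lambda>\<omega>. exp (- \<gamma> * E t \<omega>))"
      "AE \<omega> in M. real_cond_exp M (F 0) (\<lambda>\<omega>. exp (- \<gamma> * E s \<omega>)) \<omega> = expectation (\<lambda>\<omega>. exp (- \<gamma> * E s \<omega>))"
      using E_nonneg E_mono[OF t] by (intro exp_const; simp)+
    then show ?thesis
      using covariance[OF s t]
    proof eventually_elim
      case (elim \<omega>)
      have sign: "r / - \<gamma> * (A - B) = r / \<gamma> * (B - A)" "r / (2 * - \<gamma>) * (A - B) = r / (2 * \<gamma>) * (B - A)"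
        "x + r / - \<gamma> = x - r / \<gamma>" for r A B x :: real
        using \<gamma>_pos by (simp_all add: field_simps)
      show ?case
        unfolding elim drift sign ..
    qed
  qed
  with mean variance show ?thesis
    by blast
qed

end
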